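(* Let $(M,g)$ be a 3+1 spacetime and let $T$ be a (smooth, real) traceless symmetric $(0,2)$-tensor on $(M,g)$ satisfying the strict dominant energy condition. Then the following two statements are equivalent: 1. (Rainich condition) Around each point of $M$ there is an open set $U$ and an internal square root $\omega\in\Omega^2(U;\mathfrak{sl}_2(\mathbb{C}))$ of $T$ on $U$ such that $$d\big(\operatorname{ad}^{-1}_\omega(d\omega)\big)+\omega+\bar{\omega}=\operatorname{ad}^{-1}_\omega(d\omega)\wedge\operatorname{ad}^{-1}_\omega(d\omega)\quad\text{on }U,$$ where $\operatorname{ad}_\omega\colon\Omega^1(U;\mathfrak{sl}_2(\mathbb{C}))\to\Omega^3(U;\mathfrak{sl}_2(\mathbb{C}))$ is the map $\operatorname{ad}_\omega(B)=[B,\omega]$. 2. Around each point of $M$ there is an open set $U$ and an $\operatorname{SU}(2)$ Yang-Mills field on $(U,g|_U)$ whose energy-momentum tensor is equal to $T|_U$. Moreover, whenever an internal square root $\omega$ of $T$ on an open set $U$ satisfies the Rainich condition displayed in 1, the 2-form $\omega+\bar{\omega}$ is an $\operatorname{SU}(2)$ Yang-Mills field on $(U,g|_U)$ whose energy-momentum tensor equals $T|_U$.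
   Context: Spacetime: a 3+1 spacetime $(M,g)$ is a smooth, oriented, time-oriented 4-manifold with a smooth Lorentzian metric of signature $(-,+,+,+)$; $\star$ is its Hodge star, extended complex-linearly to complex forms and acting on the form part of Lie-algebra-valued forms. Energy condition: $T$ satisfies the strict dominant energy condition if at every point, for every nonzero future-directed causal vector $v$, the vector $-T^\mu{}_\nu v^\nu$ is future-directed timelike. Chiral forms: $\Lambda^+$ and $\Lambda^-$ are the bundles of complex 2-forms $\alpha$ that are self-dual ($\star\alpha=i\alpha$), respectively anti-self-dual ($\star\alpha=-i\alpha$). Complex conjugation exchanges $\Lambda^+$ and $\Lambda^-$. Identification of $T$ with $\hat T$: a traceless symmetric $(0,2)$-tensor $T$ is canonically identified with a section $\hat T$ of $\Lambda^+\otimes\Lambda^-$ (Clebsch-Gordan decomposition), i.e. $T$ corresponds to $\hat T$ under the bundle isomorphism from $\Lambda^+\otimes\Lambda^-$ to complex traceless symmetric $(0,2)$-tensors which sends $\alpha\otimes\beta$ to the tensor $2\,\alpha_{\mu\lambda}\beta_\nu{}^{\lambda}$. Lie algebra conventions: for an $\mathfrak{sl}_2(\mathbb{C})$-valued $p$-form $\Omega=\sum_i\omega_i\otimes X_i$, its conjugate is $\bar\Omega=\sum_i\bar\omega_i\otimes\phi(X_i)$, where $\bar\omega_i$ is the usual complex conjugate and $\phi(X)=-X^\dagger$ is the (conjugate-linear) involution of $\mathfrak{sl}_2(\mathbb{C})$ whose fixed set is the compact real form $\mathfrak{su}(2)$. The matrix trace $\operatorname{tr}$ is taken in $\mathfrak{sl}_2(\mathbb{C})$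 (as $2\times2$ matrices), and for $\Omega=\sum_i\omega_i\otimes X_i$, $\Omega'=\sum_j\omega'_j\otimes Y_j$ one puts $\operatorname{tr}(\Omega\otimes\Omega')=\sum_{i,j}\operatorname{tr}(X_iY_j)\,\omega_i\otimes\omega'_j$. The bracket of Lie-algebra-valued forms is $[\Omega,\Omega']=\sum_{i,j}\omega_i\wedge\omega'_j\otimes[X_i,Y_j]$, and $\Omega\wedge\Omega'$ uses matrix multiplication of the Lie algebra parts. Internal square root: an internal square root of $T$ on an open set $U\subseteq M$ is a smooth $\mathfrak{sl}_2(\mathbb{C})$-valued self-dual 2-form $\omega$ on $U$ (that is, $\star\omega=i\omega$) with $\hat T=-\operatorname{tr}(\omega\otimes\bar\omega)$ on $U$. The symbol $\operatorname{ad}_\omega^{-1}$ denotes the inverse of the map $\operatorname{ad}_\omega$ (its invertibility is implicit in the statement). Yang-Mills: an $\operatorname{SU}(2)$ Yang-Mills field on $(U,g|_U)$ is an $\mathfrak{su}(2)$-valued 2-form $F$ that is the curvature $F=dA+A\wedge A$ of an $\mathfrak{su}(2)$-valued 1-form $A$ on $U$ (the potential) satisfying the Yang-Mills equation $D_A\star F=0$, where $D_A\Omega=d\Omega+[A,\Omega]$ for a $\mathfrak{sl}_2(\mathbb{C})$-valued 2-form $\Omega$. Its energy-momentum tensor is $T_{\mu\nu}=-\operatorname{tr}\big(F_{\mu\lambda}F_\nu{}^{\lambda}-\tfrac14 g_{\mu\nu}F_{\alpha\beta}F^{\alpha\beta}\big)$; equivalently, the corresponding section of $\Lambda^+\otimes\Lambda^-$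 is $-\operatorname{tr}(F^+\otimes F^-)$, where $F=F^++F^-$ is the decomposition into self-dual and anti-self-dual parts. *)

theory Defs
  imports "HOL-Analysis.Analysis"
begin

section \<open>Smooth maps on open subsets of \<open>real ^ 4\<close>\<close>

primrec Ck_on :: "nat \<Rightarrow> (real ^ 4 \<Rightarrow> 'b::real_normed_vector) \<Rightarrow> (real ^ 4) set \<Rightarrow> bool" where
  "Ck_on 0 f S \<longleftrightarrow> continuous_on S f"
| "Ck_on (Suc k) f S \<longleftrightarrow> f differentiable_on S \<and>
     (\<forall>i. Ck_on k (\<lambda>x. frechet_derivative f (at x) (axis i 1)) S)"

definition smooth_on :: "(real ^ 4) set \<Rightarrow> (real ^ 4 \<Rightarrow> 'b::real_normed_vector) \<Rightarrow> bool" where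
  "smooth_on S f \<longleftrightarrow> (\<forall>k. Ck_on k f S)"


section \<open>Oriented 4-manifolds\<close>

text \<open>
  A chart is a domain together with a coordinate map (relevant only on the domain).
  The underlying point set of the manifold is the union of the chart domains, an open subset of
  the ambient Hausdorff, second countable space. An orientation is given by
  an atlas all of whose transition maps have positive Jacobian determinant, the charts being
  the positively oriented ones.
\<close>

type_synonym 'm chart = "'m set \<times> ('m \<Rightarrow> real ^ 4)"

abbreviation chart_dom :: "'m chart \<Rightarrow> 'm set" where
  "chart_dom c \<equiv> fst c"

abbreviation coord :: "'m chart \<Rightarrow> 'm \<Rightarrow> real ^ 4" where
  "coord c \<equiv> snd c"

definition coord_inv :: "'m chart \<Rightarrow> real ^ 4 \<Rightarrow> 'm" where
  "coord_inv c = inv_into (chart_dom c) (coord c)"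

definition is_chart :: "('m::topological_space) chart \<Rightarrow> bool" where
  "is_chart c \<longleftrightarrow> open (chart_dom c) \<and> open (coord c ` chart_dom c) \<and>
     homeomorphism (chart_dom c) (coord c ` chart_dom c) (coord c) (coord_inv c)"

definition transition :: "'m chart \<Rightarrow> 'm chart \<Rightarrow> real ^ 4 \<Rightarrow> real ^ 4" where
  "transition c c' = coord c' \<circ> coord_inv c"

text \<open>The \<open>(a, i)\<close> entry of \<open>jacobian c c' p\<close> is the partial derivative at \<open>p\<close> of the
  \<open>a\<close>-th coordinate of \<open>c'\<close> with respect to the \<open>i\<close>-th coordinate of \<open>c\<close>.\<close>

definition jacobian :: "'m chart \<Rightarrow> 'm chart \<Rightarrow> 'm \<Rightarrow> real ^ 4 ^ 4" where
  "jacobian c c' p = matrix (frechet_derivative (transition c c') (at (coord c p)))"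

definition oriented_atlas :: "('m::topological_space) chart set \<Rightarrow> bool" where
  "oriented_atlas \<A> \<longleftrightarrow>
     (\<forall>c\<in>\<A>. is_chart c) \<and>
     (\<forall>c\<in>\<A>. \<forall>c'\<in>\<A>. smooth_on (coord c ` (chart_dom c \<inter> chart_dom c')) (transition c c')) \<and>
     (\<forall>c\<in>\<A>. \<forall>c'\<in>\<A>. \<forall>p\<in>chart_dom c \<inter> chart_dom c'. det (jacobian c c' p) > 0)"


section \<open>Spacetimes\<close>

text \<open>
  A field with components in \<open>'a\<close> assigns to every chart and every point of its domain the
  components of the field in that chart. Components of 1-forms, (0,2)-tensors, 3-forms
  with values in \<open>'v\<close> are elements of \<open>'v ^ 4\<close>, \<open>'v ^ 4 ^ 4\<close>, \<open>'v ^ 4 ^ 4 ^ 4\<close>, where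
  \<open>\<alpha> $ i $ j\<close> is the component with first index \<open>i\<close> and second index \<open>j\<close>.
\<close>

type_synonym ('m, 'a) field = "'m chart \<Rightarrow> 'm \<Rightarrow> 'a"

record 'm spacetime =
  charts :: "'m chart set"
  metric :: "('m, real ^ 4 ^ 4) field"
  time_dir :: "('m, real ^ 4) field"

definition points :: "('m, 'z) spacetime_scheme \<Rightarrow> 'm set" where
  "points M = (\<Union>c\<in>charts M. chart_dom c)"

definition smooth_field :: "('m, 'z) spacetime_scheme \<Rightarrow> 'm set \<Rightarrow>
    ('m, 'a::real_normed_vector) field \<Rightarrow> bool" where
  "smooth_field M U \<alpha> \<longleftrightarrow>
     (\<forall>c\<in>charts M. smooth_on (coord c ` (U \<inter> chart_dom c)) (\<lambda>x. \<alpha> c (coord_inv c x)))"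

text \<open>Pullback of covariant components along a linear map with matrix \<open>J\<close>.\<close>

definition pull1 :: "real ^ 4 ^ 4 \<Rightarrow> ('a::real_vector) ^ 4 \<Rightarrow> 'a ^ 4" where
  "pull1 J \<alpha> = (\<chi> i. \<Sum>a\<in>UNIV. (J $ a $ i) *\<^sub>R \<alpha> $ a)"

definition pull2 :: "real ^ 4 ^ 4 \<Rightarrow> ('a::real_vector) ^ 4 ^ 4 \<Rightarrow> 'a ^ 4 ^ 4" where
  "pull2 J \<alpha> = (\<chi> i j. \<Sum>a\<in>UNIV. \<Sum>b\<in>UNIV. (J $ a $ i * J $ b $ j) *\<^sub>R \<alpha> $ a $ b)"

definition pull3 :: "real ^ 4 ^ 4 \<Rightarrow> ('a::real_vector) ^ 4 ^ 4 ^ 4 \<Rightarrow> 'a ^ 4 ^ 4 ^ 4" where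
  "pull3 J \<alpha> = (\<chi> i j k. \<Sum>a\<in>UNIV. \<Sum>b\<in>UNIV. \<Sum>c\<in>UNIV.
      (J $ a $ i * J $ b $ j * J $ c $ k) *\<^sub>R \<alpha> $ a $ b $ c)"

text \<open>The classical tensor transformation law, on a subset \<open>U\<close>, for the given pullback \<open>P\<close>.\<close>

definition covariant :: "(real ^ 4 ^ 4 \<Rightarrow> 'a \<Rightarrow> 'a) \<Rightarrow> ('m, 'z) spacetime_scheme \<Rightarrow> 'm set \<Rightarrow>
    ('m, 'a) field \<Rightarrow> bool" where
  "covariant P M U \<alpha> \<longleftrightarrow> (\<forall>c\<in>charts M. \<forall>c'\<in>charts M. \<forall>p\<in>U \<inter> chart_dom c \<inter> chart_dom c'.
      \<alpha> c p = P (jacobian c c' p) (\<alpha> c' p))"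

text \<open>The index \<open>0 :: 4\<close> is the time index; signature (-,+,+,+).\<close>

definition minkowski :: "real ^ 4 ^ 4" where
  "minkowski = (\<chi> i j. if i = j then (if i = 0 then - 1 else 1) else 0)"

definition lorentzian :: "real ^ 4 ^ 4 \<Rightarrow> bool" where
  "lorentzian G \<longleftrightarrow> (\<exists>P. invertible P \<and> transpose P ** G ** P = minkowski)"

definition inner_prod :: "real ^ 4 ^ 4 \<Rightarrow> real ^ 4 \<Rightarrow> real ^ 4 \<Rightarrow> real" where
  "inner_prod G v w = v \<bullet> (G *v w)"

text \<open>The time orientation is given by a continuous timelike vector field, declared to be
  future-directed.\<close>

definition is_spacetime ::
    "('m::{t2_space, second_countable_topology}, 'z) spacetime_scheme \<Rightarrow> bool" where
  "is_spacetime M \<longleftrightarrow>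
     oriented_atlas (charts M) \<and>
     covariant pull2 M (points M) (metric M) \<and> smooth_field M (points M) (metric M) \<and>
     (\<forall>c\<in>charts M. \<forall>p\<in>chart_dom c. lorentzian (metric M c p)) \<and>
     (\<forall>c\<in>charts M. \<forall>c'\<in>charts M. \<forall>p\<in>chart_dom c \<inter> chart_dom c'.
        time_dir M c' p = jacobian c c' p *v time_dir M c p) \<and>
     (\<forall>c\<in>charts M. continuous_on (chart_dom c) (time_dir M c)) \<and>
     (\<forall>c\<in>charts M. \<forall>p\<in>chart_dom c.
        inner_prod (metric M c p) (time_dir M c p) (time_dir M c p) < 0)"

text \<open>Below, \<open>G\<close> is the matrix of the metric, \<open>t\<close> the components of the
  time-orienting vector, both at one point and in one chart.\<close>

definition future_causal :: "real ^ 4 ^ 4 \<Rightarrow> real ^ 4 \<Rightarrow> real ^ 4 \<Rightarrow> bool" where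
  "future_causal G t v \<longleftrightarrow> v \<noteq> 0 \<and> inner_prod G v v \<le> 0 \<and> inner_prod G v t < 0"

definition future_timelike :: "real ^ 4 ^ 4 \<Rightarrow> real ^ 4 \<Rightarrow> real ^ 4 \<Rightarrow> bool" where
  "future_timelike G t v \<longleftrightarrow> inner_prod G v v < 0 \<and> inner_prod G v t < 0"

definition traceless_symmetric_tensor :: "('m, 'z) spacetime_scheme \<Rightarrow>
    ('m, real ^ 4 ^ 4) field \<Rightarrow> bool" where
  "traceless_symmetric_tensor M T \<longleftrightarrow>
     covariant pull2 M (points M) T \<and> smooth_field M (points M) T \<and>
     (\<forall>c\<in>charts M. \<forall>p\<in>chart_dom c.
        transpose (T c p) = T c p \<and>
        (\<Sum>i\<in>UNIV. \<Sum>j\<in>UNIV. matrix_inv (metric M c p) $ i $ j * T c p $ i $ j) = 0)"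

definition strict_DEC :: "('m, 'z) spacetime_scheme \<Rightarrow> ('m, real ^ 4 ^ 4) field \<Rightarrow> bool" where
  "strict_DEC M T \<longleftrightarrow> (\<forall>c\<in>charts M. \<forall>p\<in>chart_dom c. \<forall>v.
     future_causal (metric M c p) (time_dir M c p) v \<longrightarrow>
     future_timelike (metric M c p) (time_dir M c p)
       (- ((matrix_inv (metric M c p) ** T c p) *v v)))"


section \<open>Differential forms with values in 2 by 2 matrices\<close>

type_synonym cmat2 = "complex ^ 2 ^ 2"

definition sl2 :: "cmat2 set" where
  "sl2 = {X. trace X = 0}"

text \<open>The involution sending \<open>X\<close> to minus its conjugate transpose.\<close>

definition phi :: "cmat2 \<Rightarrow> cmat2" where
  "phi X = (\<chi> i j. - cnj (X $ j $ i))"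

definition su2 :: "cmat2 set" where
  "su2 = {X \<in> sl2. phi X = X}"

text \<open>
  The spaces of smooth forms of degree 1, 2, 3 on \<open>U\<close> with values in \<open>V\<close>. In order that forms
  on \<open>U\<close> be determined by their values on \<open>U\<close>, the components are required to vanish where they
  carry no meaning.
\<close>

definition off_zero :: "('m, 'z) spacetime_scheme \<Rightarrow> 'm set \<Rightarrow> ('m, 'a::zero) field \<Rightarrow> bool" where
  "off_zero M U \<alpha> \<longleftrightarrow> (\<forall>c p. \<not> (c \<in> charts M \<and> p \<in> U \<inter> chart_dom c) \<longrightarrow> \<alpha> c p = 0)"

definition alternating2 :: "('a::real_vector) ^ 4 ^ 4 \<Rightarrow> bool" where
  "alternating2 \<alpha> \<longleftrightarrow> (\<forall>i j. \<alpha> $ i $ j = - \<alpha> $ j $ i)"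

definition alternating3 :: "('a::real_vector) ^ 4 ^ 4 ^ 4 \<Rightarrow> bool" where
  "alternating3 \<alpha> \<longleftrightarrow>
     (\<forall>i j k. \<alpha> $ i $ j $ k = - \<alpha> $ j $ i $ k \<and> \<alpha> $ i $ j $ k = - \<alpha> $ i $ k $ j)"

definition forms1 :: "('m, 'z) spacetime_scheme \<Rightarrow> 'm set \<Rightarrow> ('v::real_normed_vector) set \<Rightarrow>
    ('m, 'v ^ 4) field set" where
  "forms1 M U V = {\<alpha>. off_zero M U \<alpha> \<and> covariant pull1 M U \<alpha> \<and> smooth_field M U \<alpha> \<and>
     (\<forall>c p i. \<alpha> c p $ i \<in> V)}"

definition forms2 :: "('m, 'z) spacetime_scheme \<Rightarrow> 'm set \<Rightarrow> ('v::real_normed_vector) set \<Rightarrow>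
    ('m, 'v ^ 4 ^ 4) field set" where
  "forms2 M U V = {\<alpha>. off_zero M U \<alpha> \<and> covariant pull2 M U \<alpha> \<and> smooth_field M U \<alpha> \<and>
     (\<forall>c p. alternating2 (\<alpha> c p)) \<and> (\<forall>c p i j. \<alpha> c p $ i $ j \<in> V)}"

definition forms3 :: "('m, 'z) spacetime_scheme \<Rightarrow> 'm set \<Rightarrow> ('v::real_normed_vector) set \<Rightarrow>
    ('m, 'v ^ 4 ^ 4 ^ 4) field set" where
  "forms3 M U V = {\<alpha>. off_zero M U \<alpha> \<and> covariant pull3 M U \<alpha> \<and> smooth_field M U \<alpha> \<and>
     (\<forall>c p. alternating3 (\<alpha> c p)) \<and> (\<forall>c p i j k. \<alpha> c p $ i $ j $ k \<in> V)}"

definition chart_partial :: "'m chart \<Rightarrow> ('m \<Rightarrow> 'b::real_normed_vector) \<Rightarrow> 'm \<Rightarrow> 4 \<Rightarrow> 'b" where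
  "chart_partial c f p i = frechet_derivative (f \<circ> coord_inv c) (at (coord c p)) (axis i 1)"

definition ext_d1 :: "('m, 'z) spacetime_scheme \<Rightarrow> 'm set \<Rightarrow>
    ('m, ('v::real_normed_vector) ^ 4) field \<Rightarrow> ('m, 'v ^ 4 ^ 4) field" where
  "ext_d1 M U \<alpha> = (\<lambda>c p. if c \<in> charts M \<and> p \<in> U \<inter> chart_dom c
     then (\<chi> i j. chart_partial c (\<lambda>q. \<alpha> c q $ j) p i - chart_partial c (\<lambda>q. \<alpha> c q $ i) p j)
     else 0)"

definition ext_d2 :: "('m, 'z) spacetime_scheme \<Rightarrow> 'm set \<Rightarrow>
    ('m, ('v::real_normed_vector) ^ 4 ^ 4) field \<Rightarrow> ('m, 'v ^ 4 ^ 4 ^ 4) field" where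
  "ext_d2 M U \<alpha> = (\<lambda>c p. if c \<in> charts M \<and> p \<in> U \<inter> chart_dom c
     then (\<chi> i j k. chart_partial c (\<lambda>q. \<alpha> c q $ j $ k) p i
                  + chart_partial c (\<lambda>q. \<alpha> c q $ k $ i) p j
                  + chart_partial c (\<lambda>q. \<alpha> c q $ i $ j) p k)
     else 0)"

text \<open>
  Wedge products of components with respect to a bilinear product \<open>m\<close> of the values,
  normalised so that the wedge product of two 1-forms has components
  \<open>\<alpha>\<^sub>i \<beta>\<^sub>j - \<alpha>\<^sub>j \<beta>\<^sub>i\<close>.
\<close>

definition wedge11 :: "('a \<Rightarrow> 'a \<Rightarrow> 'a::real_vector) \<Rightarrow> 'a ^ 4 \<Rightarrow> 'a ^ 4 \<Rightarrow> 'a ^ 4 ^ 4" where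
  "wedge11 m \<alpha> \<beta> = (\<chi> i j. m (\<alpha> $ i) (\<beta> $ j) - m (\<alpha> $ j) (\<beta> $ i))"

definition wedge12 :: "('a \<Rightarrow> 'a \<Rightarrow> 'a::real_vector) \<Rightarrow> 'a ^ 4 \<Rightarrow> 'a ^ 4 ^ 4 \<Rightarrow> 'a ^ 4 ^ 4 ^ 4" where
  "wedge12 m \<alpha> \<beta> = (\<chi> i j k. m (\<alpha> $ i) (\<beta> $ j $ k) + m (\<alpha> $ j) (\<beta> $ k $ i)
     + m (\<alpha> $ k) (\<beta> $ i $ j))"

definition commutator :: "cmat2 \<Rightarrow> cmat2 \<Rightarrow> cmat2" where
  "commutator X Y = X ** Y - Y ** X"

definition bracket12 :: "('m, cmat2 ^ 4) field \<Rightarrow> ('m, cmat2 ^ 4 ^ 4) field \<Rightarrow>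
    ('m, cmat2 ^ 4 ^ 4 ^ 4) field" where
  "bracket12 B \<Omega> = (\<lambda>c p. wedge12 commutator (B c p) (\<Omega> c p))"

definition conj2 :: "('m, cmat2 ^ 4 ^ 4) field \<Rightarrow> ('m, cmat2 ^ 4 ^ 4) field" where
  "conj2 \<Omega> = (\<lambda>c p. \<chi> i j. phi (\<Omega> c p $ i $ j))"


section \<open>Hodge star and chiral forms\<close>

text \<open>The Levi-Civita symbol, \<open>levi_civita 0 1 2 3 = 1\<close>.\<close>

definition levi_civita :: "4 \<Rightarrow> 4 \<Rightarrow> 4 \<Rightarrow> 4 \<Rightarrow> real" where
  "levi_civita i j k l =
     det (\<chi> r. axis (if r = 0 then i else if r = 1 then j else if r = 2 then k else l) 1
       :: real ^ 4 ^ 4)"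

text \<open>
  The Hodge star on 2-forms at a point: half the contraction of the form, with both indices
  raised, with the first two indices of the volume form. This is the convention in which
  \<open>\<alpha> \<and> \<star>\<beta>\<close> is the inner product of \<open>\<alpha>\<close> and \<open>\<beta>\<close> times the volume form, and \<open>\<star>\<star> = -1\<close>.
\<close>

definition hodge :: "real ^ 4 ^ 4 \<Rightarrow> ('a::real_vector) ^ 4 ^ 4 \<Rightarrow> 'a ^ 4 ^ 4" where
  "hodge G \<beta> = (\<chi> i j. \<Sum>k\<in>UNIV. \<Sum>l\<in>UNIV. \<Sum>a\<in>UNIV. \<Sum>b\<in>UNIV.
     (1 / 2 * sqrt \<bar>det G\<bar> * levi_civita a b i j
        * matrix_inv G $ a $ k * matrix_inv G $ b $ l) *\<^sub>R \<beta> $ k $ l)"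

definition hodge_star :: "('m, 'z) spacetime_scheme \<Rightarrow> ('m, ('a::real_vector) ^ 4 ^ 4) field \<Rightarrow>
    ('m, 'a ^ 4 ^ 4) field" where
  "hodge_star M \<beta> = (\<lambda>c p. hodge (metric M c p) (\<beta> c p))"

definition Lambda_plus :: "real ^ 4 ^ 4 \<Rightarrow> (complex ^ 4 ^ 4) set" where
  "Lambda_plus G = {\<alpha>. alternating2 \<alpha> \<and> (\<forall>i j. hodge G \<alpha> $ i $ j = \<i> * \<alpha> $ i $ j)}"

definition Lambda_minus :: "real ^ 4 ^ 4 \<Rightarrow> (complex ^ 4 ^ 4) set" where
  "Lambda_minus G = {\<alpha>. alternating2 \<alpha> \<and> (\<forall>i j. hodge G \<alpha> $ i $ j = - \<i> * \<alpha> $ i $ j)}"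

text \<open>The fibre of \<open>\<Lambda>\<^sup>+ \<otimes> \<Lambda>\<^sup>-\<close>, realised as the rank 4 tensors that are self-dual in
  the first and anti-self-dual in the second pair of indices.\<close>

definition Lambda_plus_minus :: "real ^ 4 ^ 4 \<Rightarrow> (complex ^ 4 ^ 4 ^ 4 ^ 4) set" where
  "Lambda_plus_minus G = {S.
     (\<forall>n k. (\<chi> m l. S $ m $ l $ n $ k) \<in> Lambda_plus G) \<and>
     (\<forall>m l. S $ m $ l \<in> Lambda_minus G)}"

text \<open>The linear map sending \<open>\<alpha> \<otimes> \<beta>\<close> to twice the contraction of the second index of \<open>\<alpha>\<close> with the
  second index of \<open>\<beta>\<close>.\<close>

definition clebsch_gordan :: "real ^ 4 ^ 4 \<Rightarrow> complex ^ 4 ^ 4 ^ 4 ^ 4 \<Rightarrow> complex ^ 4 ^ 4" where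
  "clebsch_gordan G S = (\<chi> m n. 2 * (\<Sum>l\<in>UNIV. \<Sum>k\<in>UNIV.
     complex_of_real (matrix_inv G $ k $ l) * S $ m $ l $ n $ k))"

text \<open>\<open>S\<close> is the element of \<open>\<Lambda>\<^sup>+ \<otimes> \<Lambda>\<^sup>-\<close> identified with the traceless symmetric tensor \<open>t\<close>.\<close>

definition corresponds :: "real ^ 4 ^ 4 \<Rightarrow> real ^ 4 ^ 4 \<Rightarrow> complex ^ 4 ^ 4 ^ 4 ^ 4 \<Rightarrow> bool" where
  "corresponds G t S \<longleftrightarrow> S \<in> Lambda_plus_minus G \<and>
     clebsch_gordan G S = (\<chi> m n. complex_of_real (t $ m $ n))"

definition trace_tensor :: "cmat2 ^ 4 ^ 4 \<Rightarrow> cmat2 ^ 4 ^ 4 \<Rightarrow> complex ^ 4 ^ 4 ^ 4 ^ 4" where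
  "trace_tensor \<Omega> \<Omega>' = (\<chi> m l n k. trace (\<Omega> $ m $ l ** \<Omega>' $ n $ k))"


section \<open>Internal square roots and Yang-Mills fields\<close>

definition self_dual :: "('m, 'z) spacetime_scheme \<Rightarrow> 'm set \<Rightarrow> ('m, cmat2 ^ 4 ^ 4) field \<Rightarrow> bool"
  where
  "self_dual M U \<Omega> \<longleftrightarrow> (\<forall>c\<in>charts M. \<forall>p\<in>U \<inter> chart_dom c. \<forall>i j r s.
     hodge_star M \<Omega> c p $ i $ j $ r $ s = \<i> * \<Omega> c p $ i $ j $ r $ s)"

definition internal_sqrt :: "('m, 'z) spacetime_scheme \<Rightarrow> 'm set \<Rightarrow> ('m, real ^ 4 ^ 4) field \<Rightarrow>
    ('m, cmat2 ^ 4 ^ 4) field \<Rightarrow> bool" where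
  "internal_sqrt M U T \<omega> \<longleftrightarrow> \<omega> \<in> forms2 M U sl2 \<and> self_dual M U \<omega> \<and>
     (\<forall>c\<in>charts M. \<forall>p\<in>U \<inter> chart_dom c.
        corresponds (metric M c p) (T c p) (- trace_tensor (\<omega> c p) (conj2 \<omega> c p)))"

definition ad :: "('m, cmat2 ^ 4 ^ 4) field \<Rightarrow> ('m, cmat2 ^ 4) field \<Rightarrow>
    ('m, cmat2 ^ 4 ^ 4 ^ 4) field" where
  "ad \<omega> B = bracket12 B \<omega>"

text \<open>The inverse of the map \<open>ad \<omega>\<close> from 1-forms to 3-forms on \<open>U\<close>; only
  meaningful where this map is a bijection.\<close>

definition ad_inv :: "('m, 'z) spacetime_scheme \<Rightarrow> 'm set \<Rightarrow> ('m, cmat2 ^ 4 ^ 4) field \<Rightarrow>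
    ('m, cmat2 ^ 4 ^ 4 ^ 4) field \<Rightarrow> ('m, cmat2 ^ 4) field" where
  "ad_inv M U \<omega> = inv_into (forms1 M U sl2) (ad \<omega>)"

definition rainich :: "('m, 'z) spacetime_scheme \<Rightarrow> 'm set \<Rightarrow> ('m, cmat2 ^ 4 ^ 4) field \<Rightarrow> bool"
  where
  "rainich M U \<omega> \<longleftrightarrow>
     (\<forall>c\<in>charts M. \<forall>p\<in>U \<inter> chart_dom c.
        ext_d1 M U (ad_inv M U \<omega> (ext_d2 M U \<omega>)) c p + \<omega> c p + conj2 \<omega> c p
        = wedge11 (**) (ad_inv M U \<omega> (ext_d2 M U \<omega>) c p) (ad_inv M U \<omega> (ext_d2 M U \<omega>) c p))"

definition curvature :: "('m, 'z) spacetime_scheme \<Rightarrow> 'm set \<Rightarrow> ('m, cmat2 ^ 4) field \<Rightarrow>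
    ('m, cmat2 ^ 4 ^ 4) field" where
  "curvature M U A = (\<lambda>c p. ext_d1 M U A c p + wedge11 (**) (A c p) (A c p))"

definition cov_d2 :: "('m, 'z) spacetime_scheme \<Rightarrow> 'm set \<Rightarrow> ('m, cmat2 ^ 4) field \<Rightarrow>
    ('m, cmat2 ^ 4 ^ 4) field \<Rightarrow> ('m, cmat2 ^ 4 ^ 4 ^ 4) field" where
  "cov_d2 M U A \<Omega> = (\<lambda>c p. ext_d2 M U \<Omega> c p + bracket12 A \<Omega> c p)"

definition yang_mills_field :: "('m, 'z) spacetime_scheme \<Rightarrow> 'm set \<Rightarrow>
    ('m, cmat2 ^ 4 ^ 4) field \<Rightarrow> bool" where
  "yang_mills_field M U F \<longleftrightarrow> F \<in> forms2 M U su2 \<and>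
     (\<exists>A\<in>forms1 M U su2. \<forall>c\<in>charts M. \<forall>p\<in>U \<inter> chart_dom c.
        F c p = curvature M U A c p \<and> cov_d2 M U A (hodge_star M F) c p = 0)"

definition em_tensor :: "real ^ 4 ^ 4 \<Rightarrow> cmat2 ^ 4 ^ 4 \<Rightarrow> complex ^ 4 ^ 4" where
  "em_tensor G F = (\<chi> m n. - trace
     ((\<Sum>l\<in>UNIV. \<Sum>k\<in>UNIV. matrix_inv G $ k $ l *\<^sub>R (F $ m $ l ** F $ n $ k))
      - (1 / 4 * G $ m $ n) *\<^sub>R
        (\<Sum>a\<in>UNIV. \<Sum>b\<in>UNIV. \<Sum>k\<in>UNIV. \<Sum>l\<in>UNIV.
           (matrix_inv G $ a $ k * matrix_inv G $ b $ l) *\<^sub>R (F $ a $ b ** F $ k $ l))))"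

definition has_em_tensor :: "('m, 'z) spacetime_scheme \<Rightarrow> 'm set \<Rightarrow> ('m, cmat2 ^ 4 ^ 4) field \<Rightarrow>
    ('m, real ^ 4 ^ 4) field \<Rightarrow> bool" where
  "has_em_tensor M U F T \<longleftrightarrow> (\<forall>c\<in>charts M. \<forall>p\<in>U \<inter> chart_dom c. \<forall>m n.
     em_tensor (metric M c p) (F c p) $ m $ n = complex_of_real (T c p $ m $ n))"

end

theory Submission
  imports Defs
begin

text \<open>
  In an orthonormal frame a self-dual form is determined by its components \<open>\<omega>\<^sub>0\<^sub>i\<close>, and \<open>T\<close> evaluated on
  two null vectors is the square norm of the contraction of \<open>\<omega>\<close> with the product of their spinors.
  Since every symmetric spinor is such a product, the strict dominant energy condition forces
  the three \<open>\<omega>\<^sub>0\<^sub>i\<close> to be a basis of \<open>sl2\<close>, and then \<open>[B, \<omega>] = 0\<close> implies \<open>B = 0\<close>. Both sides have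
  dimension 12, so Cramer's rule inverts \<open>ad \<omega>\<close> smoothly.

  For \<open>A = - ad\<^sub>\<omega>\<^sup>-\<^sup>1 (d\<omega>)\<close> the equation \<open>D\<^sub>A \<omega> = 0\<close> holds by construction and the Rainich condition says that
  the curvature of \<open>A\<close> is \<open>F = \<omega> + \<omega>'\<close>, with \<open>\<omega>'\<close> the conjugate of \<open>\<omega>\<close>. The Bianchi identity gives
  \<open>D\<^sub>A \<omega>' = 0\<close>, and comparison with the conjugate of \<open>D\<^sub>A \<omega> = 0\<close> shows that \<open>A\<close> is real. Conversely the
  self-dual part of a Yang-Mills field is covariantly constant, which identifies
  \<open>ad\<^sub>\<omega>\<^sup>-\<^sup>1 (d\<omega>)\<close> with \<open>- A\<close>.
\<close>

section \<open>Smooth maps\<close>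

text \<open>\<open>ad_inv\<close> inverts \<open>ad \<omega>\<close> on forms over all of U, so
  linear algebra at a point is not enough: the pointwise solutions must form a smooth field which
  obeys the tensor transformation law, and the exterior derivative of \<omega> must be shown to
  belong to the target space in the same full sense. Uniqueness of the pointwise solution gives the
  transformation law. Solving the linear system in the given coordinates gives smoothness without
  any smooth orthonormal frame; such frames are used at single points only. This is possible because
  every pointwise notion is invariant under pullback: the metric contractions under all invertible
  matrices, the star under those of positive determinant, which is why frames are taken oriented.
  Time orientation of a frame is never arranged; a sign accounts for it where the energy condition
  is applied.\<close>

abbreviation partial :: "4 \<Rightarrow> (real ^ 4 \<Rightarrow> 'b::real_normed_vector) \<Rightarrow> real ^ 4 \<Rightarrow> 'b" where
  "partial i f x \<equiv> frechet_derivative f (at x) (axis i 1)"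

text \<open>\<open>frechet_derivative\<close> is a choice, so it is enough that both maps have the
  same set of derivatives at x; this covers points without differentiability as well.\<close>

lemma frechet_derivative_cong_open:
  assumes "open S" "x \<in> S" "\<And>y. y \<in> S \<Longrightarrow> f y = g y"
  shows "frechet_derivative f (at x) = frechet_derivative g (at x)"
proof -
  have "(f has_derivative D) (at x) \<longleftrightarrow> (g has_derivative D) (at x)" for D
    using assms has_derivative_transform_within_open[of f D x UNIV S g]
      has_derivative_transform_within_open[of g D x UNIV S f] by auto
  then show ?thesis by (simp add: frechet_derivative_def)
qed

lemma partial_eqI: "(f has_derivative D) (at x) \<Longrightarrow> partial i f x = D (axis i 1)"
  using frechet_derivative_at by metis

lemma Ck_on_cong:
  assumes "open S" "\<And>x. x \<in> S \<Longrightarrow> f x = g x" "Ck_on k f S"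
  shows "Ck_on k g S"
  using assms(2,3)
proof (induction k arbitrary: f g)
  case 0
  then show ?case using continuous_on_cong[of S S f g] by auto
next
  case (Suc k)
  have "g differentiable_on S"
    unfolding differentiable_on_eq_differentiable_at[OF assms(1)] differentiable_def
  proof
    fix x assume x: "x \<in> S"
    then obtain D where "(f has_derivative D) (at x)"
      using Suc.prems(2) assms(1) by (auto simp: differentiable_on_eq_differentiable_at differentiable_def)
    then show "\<exists>D. (g has_derivative D) (at x)"
      using has_derivative_transform_within_open[OF _ assms(1) x] Suc.prems(1) by blast
  qed
  moreover have "Ck_on k (partial i g) S" for i
    by (rule Suc.IH[of "partial i f"])
      (use Suc.prems in \<open>auto simp: frechet_derivative_cong_open[OF assms(1) _ Suc.prems(1)]\<close>)
  ultimately show ?case by simp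
qed

lemma Ck_on_subset:
  assumes "T \<subseteq> S" "Ck_on k f S"
  shows "Ck_on k f T"
  using assms(2)
proof (induction k arbitrary: f)
  case 0
  then show ?case using assms(1) continuous_on_subset by auto
next
  case (Suc k)
  then show ?case using assms(1) differentiable_on_subset by auto
qed

lemma Ck_on_Suc_imp: "Ck_on (Suc k) f S \<Longrightarrow> Ck_on k f S"
proof (induction k arbitrary: f)
  case 0
  then show ?case by (simp add: differentiable_imp_continuous_on)
next
  case (Suc k)
  have "Ck_on k (partial i f) S" for i
    using Suc.prems by (intro Suc.IH) simp
  then show ?case using Suc.prems by simp
qed

text \<open>Lets a derivative obtained from the usual rules replace the chosen one in the recursion,
  so that each closure property reduces to a formula for its derivative.\<close>

lemma Ck_on_SucI:
  assumes "open S" "\<And>x. x \<in> S \<Longrightarrow> (f has_derivative D x) (at x)"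
    "\<And>i. Ck_on k (\<lambda>x. D x (axis i 1)) S"
  shows "Ck_on (Suc k) f S"
proof -
  have "Ck_on k (partial i f) S" for i
    by (rule Ck_on_cong[OF assms(1) _ assms(3)[of i]]) (use assms(2) partial_eqI in metis)
  moreover have "f differentiable_on S"
    by (meson assms(2) differentiable_at_imp_differentiable_on differentiable_def)
  ultimately show ?thesis by simp
qed

lemma Ck_on_has_derivative:
  assumes "open S" "Ck_on (Suc k) f S" "x \<in> S"
  shows "(f has_derivative frechet_derivative f (at x)) (at x)"
  using assms by (simp add: differentiable_on_eq_differentiable_at frechet_derivative_works)

lemma Ck_on_const: "Ck_on k (\<lambda>x. a) S"
  by (induction k arbitrary: a) simp_all

lemma Ck_on_linear:
  assumes "bounded_linear h" "open S" "Ck_on k f S"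
  shows "Ck_on k (\<lambda>x. h (f x)) S"
  using assms(3)
proof (induction k arbitrary: f)
  case 0
  then show ?case using bounded_linear.continuous_on[OF assms(1)] by simp
next
  case (Suc k)
  show ?case
    by (rule Ck_on_SucI[OF assms(2) bounded_linear.has_derivative[OF assms(1)
            Ck_on_has_derivative[OF assms(2) Suc.prems]]])
      (use Suc in auto)
qed

lemma Ck_on_add:
  assumes "open S" "Ck_on k f S" "Ck_on k g S"
  shows "Ck_on k (\<lambda>x. f x + g x) S"
  using assms(2,3)
proof (induction k arbitrary: f g)
  case 0
  then show ?case by (simp add: continuous_on_add)
next
  case (Suc k)
  show ?case
    by (rule Ck_on_SucI[OF assms(1) has_derivative_add[OF
            Ck_on_has_derivative[OF assms(1) Suc.prems(1)] Ck_on_has_derivative[OF assms(1) Suc.prems(2)]]])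
      (use Suc in auto)
qed

lemma Ck_on_bilinear:
  assumes "bounded_bilinear h" "open S" "Ck_on k f S" "Ck_on k g S"
  shows "Ck_on k (\<lambda>x. h (f x) (g x)) S"
  using assms(3,4)
proof (induction k arbitrary: f g)
  case 0
  then show ?case using bounded_bilinear.continuous_on[OF assms(1)] by simp
next
  case (Suc k)
  show ?case
  proof (rule Ck_on_SucI[OF assms(2) bounded_bilinear.FDERIV[OF assms(1)
          Ck_on_has_derivative[OF assms(2) Suc.prems(1)] Ck_on_has_derivative[OF assms(2) Suc.prems(2)]]])
    show "Ck_on k (\<lambda>x. h (f x) (partial i g x) + h (partial i f x) (g x)) S" for i
      \<comment> \<open>In each term of the product rule one factor stays undifferentiated; it is of
        class Suc k and is used here only as a factor of class k.\<close>
      using Suc.prems Ck_on_Suc_imp[OF Suc.prems(1)] Ck_on_Suc_imp[OF Suc.prems(2)]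
      by (intro Ck_on_add Suc.IH assms) auto
  qed
qed

lemma Ck_on_inverse:
  fixes f :: "real ^ 4 \<Rightarrow> 'b::real_normed_field"
  assumes "open S" "\<And>x. x \<in> S \<Longrightarrow> f x \<noteq> 0" "Ck_on k f S"
  shows "Ck_on k (\<lambda>x. inverse (f x)) S"
  using assms(3)
proof (induction k)
  case 0
  then show ?case using assms(2) by (simp add: continuous_on_inverse)
next
  case (Suc k)
  \<comment> \<open>The derivative of the inverse contains the inverse itself, which the induction
    hypothesis supplies one order lower.\<close>
  have "Ck_on k (\<lambda>x. inverse (f x)) S" using Suc Ck_on_Suc_imp by blast
  then have "Ck_on k (\<lambda>x. - (inverse (f x) * partial i f x * inverse (f x))) S" for i
    using Suc.prems
    by (intro Ck_on_linear[OF bounded_linear_minus[OF bounded_linear_ident]]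
        Ck_on_bilinear[OF bounded_bilinear_mult] assms) auto
  then show ?case
    by (intro Ck_on_SucI[OF assms(1) Deriv.has_derivative_inverse[OF assms(2)
            Ck_on_has_derivative[OF assms(1) Suc.prems]]])
qed

lemma Ck_on_sqrt:
  fixes f :: "real ^ 4 \<Rightarrow> real"
  assumes "open S" "\<And>x. x \<in> S \<Longrightarrow> f x > 0" "Ck_on k f S"
  shows "Ck_on k (\<lambda>x. sqrt (f x)) S"
  using assms(3)
proof (induction k)
  case 0
  then show ?case by (simp add: continuous_on_real_sqrt)
next
  case (Suc k)
  have sq: "Ck_on k (\<lambda>x. sqrt (f x)) S" using Suc Ck_on_Suc_imp by blast
  have "Ck_on k (\<lambda>x. partial i f x * (inverse (sqrt (f x)) * (1/2))) S" for i
    using Suc.prems assms(2)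
    by (intro Ck_on_bilinear[OF bounded_bilinear_mult] Ck_on_const Ck_on_inverse sq assms(1))
      (auto simp: less_imp_neq[symmetric])
  moreover have "((\<lambda>x. sqrt (f x)) has_derivative
      (\<lambda>h. frechet_derivative f (at x) h * (inverse (sqrt (f x)) * (1/2)))) (at x)" if "x \<in> S" for x
    using DERIV_compose_FDERIV[OF DERIV_real_sqrt[OF assms(2)[OF that]]
        Ck_on_has_derivative[OF assms(1) Suc.prems that]]
    by (simp add: field_simps)
  ultimately show ?case by (intro Ck_on_SucI[OF assms(1)])
qed

lemma bounded_linear_axis: "bounded_linear (axis i :: 'b::real_normed_vector \<Rightarrow> 'b ^ 'n)"
proof (rule bounded_linear_intro[where K = 1])
  show "norm (axis i x :: 'b ^ 'n) \<le> norm x * 1" for x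
    using L2_set_le_sum[of UNIV "\<lambda>j. norm ((axis i x :: 'b ^ 'n) $ j)"]
    by (simp add: norm_vec_def axis_def if_distrib sum.delta cong: if_cong)
qed (auto simp: axis_def vec_eq_iff)

section \<open>Algebra of smooth maps\<close>

lemma smooth_on_cong:
  "open S \<Longrightarrow> (\<And>x. x \<in> S \<Longrightarrow> f x = g x) \<Longrightarrow> smooth_on S f \<Longrightarrow> smooth_on S g"
  unfolding smooth_on_def using Ck_on_cong by blast

lemma smooth_on_subset: "T \<subseteq> S \<Longrightarrow> smooth_on S f \<Longrightarrow> smooth_on T f"
  unfolding smooth_on_def using Ck_on_subset by blast

lemma smooth_on_const: "smooth_on S (\<lambda>x. a)"
  by (simp add: smooth_on_def Ck_on_const)

lemma smooth_on_linear:
  "bounded_linear h \<Longrightarrow> open S \<Longrightarrow> smooth_on S f \<Longrightarrow> smooth_on S (\<lambda>x. h (f x))"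
  by (simp add: smooth_on_def Ck_on_linear)

lemma smooth_on_add:
  "open S \<Longrightarrow> smooth_on S f \<Longrightarrow> smooth_on S g \<Longrightarrow> smooth_on S (\<lambda>x. f x + g x)"
  by (simp add: smooth_on_def Ck_on_add)

lemma smooth_on_minus: "open S \<Longrightarrow> smooth_on S f \<Longrightarrow> smooth_on S (\<lambda>x. - f x)"
  by (rule smooth_on_linear[OF bounded_linear_minus[OF bounded_linear_ident]])

lemma smooth_on_bilinear:
  "bounded_bilinear h \<Longrightarrow> open S \<Longrightarrow> smooth_on S f \<Longrightarrow> smooth_on S g \<Longrightarrow>
    smooth_on S (\<lambda>x. h (f x) (g x))"
  by (simp add: smooth_on_def Ck_on_bilinear)

lemma smooth_on_mult:
  fixes f g :: "real ^ 4 \<Rightarrow> 'b::real_normed_algebra"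
  shows "open S \<Longrightarrow> smooth_on S f \<Longrightarrow> smooth_on S g \<Longrightarrow> smooth_on S (\<lambda>x. f x * g x)"
  by (rule smooth_on_bilinear[OF bounded_bilinear_mult])

lemma smooth_on_scaleR:
  "open S \<Longrightarrow> smooth_on S f \<Longrightarrow> smooth_on S g \<Longrightarrow> smooth_on S (\<lambda>x. f x *\<^sub>R g x)"
  by (rule smooth_on_bilinear[OF bounded_bilinear_scaleR])

lemma smooth_on_inverse:
  fixes f :: "real ^ 4 \<Rightarrow> 'b::real_normed_field"
  shows "open S \<Longrightarrow> (\<And>x. x \<in> S \<Longrightarrow> f x \<noteq> 0) \<Longrightarrow> smooth_on S f \<Longrightarrow> smooth_on S (\<lambda>x. inverse (f x))"
  by (simp add: smooth_on_def Ck_on_inverse)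

lemma smooth_on_divide:
  fixes f g :: "real ^ 4 \<Rightarrow> 'b::real_normed_field"
  shows "open S \<Longrightarrow> (\<And>x. x \<in> S \<Longrightarrow> g x \<noteq> 0) \<Longrightarrow> smooth_on S f \<Longrightarrow> smooth_on S g \<Longrightarrow>
    smooth_on S (\<lambda>x. f x / g x)"
  by (simp add: divide_inverse smooth_on_mult smooth_on_inverse)

lemma smooth_on_sqrt:
  "open S \<Longrightarrow> (\<And>x. x \<in> S \<Longrightarrow> f x > 0) \<Longrightarrow> smooth_on S f \<Longrightarrow> smooth_on S (\<lambda>x. sqrt (f x))"
  by (simp add: smooth_on_def Ck_on_sqrt)

lemma smooth_on_sum:
  assumes "open S" "\<And>i. i \<in> I \<Longrightarrow> smooth_on S (f i)"
  shows "smooth_on S (\<lambda>x. \<Sum>i\<in>I. f i x)"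
  using assms(2)
  by (induction I rule: infinite_finite_induct) (auto intro: smooth_on_const smooth_on_add assms(1))

lemma smooth_on_prod:
  fixes f :: "'i \<Rightarrow> real ^ 4 \<Rightarrow> 'b::{real_normed_algebra_1, comm_ring_1}"
  assumes "open S" "\<And>i. i \<in> I \<Longrightarrow> smooth_on S (f i)"
  shows "smooth_on S (\<lambda>x. \<Prod>i\<in>I. f i x)"
  using assms(2)
  by (induction I rule: infinite_finite_induct) (auto intro: smooth_on_const smooth_on_mult assms(1))

lemma smooth_on_nth: "open S \<Longrightarrow> smooth_on S f \<Longrightarrow> smooth_on S (\<lambda>x. f x $ i)"
  by (rule smooth_on_linear[OF bounded_linear_vec_nth])

lemma smooth_on_vecI:
  fixes f :: "real ^ 4 \<Rightarrow> ('b::real_normed_vector) ^ 'n"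
  assumes "open S" "\<And>i. smooth_on S (\<lambda>x. f x $ i)"
  shows "smooth_on S f"
proof -
  have "smooth_on S (\<lambda>x. \<Sum>i\<in>UNIV. axis i (f x $ i))"
    by (intro smooth_on_sum smooth_on_linear[OF bounded_linear_axis] assms)
  moreover have "(\<Sum>i\<in>UNIV. axis i (v $ i)) = v" for v :: "'b ^ 'n"
    by (simp add: vec_eq_iff axis_def if_distrib sum.delta cong: if_cong)
  ultimately show ?thesis by simp
qed

lemma smooth_on_det:
  fixes A :: "real ^ 4 \<Rightarrow> 'b::{real_normed_algebra_1, comm_ring_1} ^ 'n ^ 'n"
  assumes "open S" "\<And>i j. smooth_on S (\<lambda>x. A x $ i $ j)"
  shows "smooth_on S (\<lambda>x. det (A x))"
  unfolding det_def by (intro smooth_on_sum smooth_on_mult smooth_on_prod smooth_on_const assms)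

text \<open>The solution v is only given point by point. Its components are quotients of
  determinants in the coefficients, which is where their smoothness comes from.\<close>

lemma smooth_on_cramer:
  fixes A :: "real ^ 4 \<Rightarrow> 'b::real_normed_field ^ 'n ^ 'n"
  assumes "open S" "\<And>i j. smooth_on S (\<lambda>x. A x $ i $ j)" "\<And>i. smooth_on S (\<lambda>x. b x $ i)"
    and det: "\<And>x. x \<in> S \<Longrightarrow> det (A x) \<noteq> 0" and eq: "\<And>x. x \<in> S \<Longrightarrow> A x *v v x = b x"
  shows "smooth_on S v"
proof (rule smooth_on_vecI[OF assms(1)], rule smooth_on_cong[OF assms(1)])
  fix k
  show "smooth_on S (\<lambda>x. det (\<chi> i j. if j = k then b x $ i else A x $ i $ j) / det (A x))"
  proof (intro smooth_on_divide smooth_on_det assms)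
    show "smooth_on S (\<lambda>x. (\<chi> i j. if j = k then b x $ i else A x $ i $ j) $ i $ j)" for i j
      using assms by (cases "j = k") simp_all
  qed
  show "det (\<chi> i j. if j = k then b x $ i else A x $ i $ j) / det (A x) = v x $ k" if "x \<in> S" for x
    using cramer[OF det[OF that], of "v x" "b x"] eq[OF that] by (simp add: vec_eq_iff)
qed

lemma smooth_on_differentiable:
  "open S \<Longrightarrow> smooth_on S f \<Longrightarrow> x \<in> S \<Longrightarrow> f differentiable (at x)"
  unfolding smooth_on_def using Ck_on.simps(2) differentiable_on_eq_differentiable_at by blast

lemma smooth_on_has_derivative:
  "open S \<Longrightarrow> smooth_on S f \<Longrightarrow> x \<in> S \<Longrightarrow> (f has_derivative frechet_derivative f (at x)) (at x)"
  using smooth_on_differentiable frechet_derivative_works by blast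

lemma smooth_on_partial: "smooth_on S f \<Longrightarrow> smooth_on S (partial i f)"
  unfolding smooth_on_def using Ck_on.simps(2) by blast

lemma smooth_on_continuous: "smooth_on S f \<Longrightarrow> continuous_on S f"
  unfolding smooth_on_def using Ck_on.simps(1) by blast

text \<open>The mean value theorem is used twice, along axis i for the increment in direction j and
  then along axis j. The radius 2 h leaves room for one step of length at most h in each direction,
  also when i = j.\<close>

lemma mixed_difference_mvt:
  fixes f :: "real ^ 4 \<Rightarrow> real"
  assumes "open S" "smooth_on S f" "0 < h" "cball x (2 * h) \<subseteq> S"
  shows "\<exists>y. dist y x \<le> 2 * h \<and>
    f (x + h *\<^sub>R axis i 1 + h *\<^sub>R axis j 1) - f (x + h *\<^sub>R axis i 1) - f (x + h *\<^sub>R axis j 1) + f x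
      = h * h * partial j (partial i f) y"
proof -
  let ?u = "axis i 1 :: real ^ 4" and ?v = "axis j 1 :: real ^ 4"
  have in_ball: "dist (x + s *\<^sub>R ?u + t *\<^sub>R ?v) x \<le> 2 * h"
    if "0 \<le> s" "s \<le> h" "0 \<le> t" "t \<le> h" for s t
  proof -
    have "norm (s *\<^sub>R ?u + t *\<^sub>R ?v) \<le> s + t"
      using norm_triangle_ineq[of "s *\<^sub>R ?u" "t *\<^sub>R ?v"] that by simp
    then show ?thesis using that by (simp add: dist_norm add.assoc)
  qed
  then have inS: "x + s *\<^sub>R ?u + t *\<^sub>R ?v \<in> S" if "0 \<le> s" "s \<le> h" "0 \<le> t" "t \<le> h" for s t
    using assms(4) that by (auto simp: dist_commute)
  have line: "((\<lambda>s. g (a + s *\<^sub>R axis k 1)) has_real_derivative partial k g (a + s *\<^sub>R axis k 1)) (at s)"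
    if g: "smooth_on S g" and "a + s *\<^sub>R axis k 1 \<in> S" for g :: "real ^ 4 \<Rightarrow> real" and a s k
  proof -
    have D: "(g has_derivative frechet_derivative g (at (a + s *\<^sub>R axis k 1))) (at (a + s *\<^sub>R axis k 1))"
      using smooth_on_has_derivative[OF assms(1) that] .
    have "((\<lambda>s. g (a + s *\<^sub>R axis k 1)) has_derivative
        (\<lambda>t. frechet_derivative g (at (a + s *\<^sub>R axis k 1)) (t *\<^sub>R axis k 1))) (at s)"
      by (rule has_derivative_compose[of "\<lambda>s. a + s *\<^sub>R axis k 1" "\<lambda>t. t *\<^sub>R axis k 1" s UNIV g, OF _ D])
        (rule derivative_eq_intros refl | simp)+
    moreover have "(*) (partial k g (a + s *\<^sub>R axis k 1)) =
        (\<lambda>t. frechet_derivative g (at (a + s *\<^sub>R axis k 1)) (t *\<^sub>R axis k 1))"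
      using linear_frechet_derivative[OF differentiableI[OF D]] by (simp add: fun_eq_iff linear_scale)
    ultimately show ?thesis by (simp add: has_field_derivative_def)
  qed
  define \<phi> where "\<phi> = (\<lambda>s. f (x + h *\<^sub>R ?v + s *\<^sub>R ?u) - f (x + s *\<^sub>R ?u))"
  have "\<exists>s>0. s < h \<and> \<phi> h - \<phi> 0 = (h - 0) * (partial i f (x + h *\<^sub>R ?v + s *\<^sub>R ?u) - partial i f (x + s *\<^sub>R ?u))"
    unfolding \<phi>_def
    by (rule MVT2[OF assms(3)], intro DERIV_diff line assms)
      (use inS[of _ h] inS[of _ 0] assms(3) in \<open>auto simp: algebra_simps\<close>)
  then obtain s where s: "0 < s" "s < h"
    "\<phi> h - \<phi> 0 = h * (partial i f (x + h *\<^sub>R ?v + s *\<^sub>R ?u) - partial i f (x + s *\<^sub>R ?u))"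
    by auto
  have "\<exists>t>0. t < h \<and> partial i f (x + s *\<^sub>R ?u + h *\<^sub>R ?v) - partial i f (x + s *\<^sub>R ?u + 0 *\<^sub>R ?v)
      = (h - 0) * partial j (partial i f) (x + s *\<^sub>R ?u + t *\<^sub>R ?v)"
    by (rule MVT2[OF assms(3)], intro line smooth_on_partial assms) (use inS s in auto)
  then obtain t where t: "0 < t" "t < h"
    "partial i f (x + s *\<^sub>R ?u + h *\<^sub>R ?v) - partial i f (x + s *\<^sub>R ?u)
      = h * partial j (partial i f) (x + s *\<^sub>R ?u + t *\<^sub>R ?v)"
    by auto
  have "\<phi> h - \<phi> 0 = h * h * partial j (partial i f) (x + s *\<^sub>R ?u + t *\<^sub>R ?v)"
    using s(3) t(3) by (simp add: algebra_simps)
  then show ?thesis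
    using in_ball[of s t] s t unfolding \<phi>_def
    by (intro exI[of _ "x + s *\<^sub>R ?u + t *\<^sub>R ?v"]) (auto simp: algebra_simps)
qed

text \<open>The second difference quotient is symmetric in i and j and equals either mixed
  derivative at some nearby point; letting h tend to 0, continuity moves both points to x.\<close>

lemma partial_commute_real:
  fixes f :: "real ^ 4 \<Rightarrow> real"
  assumes "open S" "smooth_on S f" "x \<in> S"
  shows "partial j (partial i f) x = partial i (partial j f) x"
proof -
  obtain r where r: "r > 0" "cball x r \<subseteq> S"
    using assms open_contains_cball by blast
  define h where "h = (\<lambda>n::nat. r / (2 * real (Suc n)))"
  have h: "0 < h n" "cball x (2 * h n) \<subseteq> S" for n
  proof -
    show "0 < h n" using r by (simp add: h_def)
    have "2 * h n \<le> r" using r by (simp add: h_def field_simps)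
    then show "cball x (2 * h n) \<subseteq> S" using r by (meson subset_cball order_trans)
  qed
  have "\<exists>y z. dist y x \<le> 2 * h n \<and> dist z x \<le> 2 * h n \<and>
      partial j (partial i f) y = partial i (partial j f) z" for n
  proof -
    obtain y where y: "dist y x \<le> 2 * h n" "f (x + h n *\<^sub>R axis i 1 + h n *\<^sub>R axis j 1)
        - f (x + h n *\<^sub>R axis i 1) - f (x + h n *\<^sub>R axis j 1) + f x
        = h n * h n * partial j (partial i f) y"
      using mixed_difference_mvt[OF assms(1,2) h[of n], of i j] by blast
    obtain z where z: "dist z x \<le> 2 * h n" "f (x + h n *\<^sub>R axis j 1 + h n *\<^sub>R axis i 1)
        - f (x + h n *\<^sub>R axis j 1) - f (x + h n *\<^sub>R axis i 1) + f x
        = h n * h n * partial i (partial j f) z"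
      using mixed_difference_mvt[OF assms(1,2) h[of n], of j i] by blast
    have swap: "x + h n *\<^sub>R axis i 1 + h n *\<^sub>R axis j 1 = x + h n *\<^sub>R axis j 1 + h n *\<^sub>R axis i 1"
      by (simp only: add.assoc add.commute[of "h n *\<^sub>R axis i 1"])
    have "h n * h n * partial j (partial i f) y = h n * h n * partial i (partial j f) z"
      unfolding y(2)[symmetric] z(2)[symmetric] swap by simp
    moreover have "h n * h n \<noteq> 0" using h(1)[of n] by simp
    ultimately have "partial j (partial i f) y = partial i (partial j f) z" by simp
    then show ?thesis using y(1) z(1) by blast
  qed
  then obtain y z where yz: "\<And>n. dist (y n) x \<le> 2 * h n" "\<And>n. dist (z n) x \<le> 2 * h n"
    "\<And>n. partial j (partial i f) (y n) = partial i (partial j f) (z n)"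
    by metis
  have "(\<lambda>n. inverse (real (Suc n))) \<longlonglongrightarrow> 0" by (rule LIMSEQ_inverse_real_of_nat)
  then have "(\<lambda>n. r * inverse (real (Suc n))) \<longlonglongrightarrow> r * 0" by (intro tendsto_intros)
  moreover have "2 * h n = r * inverse (real (Suc n))" for n
    by (simp add: h_def field_simps)
  ultimately have h0: "(\<lambda>n. 2 * h n) \<longlonglongrightarrow> 0" by simp
  have lim: "w \<longlonglongrightarrow> x" if "\<And>n. dist (w n) x \<le> 2 * h n" for w
    using that by (intro metric_tendsto_imp_tendsto[OF h0])
      (auto intro!: always_eventually simp: dist_norm intro: order_trans[OF _ abs_ge_self])
  have cont: "isCont (partial a (partial b f)) x" for a b
    using smooth_on_continuous[OF smooth_on_partial[OF smooth_on_partial[OF assms(2)]]] assms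
    by (simp add: continuous_on_eq_continuous_at)
  have "(\<lambda>n. partial j (partial i f) (y n)) \<longlonglongrightarrow> partial j (partial i f) x"
    by (rule isCont_tendsto_compose[OF cont lim[OF yz(1)]])
  moreover have "(\<lambda>n. partial i (partial j f) (z n)) \<longlonglongrightarrow> partial i (partial j f) x"
    by (rule isCont_tendsto_compose[OF cont lim[OF yz(2)]])
  ultimately show ?thesis using yz(3) LIMSEQ_unique by simp
qed

lemma partial_linear:
  assumes "bounded_linear h" "open S" "smooth_on S f" "x \<in> S"
  shows "partial i (\<lambda>x. h (f x)) x = h (partial i f x)"
  by (rule partial_eqI[OF bounded_linear.has_derivative[OF assms(1) smooth_on_has_derivative[OF assms(2-)]]])

lemma partial_commute:
  fixes f :: "real ^ 4 \<Rightarrow> 'b::euclidean_space"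
  assumes "open S" "smooth_on S f" "x \<in> S"
  shows "partial j (partial i f) x = partial i (partial j f) x"
proof (rule euclidean_eqI)
  fix b :: 'b
  have bl: "bounded_linear (\<lambda>v. v \<bullet> b)" by (rule bounded_linear_inner_left)
  have *: "partial k (partial l f) x \<bullet> b = partial k (partial l (\<lambda>x. f x \<bullet> b)) x" for k l
  proof -
    have "partial k (partial l (\<lambda>x. f x \<bullet> b)) x = partial k (\<lambda>x. partial l f x \<bullet> b) x"
      using frechet_derivative_cong_open[OF assms(1,3), of "partial l (\<lambda>x. f x \<bullet> b)" "\<lambda>x. partial l f x \<bullet> b"]
        partial_linear[OF bl assms(1,2)] by simp
    also have "\<dots> = partial k (partial l f) x \<bullet> b"
      by (rule partial_linear[OF bl assms(1) smooth_on_partial[OF assms(2)] assms(3)])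
    finally show ?thesis ..
  qed
  show "partial j (partial i f) x \<bullet> b = partial i (partial j f) x \<bullet> b"
    unfolding * by (rule partial_commute_real[OF assms(1) smooth_on_linear[OF bl assms(1,2)] assms(3)])
qed

lemma partial_add:
  assumes "open S" "smooth_on S f" "smooth_on S g" "x \<in> S"
  shows "partial i (\<lambda>x. f x + g x) x = partial i f x + partial i g x"
  by (rule partial_eqI[OF has_derivative_add[OF smooth_on_has_derivative[OF assms(1,2,4)]
          smooth_on_has_derivative[OF assms(1,3,4)]]])

lemma partial_compose:
  assumes "g differentiable (at x)" "f differentiable (at (g x))"
  shows "partial i (\<lambda>x. f (g x)) x = (\<Sum>a\<in>UNIV. partial i g x $ a *\<^sub>R partial a f (g x))"
proof -
  have "partial i (\<lambda>x. f (g x)) x = frechet_derivative f (at (g x)) (partial i g x)"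
    using frechet_derivative_compose[OF assms] by (simp add: o_def)
  also have "\<dots> = frechet_derivative f (at (g x)) (\<Sum>a\<in>UNIV. partial i g x $ a *\<^sub>R axis a 1)"
    using basis_expansion[of "partial i g x"] by (simp add: scalar_mult_eq_scaleR)
  also have "\<dots> = (\<Sum>a\<in>UNIV. partial i g x $ a *\<^sub>R partial a f (g x))"
    using linear_frechet_derivative[OF assms(2)] by (simp add: linear_sum linear_scale)
  finally show ?thesis .
qed

section \<open>The Levi-Civita symbol\<close>

text \<open>Time is index 0, while the standard enumeration of the type \<open>4\<close> runs over
  1, 2, 3, 4; the two agree because 4 is 0 there.\<close>

lemma numeral_4_eq_0: "(4::4) = 0" by simp

lemma sum_4_from_0: "sum f (UNIV :: 4 set) = f 0 + f 1 + f 2 + f 3"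
  using sum_4[of f] unfolding numeral_4_eq_0 by (simp only: add.commute add.left_commute)

lemma all_4_from_0: "(\<forall>i::4. P i) \<longleftrightarrow> P 0 \<and> P 1 \<and> P 2 \<and> P 3"
  using forall_4[of P] unfolding numeral_4_eq_0 by blast

lemma sum_swap22:
  "(\<Sum>c\<in>C. \<Sum>d\<in>D. \<Sum>a\<in>A. \<Sum>b\<in>B. f a b c d) = (\<Sum>a\<in>A. \<Sum>b\<in>B. \<Sum>c\<in>C. \<Sum>d\<in>D. f a b c d)"
proof -
  have "(\<Sum>c\<in>C. \<Sum>d\<in>D. \<Sum>a\<in>A. \<Sum>b\<in>B. f a b c d) = (\<Sum>c\<in>C. \<Sum>a\<in>A. \<Sum>b\<in>B. \<Sum>d\<in>D. f a b c d)"
    by (rule sum.cong[OF refl], subst sum.swap, rule sum.cong[OF refl], rule sum.swap)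
  also have "\<dots> = (\<Sum>a\<in>A. \<Sum>b\<in>B. \<Sum>c\<in>C. \<Sum>d\<in>D. f a b c d)"
    by (subst sum.swap, rule sum.cong[OF refl], rule sum.swap)
  finally show ?thesis .
qed

lemma sum_rotate:
  "(\<Sum>a\<in>A. \<Sum>b\<in>B. \<Sum>c\<in>C. f a b c) = (\<Sum>c\<in>C. \<Sum>a\<in>A. \<Sum>b\<in>B. f a b c)"
proof -
  have "(\<Sum>a\<in>A. \<Sum>b\<in>B. \<Sum>c\<in>C. f a b c) = (\<Sum>a\<in>A. \<Sum>c\<in>C. \<Sum>b\<in>B. f a b c)"
    by (rule sum.cong[OF refl], rule sum.swap)
  also have "\<dots> = (\<Sum>c\<in>C. \<Sum>a\<in>A. \<Sum>b\<in>B. f a b c)" by (rule sum.swap)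
  finally show ?thesis .
qed

text \<open>The rows are separate arguments so that multilinearity can be applied to one row at a
  time.\<close>

definition det4 :: "real ^ 4 \<Rightarrow> real ^ 4 \<Rightarrow> real ^ 4 \<Rightarrow> real ^ 4 \<Rightarrow> real" where
  "det4 u v w x = det (\<chi> r. if r = 0 then u else if r = 1 then v else if r = 2 then w else x)"

lemma levi_civita_det4: "levi_civita i j k l = det4 (axis i 1) (axis j 1) (axis k 1) (axis l 1)"
proof -
  have "(\<chi> r. axis (if r = 0 then i else if r = 1 then j else if r = 2 then k else l) 1 :: real ^ 4 ^ 4)
    = (\<chi> r. if r = 0 then axis i 1 else if r = 1 then axis j 1 else if r = 2 then axis k 1 else axis l 1)"
    by (simp add: vec_eq_iff)
  then show ?thesis unfolding levi_civita_def det4_def by (rule arg_cong)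
qed

lemma linear_det_row:
  fixes g :: "real ^ 'n \<Rightarrow> real ^ 'n ^ 'n"
  assumes "\<And>v. g v = (\<chi> r. if r = k then v else c r)"
  shows "linear (\<lambda>v. det (g v))"
proof (rule linearI)
  show "det (g (a + b)) = det (g a) + det (g b)" for a b
    unfolding assms by (rule det_row_add)
  show "det (g (a *\<^sub>R b)) = a *\<^sub>R det (g b)" for a b
    unfolding assms scalar_mult_eq_scaleR[symmetric] real_scaleR_def by (rule det_row_mul)
qed

lemma linear_det4:
  "linear (\<lambda>u. det4 u v w x)" "linear (\<lambda>v. det4 u v w x)"
  "linear (\<lambda>w. det4 u v w x)" "linear (\<lambda>x. det4 u v w x)"
  unfolding det4_def
     apply (rule linear_det_row[where k = 0 and c = "\<lambda>r. if r = 1 then v else if r = 2 then w else x"])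
     apply simp
    apply (rule linear_det_row[where k = 1 and c = "\<lambda>r. if r = 0 then u else if r = 2 then w else x"])
    apply (simp add: vec_eq_iff)
   apply (rule linear_det_row[where k = 2 and c = "\<lambda>r. if r = 0 then u else if r = 1 then v else x"])
   apply (simp add: vec_eq_iff)
  apply (rule linear_det_row[where k = 3 and c = "\<lambda>r. if r = 0 then u else if r = 1 then v else w"])
  apply (simp add: vec_eq_iff all_4_from_0)
  done

lemma vec_expand_real: "(v :: real ^ 'n) = (\<Sum>a\<in>UNIV. v $ a *\<^sub>R axis a 1)"
  using basis_expansion[of v] by (simp add: scalar_mult_eq_scaleR)

lemma det4_expand:
  "det4 u v w x = (\<Sum>a\<in>UNIV. \<Sum>b\<in>UNIV. \<Sum>c\<in>UNIV. \<Sum>d\<in>UNIV.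
    u $ a * v $ b * w $ c * x $ d * levi_civita a b c d)"
proof -
  have lin: "f v = (\<Sum>a\<in>UNIV. v $ a * f (axis a 1))" if "linear f" for f :: "real ^ 4 \<Rightarrow> real" and v
  proof -
    have "f v = f (\<Sum>a\<in>UNIV. v $ a *\<^sub>R axis a 1)" using vec_expand_real[of v] by simp
    then show ?thesis by (simp add: linear_sum[OF that] linear_scale[OF that])
  qed
  have 1: "det4 u v w x = (\<Sum>a\<in>UNIV. u $ a * det4 (axis a 1) v w x)"
    by (rule lin[OF linear_det4(1)])
  have 2: "det4 a v w x = (\<Sum>b\<in>UNIV. v $ b * det4 a (axis b 1) w x)" for a
    by (rule lin[OF linear_det4(2)])
  have 3: "det4 a b w x = (\<Sum>c\<in>UNIV. w $ c * det4 a b (axis c 1) x)" for a b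
    by (rule lin[OF linear_det4(3)])
  have 4: "det4 a b c x = (\<Sum>d\<in>UNIV. x $ d * det4 a b c (axis d 1))" for a b c
    by (rule lin[OF linear_det4(4)])
  show ?thesis
    unfolding 1 2[of "axis _ 1"] 3[of "axis _ 1" "axis _ 1"] 4[of "axis _ 1" "axis _ 1" "axis _ 1"]
      levi_civita_det4 sum_distrib_left mult.assoc ..
qed

text \<open>Multiplying a matrix of basis rows by \<open>transpose J\<close> gives the matrix whose
  rows are the selected columns of J. Multiplicativity of the determinant and multilinear expansion
  then compute the same number twice.\<close>

lemma levi_civita_transform:
  "(\<Sum>a\<in>UNIV. \<Sum>b\<in>UNIV. \<Sum>c\<in>UNIV. \<Sum>d\<in>UNIV.
     J $ a $ i * J $ b $ j * J $ c $ k * J $ d $ l * levi_civita a b c d) = det J * levi_civita i j k l"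
proof -
  let ?s = "\<lambda>r::4. if r = 0 then i else if r = 1 then j else if r = 2 then k else l"
  have rows: "(\<chi> r. axis (s r) 1) ** transpose J = (\<chi> r. column (s r) J)" for s :: "4 \<Rightarrow> 4"
    by (simp add: vec_eq_iff matrix_matrix_mult_def axis_def transpose_def column_def if_distrib
        if_distribR sum.delta cong: if_cong)
  have "det (\<chi> r. axis (s r) 1) * det J = det (\<chi> r. column (s r) J)" for s :: "4 \<Rightarrow> 4"
    unfolding rows[symmetric] det_mul det_transpose ..
  from this[of ?s] have "levi_civita i j k l * det J = det (\<chi> r. column (?s r) J)"
    unfolding levi_civita_def .
  also have "(\<chi> r. column (?s r) J) = (\<chi> r. if r = 0 then column i J else if r = 1 then column j J
      else if r = 2 then column k J else column l J)"
    by (simp add: vec_eq_iff)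
  also have "det \<dots> = det4 (column i J) (column j J) (column k J) (column l J)"
    by (simp add: det4_def)
  finally show ?thesis by (simp add: det4_expand column_def mult.commute)
qed

lemma levi_civita_eq_0: "levi_civita i i k l = 0" "levi_civita i j i l = 0" "levi_civita i j k i = 0"
  "levi_civita i j j l = 0" "levi_civita i j k j = 0" "levi_civita i j k k = 0"
proof -
  have "det (\<chi> r. axis (s r) 1 :: real ^ 4 ^ 4) = 0" if "a \<noteq> b" "s a = s b" for a b :: 4 and s :: "4 \<Rightarrow> 4"
    by (rule det_identical_rows[OF that(1)]) (simp add: row_def that)
  note * = this
  show "levi_civita i i k l = 0" unfolding levi_civita_def by (rule *[of 0 1]) auto
  show "levi_civita i j i l = 0" unfolding levi_civita_def by (rule *[of 0 2]) auto
  show "levi_civita i j k i = 0" unfolding levi_civita_def by (rule *[of 0 3]) auto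
  show "levi_civita i j j l = 0" unfolding levi_civita_def by (rule *[of 1 2]) auto
  show "levi_civita i j k j = 0" unfolding levi_civita_def by (rule *[of 1 3]) auto
  show "levi_civita i j k k = 0" unfolding levi_civita_def by (rule *[of 2 3]) auto
qed

lemma levi_civita_swap: "levi_civita j i k l = - levi_civita i j k l"
  "levi_civita i k j l = - levi_civita i j k l" "levi_civita i j l k = - levi_civita i j k l"
proof -
  \<comment> \<open>Polarisation: a biadditive map vanishing on the diagonal is antisymmetric, seen
    by expanding f (i + j) (i + j).\<close>
  have swap: "f j i = - f i j" if add: "\<And>u v w. f (u + v) w = f u w + f v w"
    "\<And>u v w. f w (u + v) = f w u + f w v" and 0: "\<And>u. f u u = (0::real)"
    for f :: "real ^ 4 \<Rightarrow> real ^ 4 \<Rightarrow> real" and i j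
  proof -
    have "f (i + j) (i + j) = f i i + f j i + (f i j + f j j)" by (simp only: add)
    then show ?thesis by (simp add: 0)
  qed
  have 0: "det4 u u w x = 0" "det4 u v v x = 0" "det4 u v w w = 0" for u v w x
    unfolding det4_def
      apply (rule det_identical_rows[of 0 1]; simp add: row_def)
     apply (rule det_identical_rows[of 1 2]; simp add: row_def)
    apply (rule det_identical_rows[of 2 3]; simp add: row_def)
    done
  note add = linear_add[OF linear_det4(1)] linear_add[OF linear_det4(2)] linear_add[OF linear_det4(3)] linear_add[OF linear_det4(4)]
  show "levi_civita j i k l = - levi_civita i j k l" unfolding levi_civita_det4
    by (rule swap[of "\<lambda>u v. det4 u v (axis k 1) (axis l 1)"]) (rule add 0)+
  show "levi_civita i k j l = - levi_civita i j k l" unfolding levi_civita_det4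
    by (rule swap[of "\<lambda>u v. det4 (axis i 1) u v (axis l 1)"]) (rule add 0)+
  show "levi_civita i j l k = - levi_civita i j k l" unfolding levi_civita_det4
    by (rule swap[of "\<lambda>u v. det4 (axis i 1) (axis j 1) u v"]) (rule add 0)+
qed

lemma levi_civita_0123: "levi_civita 0 1 2 3 = 1"
proof -
  have "(\<chi> r. axis (if r = 0 then 0 else if r = 1 then 1 else if r = 2 then 2 else 3) 1 :: real ^ 4 ^ 4) = mat 1"
    by (simp add: vec_eq_iff mat_def axis_def all_4_from_0)
  then show ?thesis by (simp add: levi_civita_def)
qed

text \<open>The twelve values that enter the six Hodge components in \<open>hodge_minkowski\<close>,
  two for each component.\<close>

lemma levi_civita_values:
  "levi_civita 2 3 0 1 = 1" "levi_civita 3 2 0 1 = -1" "levi_civita 1 3 0 2 = -1" "levi_civita 3 1 0 2 = 1"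
  "levi_civita 1 2 0 3 = 1" "levi_civita 2 1 0 3 = -1" "levi_civita 0 1 2 3 = 1" "levi_civita 1 0 2 3 = -1"
  "levi_civita 0 2 3 1 = 1" "levi_civita 2 0 3 1 = -1" "levi_civita 0 3 1 2 = 1" "levi_civita 3 0 1 2 = -1"
  using levi_civita_0123
    levi_civita_swap(1)[of 0 1 2 3] levi_civita_swap(2)[of 0 1 2 3] levi_civita_swap(3)[of 0 1 2 3]
  by (smt (verit) levi_civita_swap)+

section \<open>Lorentzian frames\<close>

definition cm :: "real ^ 'n ^ 'm \<Rightarrow> complex ^ 'n ^ 'm" where
  "cm A = (\<chi> i j. complex_of_real (A $ i $ j))"

lemma cm_nth [simp]: "cm A $ i $ j = complex_of_real (A $ i $ j)"
  by (simp add: cm_def)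

lemma cm_mult: "cm (A ** B) = cm A ** cm B"
  by (simp add: vec_eq_iff matrix_matrix_mult_def)

lemma cm_transpose: "cm (transpose A) = transpose (cm A)"
  by (simp add: vec_eq_iff transpose_def)

text \<open>Writing pullback as a congruence turns invariance statements about double sums into
  matrix algebra.\<close>

lemma pull2_complex: "pull2 J \<alpha> = transpose (cm J) ** \<alpha> ** cm J" for \<alpha> :: "complex ^ 4 ^ 4"
  unfolding vec_eq_iff
proof (intro allI)
  fix i j
  have "pull2 J \<alpha> $ i $ j = (\<Sum>b\<in>UNIV. \<Sum>a\<in>UNIV. (J $ a $ i * J $ b $ j) *\<^sub>R \<alpha> $ a $ b)"
    by (simp add: pull2_def, rule sum.swap)
  also have "\<dots> = (transpose (cm J) ** \<alpha> ** cm J) $ i $ j"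
    by (simp add: matrix_matrix_mult_def transpose_def scaleR_conv_of_real sum_distrib_right sum_distrib_left mult_ac)
  finally show "pull2 J \<alpha> $ i $ j = (transpose (cm J) ** \<alpha> ** cm J) $ i $ j" .
qed

lemma pull2_real: "pull2 J \<alpha> = transpose J ** \<alpha> ** J" for \<alpha> :: "real ^ 4 ^ 4"
proof -
  have "cm (pull2 J \<alpha>) = pull2 J (cm \<alpha>)"
    by (simp add: vec_eq_iff pull2_def scaleR_conv_of_real)
  then have "cm (pull2 J \<alpha>) = cm (transpose J ** \<alpha> ** J)"
    by (simp only: pull2_complex cm_mult cm_transpose)
  then show ?thesis by (simp add: vec_eq_iff)
qed

lemma matrix_inv_eqI:
  fixes A :: "'a::field ^ 'n ^ 'n"
  assumes "A ** B = mat 1"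
  shows "matrix_inv A = B"
proof -
  have "B ** A = mat 1" using assms matrix_left_right_inverse by blast
  then have "\<exists>A'. A ** A' = mat 1 \<and> A' ** A = mat 1" using assms by blast
  then have "matrix_inv A ** A = mat 1" unfolding matrix_inv_def by (rule someI2_ex) blast
  then show ?thesis by (metis assms matrix_mul_assoc matrix_mul_lid matrix_mul_rid)
qed

lemma
  fixes A :: "'a::field ^ 'n ^ 'n"
  assumes "invertible A"
  shows matrix_inv_left: "matrix_inv A ** A = mat 1"
    and matrix_inv_right: "A ** matrix_inv A = mat 1"
  using assms matrix_inv_eqI unfolding invertible_def by metis+

text \<open>Contravariance of the inverse metric, the reason why raising indices is compatible with
  pullback.\<close>

lemma matrix_inv_congruence:
  fixes G :: "'a::field ^ 'n ^ 'n"
  assumes "invertible G" "invertible (J :: 'a ^ 'n ^ 'n)"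
  shows "J ** matrix_inv (transpose J ** G ** J) ** transpose J = matrix_inv G"
proof -
  have "(transpose J ** G ** J) ** (matrix_inv J ** matrix_inv G ** transpose (matrix_inv J))
      = transpose J ** (G ** (J ** matrix_inv J) ** matrix_inv G) ** transpose (matrix_inv J)"
    by (simp only: matrix_mul_assoc)
  also have "\<dots> = transpose (matrix_inv J ** J)"
    by (simp add: matrix_inv_right[OF assms(1)] matrix_inv_right[OF assms(2)] matrix_transpose_mul)
  also have "\<dots> = mat 1" using assms by (simp add: matrix_inv_left)
  finally have "matrix_inv (transpose J ** G ** J) = matrix_inv J ** matrix_inv G ** transpose (matrix_inv J)"
    by (rule matrix_inv_eqI)
  then have "J ** matrix_inv (transpose J ** G ** J) ** transpose J
      = (J ** matrix_inv J) ** matrix_inv G ** transpose (J ** matrix_inv J)"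
    by (simp only: matrix_mul_assoc matrix_transpose_mul)
  then show ?thesis using assms by (simp add: matrix_inv_right)
qed

lemma invertible_transpose_iff: "invertible (transpose A) \<longleftrightarrow> invertible (A :: 'a::field ^ 'n ^ 'n)"
  by (simp add: invertible_det_nz)

lemma det_minkowski: "det minkowski = - 1"
proof -
  have "det minkowski = (\<Prod>i\<in>UNIV. minkowski $ i $ i)"
    by (rule det_diagonal) (simp add: minkowski_def)
  also have "\<dots> = (\<Prod>i\<in>UNIV - {0}. minkowski $ i $ i) * - 1"
    by (subst prod.remove[of UNIV 0]) (simp_all add: minkowski_def)
  also have "(\<Prod>i\<in>UNIV - {0::4}. minkowski $ i $ i) = 1"
    by (rule prod.neutral) (simp add: minkowski_def)
  finally show ?thesis by simp
qed

lemma minkowski_squared: "minkowski ** minkowski = mat 1"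
  by (simp add: vec_eq_iff matrix_matrix_mult_def minkowski_def mat_def all_4_from_0 sum_4_from_0)

lemma matrix_inv_minkowski: "matrix_inv minkowski = minkowski"
  by (rule matrix_inv_eqI[OF minkowski_squared])

text \<open>A frame of the wrong orientation is corrected by reflecting its last vector.\<close>

lemma lorentzian_frame:
  assumes "lorentzian G"
  obtains P where "det P > 0" "transpose P ** G ** P = minkowski"
proof -
  obtain P where P: "invertible P" "transpose P ** G ** P = minkowski"
    using assms by (auto simp: lorentzian_def)
  define D :: "real ^ 4 ^ 4" where "D = (\<chi> i j. if i = j then if i = 3 then - 1 else 1 else 0)"
  have D: "transpose D ** minkowski ** D = minkowski"
    by (simp add: vec_eq_iff matrix_matrix_mult_def minkowski_def D_def transpose_def all_4_from_0 sum_4_from_0)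
  have "det D = (\<Prod>i\<in>UNIV. D $ i $ i)" by (rule det_diagonal) (simp add: D_def)
  also have "\<dots> = (\<Prod>i\<in>UNIV - {3}. D $ i $ i) * - 1"
    by (subst prod.remove[of UNIV 3]) (simp_all add: D_def)
  also have "(\<Prod>i\<in>UNIV - {3::4}. D $ i $ i) = 1" by (rule prod.neutral) (simp add: D_def)
  finally have detD: "det D = - 1" by simp
  show ?thesis
  proof (cases "det P > 0")
    case True
    then show ?thesis using that P by blast
  next
    case False
    then have "det P < 0" using P(1) by (simp add: invertible_det_nz less_le)
    then have "det (P ** D) > 0" by (simp add: det_mul detD)
    moreover have "transpose (P ** D) ** G ** (P ** D) = transpose D ** (transpose P ** G ** P) ** D"
      by (simp only: matrix_transpose_mul matrix_mul_assoc)
    ultimately show ?thesis using that P D by metis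
  qed
qed

lemma lorentzian_pull2_frame:
  assumes "lorentzian G"
  obtains P where "det P > 0" "invertible P" "pull2 P G = minkowski"
  using lorentzian_frame[OF assms] by (metis invertible_det_nz less_irrefl pull2_real)

lemma lorentzian_minkowski: "lorentzian minkowski"
  unfolding lorentzian_def by (rule exI[of _ "mat 1"]) (simp add: transpose_mat invertible_det_nz)

lemma lorentzian_imp:
  assumes "lorentzian G"
  shows "det G < 0" "invertible G" "transpose G = G" "transpose (matrix_inv G) = matrix_inv G"
proof -
  obtain P where P: "det P > 0" "transpose P ** G ** P = minkowski"
    using lorentzian_frame[OF assms] by blast
  have "det P * det P * det G = - 1"
    using arg_cong[OF P(2), of det] by (simp add: det_mul det_minkowski mult.commute mult.left_commute)
  then have "(det P)\<^sup>2 * det G < 0" by (simp add: power2_eq_square)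
  then show 1: "det G < 0" by (smt (verit) zero_le_mult_iff zero_le_power2)
  then show 2: "invertible G" by (simp add: invertible_det_nz)
  have iP: "invertible P" using P(1) by (simp add: invertible_det_nz)
  have "transpose P ** transpose G ** P = transpose (transpose P ** G ** P)"
    by (simp add: matrix_transpose_mul matrix_mul_assoc)
  also have "\<dots> = minkowski" unfolding P(2)
    by (simp add: minkowski_def transpose_def vec_eq_iff)
  finally have "transpose P ** transpose G ** P = transpose P ** G ** P" using P(2) by simp
  then have "transpose (matrix_inv P) ** (transpose P ** transpose G ** P) ** matrix_inv P
      = transpose (matrix_inv P) ** (transpose P ** G ** P) ** matrix_inv P" by simp
  moreover have "transpose (matrix_inv P) ** (transpose P ** X ** P) ** matrix_inv P = X" for X
  proof -
    have "transpose (matrix_inv P) ** (transpose P ** X ** P) ** matrix_inv P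
      = transpose (P ** matrix_inv P) ** X ** (P ** matrix_inv P)"
      by (simp only: matrix_transpose_mul matrix_mul_assoc)
    then show ?thesis using iP by (simp add: matrix_inv_right)
  qed
  ultimately show 3: "transpose G = G" by simp
  have "G ** transpose (matrix_inv G) = transpose (matrix_inv G ** G)"
    by (simp add: matrix_transpose_mul 3)
  also have "\<dots> = mat 1" using 2 by (simp add: matrix_inv_left)
  finally show "transpose (matrix_inv G) = matrix_inv G" using matrix_inv_eqI by metis
qed

lemma lorentzian_pull2:
  assumes "lorentzian G" "invertible J"
  shows "lorentzian (pull2 J G)"
proof -
  obtain P where P: "invertible P" "transpose P ** G ** P = minkowski"
    using assms by (auto simp: lorentzian_def)
  have "transpose (matrix_inv J ** P) ** pull2 J G ** (matrix_inv J ** P)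
      = transpose P ** transpose (J ** matrix_inv J) ** G ** (J ** matrix_inv J) ** P"
    by (simp only: pull2_real matrix_transpose_mul matrix_mul_assoc)
  also have "\<dots> = minkowski" using assms P by (simp add: matrix_inv_right)
  finally show ?thesis using P(1) assms(2) unfolding lorentzian_def
    by (intro exI[of _ "matrix_inv J ** P"]) (metis invertible_mult matrix_inv_left matrix_inv_right invertible_def)
qed

section \<open>The Hodge star\<close>

text \<open>The star acts on form indices with real coefficients, so every real-linear map of the
  values commutes with it. This covers matrix entries, \<open>phi\<close>, complex multiples and
  traces alike.\<close>

lemma hodge_linear_map:
  assumes "linear f"
  shows "f (hodge G \<beta> $ i $ j) = hodge G (\<chi> k l. f (\<beta> $ k $ l)) $ i $ j"
  by (simp add: hodge_def linear_sum[OF assms] linear_scale[OF assms])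

definition raise2 :: "real ^ 4 ^ 4 \<Rightarrow> complex ^ 4 ^ 4 \<Rightarrow> complex ^ 4 ^ 4" where
  "raise2 G \<alpha> = cm (matrix_inv G) ** \<alpha> ** transpose (cm (matrix_inv G))"

lemma hodge_raise2:
  "hodge G \<alpha> $ i $ j = (\<Sum>a\<in>UNIV. \<Sum>b\<in>UNIV.
     complex_of_real (1 / 2 * sqrt \<bar>det G\<bar> * levi_civita a b i j) * raise2 G \<alpha> $ a $ b)"
proof -
  have "hodge G \<alpha> $ i $ j = (\<Sum>k\<in>UNIV. \<Sum>l\<in>UNIV. \<Sum>a\<in>UNIV. \<Sum>b\<in>UNIV.
     complex_of_real (1 / 2 * sqrt \<bar>det G\<bar> * levi_civita a b i j) *
       (complex_of_real (matrix_inv G $ a $ k) * complex_of_real (matrix_inv G $ b $ l) * \<alpha> $ k $ l))"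
    unfolding hodge_def by (simp add: scaleR_conv_of_real mult.assoc)
  also have "\<dots> = (\<Sum>a\<in>UNIV. \<Sum>b\<in>UNIV. \<Sum>k\<in>UNIV. \<Sum>l\<in>UNIV.
     complex_of_real (1 / 2 * sqrt \<bar>det G\<bar> * levi_civita a b i j) *
       (complex_of_real (matrix_inv G $ a $ k) * complex_of_real (matrix_inv G $ b $ l) * \<alpha> $ k $ l))"
    by (rule sum_swap22)
  also have "\<dots> = (\<Sum>a\<in>UNIV. \<Sum>b\<in>UNIV.
     complex_of_real (1 / 2 * sqrt \<bar>det G\<bar> * levi_civita a b i j) * raise2 G \<alpha> $ a $ b)"
  proof (intro sum.cong refl)
    fix a b
    have "raise2 G \<alpha> $ a $ b = (\<Sum>k\<in>UNIV. \<Sum>l\<in>UNIV.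
       complex_of_real (matrix_inv G $ a $ k) * complex_of_real (matrix_inv G $ b $ l) * \<alpha> $ k $ l)"
      unfolding raise2_def
      by (simp add: matrix_matrix_mult_def transpose_def sum_distrib_right sum_distrib_left mult_ac,
          rule sum.swap)
    then show "(\<Sum>k\<in>UNIV. \<Sum>l\<in>UNIV. complex_of_real (1 / 2 * sqrt \<bar>det G\<bar> * levi_civita a b i j) *
       (complex_of_real (matrix_inv G $ a $ k) * complex_of_real (matrix_inv G $ b $ l) * \<alpha> $ k $ l))
      = complex_of_real (1 / 2 * sqrt \<bar>det G\<bar> * levi_civita a b i j) * raise2 G \<alpha> $ a $ b"
      by (simp only: sum_distrib_left)
  qed
  finally show ?thesis .
qed

lemma raise2_pull:
  assumes "invertible G" "invertible J"
  shows "raise2 G \<alpha> = cm J ** raise2 (pull2 J G) (pull2 J \<alpha>) ** transpose (cm J)"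
proof -
  have "cm J ** cm (matrix_inv (pull2 J G)) ** transpose (cm J) = cm (matrix_inv G)"
    unfolding pull2_real cm_mult[symmetric] cm_transpose[symmetric] matrix_inv_congruence[OF assms] ..
  moreover have "cm J ** raise2 (pull2 J G) (pull2 J \<alpha>) ** transpose (cm J) =
      (cm J ** cm (matrix_inv (pull2 J G)) ** transpose (cm J)) ** \<alpha> **
      transpose (cm J ** cm (matrix_inv (pull2 J G)) ** transpose (cm J))"
    unfolding raise2_def pull2_complex by (simp only: matrix_transpose_mul transpose_transpose matrix_mul_assoc)
  ultimately show ?thesis by (simp add: raise2_def)
qed

text \<open>The Levi-Civita symbol contributes a factor det J and the volume factor
  \<open>sqrt \<bar>det G\<bar>\<close> a factor \<bar>det J\<bar>. They match exactly because det J
  is positive, so this is the place where orientation enters.\<close>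

lemma hodge_pull2_complex:
  fixes \<alpha> :: "complex ^ 4 ^ 4"
  assumes "invertible G" "det J > 0"
  shows "hodge (pull2 J G) (pull2 J \<alpha>) = pull2 J (hodge G \<alpha>)"
  unfolding vec_eq_iff
proof (intro allI)
  fix i j
  define s where "s = 1 / 2 * sqrt \<bar>det G\<bar>"
  define R where "R = raise2 (pull2 J G) (pull2 J \<alpha>)"
  have iJ: "invertible J" using assms(2) by (simp add: invertible_det_nz)
  have raise: "raise2 G \<alpha> $ a $ b = (\<Sum>m\<in>UNIV. \<Sum>n\<in>UNIV. complex_of_real (J $ a $ m * J $ b $ n) * R $ m $ n)" for a b
    unfolding raise2_pull[OF assms(1) iJ, of \<alpha>] R_def[symmetric]
    by (simp add: matrix_matrix_mult_def transpose_def sum_distrib_right sum_distrib_left mult_ac,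
          rule sum.swap)
  have vol: "1 / 2 * sqrt \<bar>det (pull2 J G)\<bar> = s * det J"
  proof -
    have "\<bar>det (pull2 J G)\<bar> = \<bar>det G\<bar> * (det J)\<^sup>2"
      by (simp add: pull2_real det_mul abs_mult power2_eq_square)
    then show ?thesis using assms(2) by (simp add: s_def real_sqrt_mult)
  qed
  have "pull2 J (hodge G \<alpha>) $ i $ j = (\<Sum>c\<in>UNIV. \<Sum>d\<in>UNIV. \<Sum>a\<in>UNIV. \<Sum>b\<in>UNIV. \<Sum>m\<in>UNIV. \<Sum>n\<in>UNIV.
      complex_of_real (s * (J $ a $ m * J $ b $ n * J $ c $ i * J $ d $ j * levi_civita a b c d)) * R $ m $ n)"
    unfolding pull2_def hodge_raise2 raise
    by (simp only: vec_lambda_beta scaleR_conv_of_real sum_distrib_left s_def of_real_mult mult_ac)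
  also have "\<dots> = (\<Sum>a\<in>UNIV. \<Sum>b\<in>UNIV. \<Sum>c\<in>UNIV. \<Sum>d\<in>UNIV. \<Sum>m\<in>UNIV. \<Sum>n\<in>UNIV.
      complex_of_real (s * (J $ a $ m * J $ b $ n * J $ c $ i * J $ d $ j * levi_civita a b c d)) * R $ m $ n)"
    by (rule sum_swap22)
  also have "\<dots> = (\<Sum>a\<in>UNIV. \<Sum>b\<in>UNIV. \<Sum>m\<in>UNIV. \<Sum>n\<in>UNIV. \<Sum>c\<in>UNIV. \<Sum>d\<in>UNIV.
      complex_of_real (s * (J $ a $ m * J $ b $ n * J $ c $ i * J $ d $ j * levi_civita a b c d)) * R $ m $ n)"
    by (rule sum.cong[OF refl], rule sum.cong[OF refl], rule sum_swap22)
  also have "\<dots> = (\<Sum>m\<in>UNIV. \<Sum>n\<in>UNIV. \<Sum>a\<in>UNIV. \<Sum>b\<in>UNIV. \<Sum>c\<in>UNIV. \<Sum>d\<in>UNIV.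
      complex_of_real (s * (J $ a $ m * J $ b $ n * J $ c $ i * J $ d $ j * levi_civita a b c d)) * R $ m $ n)"
    by (rule sum_swap22)
  also have "\<dots> = (\<Sum>m\<in>UNIV. \<Sum>n\<in>UNIV. complex_of_real (s * (\<Sum>a\<in>UNIV. \<Sum>b\<in>UNIV. \<Sum>c\<in>UNIV. \<Sum>d\<in>UNIV.
      J $ a $ m * J $ b $ n * J $ c $ i * J $ d $ j * levi_civita a b c d)) * R $ m $ n)"
    by (simp add: sum_distrib_left sum_distrib_right)
  also have "\<dots> = hodge (pull2 J G) (pull2 J \<alpha>) $ i $ j"
    unfolding levi_civita_transform hodge_raise2 R_def[symmetric] vol by (simp add: mult_ac)
  finally show "hodge (pull2 J G) (pull2 J \<alpha>) $ i $ j = pull2 J (hodge G \<alpha>) $ i $ j" ..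
qed

lemma pull2_linear_map:
  assumes "linear f"
  shows "f (pull2 J \<beta> $ i $ j) = pull2 J (\<chi> k l. f (\<beta> $ k $ l)) $ i $ j"
  by (simp add: pull2_def linear_sum[OF assms] linear_scale[OF assms])

definition entry :: "'n \<Rightarrow> 'k \<Rightarrow> complex ^ 'k ^ 'n ^ 4 ^ 4 \<Rightarrow> complex ^ 4 ^ 4" where
  "entry r s \<alpha> = (\<chi> i j. \<alpha> $ i $ j $ r $ s)"

lemma linear_nth2: "linear (\<lambda>X :: complex ^ 'k ^ 'n. X $ r $ s)"
  by (rule linearI) simp_all

lemma entry_hodge: "entry r s (hodge G \<beta>) = hodge G (entry r s \<beta>)"
  using hodge_linear_map[OF linear_nth2[of r s], of G \<beta>] by (simp add: vec_eq_iff entry_def)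

lemma entry_pull2: "entry r s (pull2 J \<beta>) = pull2 J (entry r s \<beta>)"
  using pull2_linear_map[OF linear_nth2[of r s], of J \<beta>] by (simp add: vec_eq_iff entry_def)

lemma entry_eqI: "(\<And>r s. entry r s \<alpha> = entry r s \<beta>) \<Longrightarrow> \<alpha> = \<beta>"
  by (simp add: vec_eq_iff entry_def)

lemma hodge_pull2:
  fixes \<beta> :: "cmat2 ^ 4 ^ 4"
  assumes "invertible G" "det J > 0"
  shows "hodge (pull2 J G) (pull2 J \<beta>) = pull2 J (hodge G \<beta>)"
  by (rule entry_eqI) (simp add: entry_hodge entry_pull2 hodge_pull2_complex[OF assms])

text \<open>Raising an index 0 costs a sign. The components 23, 31, 12 therefore enter with a plus
  sign and 01, 02, 03 with a minus sign, and the star squares to -1.\<close>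

lemma hodge_minkowski:
  fixes \<alpha> :: "'a::real_vector ^ 4 ^ 4"
  assumes "alternating2 \<alpha>"
  shows "hodge minkowski \<alpha> $ 0 $ 1 = \<alpha> $ 2 $ 3" "hodge minkowski \<alpha> $ 0 $ 2 = \<alpha> $ 3 $ 1"
    "hodge minkowski \<alpha> $ 0 $ 3 = \<alpha> $ 1 $ 2" "hodge minkowski \<alpha> $ 2 $ 3 = - \<alpha> $ 0 $ 1"
    "hodge minkowski \<alpha> $ 3 $ 1 = - \<alpha> $ 0 $ 2" "hodge minkowski \<alpha> $ 1 $ 2 = - \<alpha> $ 0 $ 3"
proof -
  have alt: "\<alpha> $ 1 $ 0 = - \<alpha> $ 0 $ 1" "\<alpha> $ 2 $ 0 = - \<alpha> $ 0 $ 2" "\<alpha> $ 3 $ 0 = - \<alpha> $ 0 $ 3"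
    "\<alpha> $ 3 $ 2 = - \<alpha> $ 2 $ 3" "\<alpha> $ 1 $ 3 = - \<alpha> $ 3 $ 1" "\<alpha> $ 2 $ 1 = - \<alpha> $ 1 $ 2"
    using assms unfolding alternating2_def by blast+
  have half: "(1 / 2) *\<^sub>R x + (1 / 2) *\<^sub>R x = x" for x :: 'a
    by (simp add: scaleR_add_left[symmetric])
  have half': "- ((1 / 2) *\<^sub>R x) - (1 / 2) *\<^sub>R x = - x" for x :: 'a
    using half[of x] by (metis diff_conv_add_uminus minus_add_distrib)
  have *: "hodge minkowski \<alpha> $ i $ j = (\<Sum>a\<in>UNIV. \<Sum>b\<in>UNIV.
     (1 / 2 * levi_civita a b i j * minkowski $ a $ a * minkowski $ b $ b) *\<^sub>R \<alpha> $ a $ b)" for i j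
  proof -
    have inner: "(\<Sum>a\<in>UNIV. \<Sum>b\<in>UNIV. (1 / 2 * levi_civita a b i j * minkowski $ a $ k * minkowski $ b $ l) *\<^sub>R \<alpha> $ k $ l)
      = (1 / 2 * levi_civita k l i j * minkowski $ k $ k * minkowski $ l $ l) *\<^sub>R \<alpha> $ k $ l" for k l
    proof -
      define m where "m = (\<lambda>k. minkowski $ k $ k)"
      have m: "minkowski $ a $ k = (if a = k then m k else 0)" for a k
        by (simp add: m_def minkowski_def)
      have "(\<Sum>a\<in>UNIV. \<Sum>b\<in>UNIV. (1 / 2 * levi_civita a b i j * minkowski $ a $ k * minkowski $ b $ l) *\<^sub>R \<alpha> $ k $ l)
        = (\<Sum>a\<in>UNIV. if a = k then (\<Sum>b\<in>UNIV. if b = l then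
            (1 / 2 * levi_civita a b i j * m k * m l) *\<^sub>R \<alpha> $ k $ l else 0) else 0)"
        unfolding m
      proof (rule sum.cong[OF refl])
        show "(\<Sum>b\<in>UNIV. (1 / 2 * levi_civita a b i j * (if a = k then m k else 0) * (if b = l then m l else 0)) *\<^sub>R \<alpha> $ k $ l)
          = (if a = k then (\<Sum>b\<in>UNIV. if b = l then
            (1 / 2 * levi_civita a b i j * m k * m l) *\<^sub>R \<alpha> $ k $ l else 0) else 0)" for a
        proof (cases "a = k")
          case True
          have "(1 / 2 * levi_civita a b i j * m k * (if b = l then m l else 0)) *\<^sub>R \<alpha> $ k $ l
            = (if b = l then (1 / 2 * levi_civita a b i j * m k * m l) *\<^sub>R \<alpha> $ k $ l else 0)" for b
            by simp
          then show ?thesis using True by (simp only: if_True simp_thms)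
        qed simp
      qed
      then show ?thesis by (simp add: m_def)
    qed
    have "hodge minkowski \<alpha> $ i $ j = (\<Sum>k\<in>UNIV. \<Sum>l\<in>UNIV. \<Sum>a\<in>UNIV. \<Sum>b\<in>UNIV.
        (1 / 2 * levi_civita a b i j * minkowski $ a $ k * minkowski $ b $ l) *\<^sub>R \<alpha> $ k $ l)"
      by (simp add: hodge_def matrix_inv_minkowski det_minkowski)
    then show ?thesis unfolding inner .
  qed
  show "hodge minkowski \<alpha> $ 0 $ 1 = \<alpha> $ 2 $ 3" "hodge minkowski \<alpha> $ 0 $ 2 = \<alpha> $ 3 $ 1"
    "hodge minkowski \<alpha> $ 0 $ 3 = \<alpha> $ 1 $ 2" "hodge minkowski \<alpha> $ 2 $ 3 = - \<alpha> $ 0 $ 1"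
    "hodge minkowski \<alpha> $ 3 $ 1 = - \<alpha> $ 0 $ 2" "hodge minkowski \<alpha> $ 1 $ 2 = - \<alpha> $ 0 $ 3"
    unfolding * sum_4_from_0
    by (simp_all add: levi_civita_eq_0 levi_civita_values minkowski_def alt half half')
qed

lemma alternating2_hodge: "alternating2 (hodge G \<beta>)"
  unfolding alternating2_def
proof (intro allI)
  fix i j
  have "levi_civita a b i j = - levi_civita a b j i" for a b by (rule levi_civita_swap(3))
  then show "hodge G \<beta> $ i $ j = - hodge G \<beta> $ j $ i" by (simp add: hodge_def sum_negf)
qed

lemma alternating2_pull2:
  assumes "alternating2 \<alpha>"
  shows "alternating2 (pull2 J \<alpha>)"
  unfolding alternating2_def
proof (intro allI)
  fix i j
  have "pull2 J \<alpha> $ i $ j = (\<Sum>b\<in>UNIV. \<Sum>a\<in>UNIV. (J $ a $ i * J $ b $ j) *\<^sub>R \<alpha> $ a $ b)"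
    by (simp add: pull2_def, rule sum.swap)
  also have "\<dots> = (\<Sum>b\<in>UNIV. \<Sum>a\<in>UNIV. - ((J $ b $ j * J $ a $ i) *\<^sub>R \<alpha> $ b $ a))"
  proof (intro sum.cong refl)
    fix a b show "(J $ a $ i * J $ b $ j) *\<^sub>R \<alpha> $ a $ b = - ((J $ b $ j * J $ a $ i) *\<^sub>R \<alpha> $ b $ a)"
      using assms unfolding alternating2_def by (metis mult.commute scaleR_minus_right)
  qed
  also have "\<dots> = - pull2 J \<alpha> $ j $ i" by (simp add: pull2_def sum_negf)
  finally show "pull2 J \<alpha> $ i $ j = - pull2 J \<alpha> $ j $ i" .
qed

section \<open>Functoriality of pullbacks\<close>

lemma pull2_add: "pull2 J (\<alpha> + \<beta>) = pull2 J \<alpha> + pull2 J \<beta>"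
  by (simp add: pull2_def vec_eq_iff scaleR_add_right sum.distrib)

lemma pull1_pull1: "pull1 K (pull1 J \<alpha>) = pull1 (J ** K) \<alpha>"
proof -
  have "pull1 K (pull1 J \<alpha>) $ i = (\<Sum>b\<in>UNIV. \<Sum>a\<in>UNIV. (J $ b $ a * K $ a $ i) *\<^sub>R \<alpha> $ b)" for i
    by (simp add: pull1_def scaleR_sum_right mult.commute, rule sum.swap)
  then show ?thesis by (simp add: vec_eq_iff pull1_def matrix_matrix_mult_def scaleR_sum_left)
qed

lemma pull1_uminus: "pull1 J (- \<alpha>) = - pull1 J \<alpha>"
  by (simp add: pull1_def vec_eq_iff sum_negf)

lemma pull1_mat1: "pull1 (mat 1) \<alpha> = \<alpha>"
  by (simp add: vec_eq_iff pull1_def mat_def if_distrib if_distribR sum.delta cong: if_cong)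

lemma pull1_eq_0_iff:
  assumes "invertible J"
  shows "pull1 J \<alpha> = 0 \<longleftrightarrow> \<alpha> = 0"
proof
  assume "pull1 J \<alpha> = 0"
  then have "pull1 (matrix_inv J) (pull1 J \<alpha>) = 0" by (simp add: pull1_def vec_eq_iff)
  then show "\<alpha> = 0" using assms by (simp add: pull1_pull1 matrix_inv_right pull1_mat1)
qed (simp add: pull1_def vec_eq_iff)

lemma pull2_pull2_complex: "pull2 K (pull2 J \<alpha>) = pull2 (J ** K) \<alpha>" for \<alpha> :: "complex ^ 4 ^ 4"
  by (simp add: pull2_complex cm_mult matrix_transpose_mul matrix_mul_assoc)

lemma pull2_mat1_complex: "pull2 (mat 1) \<alpha> = \<alpha>" for \<alpha> :: "complex ^ 4 ^ 4"
proof -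
  have "cm (mat 1) = (mat 1 :: complex ^ 4 ^ 4)" by (simp add: vec_eq_iff mat_def)
  then show ?thesis by (simp add: pull2_complex transpose_mat)
qed

lemma pull2_inject_complex:
  fixes \<alpha> :: "complex ^ 4 ^ 4"
  assumes "invertible J" "pull2 J \<alpha> = pull2 J \<beta>"
  shows "\<alpha> = \<beta>"
  using arg_cong[OF assms(2), of "pull2 (matrix_inv J)"] assms(1)
  by (simp add: pull2_pull2_complex matrix_inv_right pull2_mat1_complex)

lemma pull2_inject:
  fixes \<alpha> :: "cmat2 ^ 4 ^ 4"
  assumes "invertible J" "pull2 J \<alpha> = pull2 J \<beta>"
  shows "\<alpha> = \<beta>"
  by (rule entry_eqI, rule pull2_inject_complex[OF assms(1)]) (metis assms(2) entry_pull2)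

lemma alternating2_eqI:
  assumes "alternating2 \<alpha>" "alternating2 \<beta>"
    and "\<alpha> $ 0 $ 1 = \<beta> $ 0 $ 1" "\<alpha> $ 0 $ 2 = \<beta> $ 0 $ 2" "\<alpha> $ 0 $ 3 = \<beta> $ 0 $ 3"
    "\<alpha> $ 2 $ 3 = \<beta> $ 2 $ 3" "\<alpha> $ 3 $ 1 = \<beta> $ 3 $ 1" "\<alpha> $ 1 $ 2 = \<beta> $ 1 $ 2"
  shows "\<alpha> = \<beta>"
proof -
  have diag: "\<gamma> $ i $ i = 0" if "alternating2 \<gamma>" for \<gamma> :: "'a ^ 4 ^ 4" and i
  proof -
    have "\<gamma> $ i $ i = - \<gamma> $ i $ i" using that unfolding alternating2_def by blast
    then have "(2::real) *\<^sub>R \<gamma> $ i $ i = 0" by (metis add.right_inverse scaleR_2)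
    then show ?thesis by simp
  qed
  have neg: "\<alpha> $ j $ i = \<beta> $ j $ i" if "\<alpha> $ i $ j = \<beta> $ i $ j" for i j
    using assms(1,2) that unfolding alternating2_def by metis
  show ?thesis
    unfolding vec_eq_iff all_4_from_0
    by (intro conjI) (simp_all add: diag assms neg[OF assms(3)] neg[OF assms(4)] neg[OF assms(5)]
      neg[OF assms(6)] neg[OF assms(7)] neg[OF assms(8)])
qed

text \<open>In an oriented orthonormal frame the star exchanges the dual pairs 01 and 23, 02 and 31,
  03 and 12, with one sign on each round trip; naturality carries this back to G.\<close>

lemma hodge_hodge:
  fixes \<beta> :: "cmat2 ^ 4 ^ 4"
  assumes "lorentzian G" "alternating2 \<beta>"
  shows "hodge G (hodge G \<beta>) = - \<beta>"
proof -
  obtain P where P: "det P > 0" and iP: "invertible P" and PG: "pull2 P G = minkowski"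
    using lorentzian_pull2_frame[OF assms(1)] by blast
  have iG: "invertible G" using lorentzian_imp[OF assms(1)] by blast
  define \<alpha> where "\<alpha> = pull2 P \<beta>"
  have alt: "alternating2 \<alpha>" unfolding \<alpha>_def by (rule alternating2_pull2[OF assms(2)])
  have altn: "alternating2 (- \<alpha>)" using alt unfolding alternating2_def by (metis vector_uminus_component)
  have "hodge minkowski (hodge minkowski \<alpha>) = - \<alpha>"
    by (rule alternating2_eqI[OF alternating2_hodge altn])
      (simp_all add: hodge_minkowski[OF alt] hodge_minkowski[OF alternating2_hodge])
  moreover have "pull2 P (hodge G (hodge G \<beta>)) = hodge minkowski (hodge minkowski \<alpha>)"
    unfolding \<alpha>_def PG[symmetric] by (simp add: hodge_pull2[OF iG P])
  moreover have "pull2 P (- \<beta>) = - \<alpha>"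
    by (simp add: \<alpha>_def pull2_def vec_eq_iff sum_negf)
  ultimately show ?thesis by (metis pull2_inject[OF iP])
qed

section \<open>Chiral forms\<close>

text \<open>The complex structure on \<open>cmat2\<close>, whose scalar multiplication
  \<open>*\<^sub>R\<close> is real.\<close>

definition cscale :: "complex \<Rightarrow> cmat2 \<Rightarrow> cmat2" where
  "cscale c X = (\<chi> r s. c * X $ r $ s)"

lemma cscale_nth [simp]: "cscale c X $ r $ s = c * X $ r $ s"
  by (simp add: cscale_def)

lemma cscale_simps [simp]: "cscale c (cscale d X) = cscale (c * d) X" "cscale c (- X) = - cscale c X"
  by (simp_all add: vec_eq_iff)

lemma linear_cscale: "linear (cscale c)"
  by (rule linearI) (simp_all add: vec_eq_iff algebra_simps)

lemma trace_2: "trace (X :: cmat2) = X $ 1 $ 1 + X $ 2 $ 2"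
  by (simp add: trace_def sum_2)

definition tr2 :: "cmat2 \<Rightarrow> cmat2 \<Rightarrow> complex" where
  "tr2 X Y = trace (X ** Y)"

lemma tr2_sum: "tr2 X Y = (\<Sum>r\<in>UNIV. \<Sum>s\<in>UNIV. X $ r $ s * Y $ s $ r)"
  by (simp add: tr2_def trace_def matrix_matrix_mult_def)

lemma tr2_commute: "tr2 X Y = tr2 Y X"
  by (simp add: tr2_sum sum_2)

lemma tr2_simps [simp]:
  "tr2 (X + Y) Z = tr2 X Z + tr2 Y Z" "tr2 Z (X + Y) = tr2 Z X + tr2 Z Y"
  "tr2 (cscale c X) Z = c * tr2 X Z" "tr2 Z (cscale c X) = c * tr2 Z X"
  "tr2 (X - Y) Z = tr2 X Z - tr2 Y Z" "tr2 Z (X - Y) = tr2 Z X - tr2 Z Y"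
  "tr2 (- X) Z = - tr2 X Z" "tr2 Z (- X) = - tr2 Z X" "tr2 0 Z = 0" "tr2 Z 0 = 0"
  by (simp_all add: tr2_sum sum_2 algebra_simps)

lemma linear_tr2: "linear (tr2 X)" "linear (\<lambda>X. tr2 X Y)"
  by (simp_all add: linear_iff tr2_sum sum_2 scaleR_conv_of_real[where 'a = complex] algebra_simps)

lemma phi_nth: "phi X $ r $ s = - cnj (X $ s $ r)"
  by (simp add: phi_def)

lemma phi_phi [simp]: "phi (phi X) = X"
  by (simp add: vec_eq_iff phi_nth)

lemma linear_phi: "linear phi"
  by (rule linearI) (simp_all add: vec_eq_iff phi_nth)

lemma phi_commutator: "phi (commutator X Y) = commutator (phi X) (phi Y)"
  by (simp add: vec_eq_iff commutator_def phi_nth matrix_matrix_mult_def sum_2 mult.commute)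

lemma phi_sl2: "X \<in> sl2 \<Longrightarrow> phi X \<in> sl2"
  by (simp add: sl2_def trace_2 phi_nth complex_eq_iff)

definition cj :: "cmat2 ^ 4 ^ 4 \<Rightarrow> cmat2 ^ 4 ^ 4" where
  "cj \<alpha> = (\<chi> i j. phi (\<alpha> $ i $ j))"

lemma cj_nth [simp]: "cj \<alpha> $ i $ j = phi (\<alpha> $ i $ j)"
  by (simp add: cj_def)

lemma conj2_cj: "conj2 \<omega> c p = cj (\<omega> c p)"
  by (simp add: conj2_def cj_def)

lemma cj_pull2: "cj (pull2 J \<alpha>) = pull2 J (cj \<alpha>)"
  using pull2_linear_map[OF linear_phi] by (simp add: vec_eq_iff cj_def)

lemma cj_hodge: "cj (hodge G \<alpha>) = hodge G (cj \<alpha>)"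
  using hodge_linear_map[OF linear_phi] by (simp add: vec_eq_iff cj_def)

definition csc2 :: "complex \<Rightarrow> cmat2 ^ 4 ^ 4 \<Rightarrow> cmat2 ^ 4 ^ 4" where
  "csc2 c \<alpha> = (\<chi> i j. cscale c (\<alpha> $ i $ j))"

lemma csc2_nth [simp]: "csc2 c \<alpha> $ i $ j = cscale c (\<alpha> $ i $ j)"
  by (simp add: csc2_def)

lemma csc2_pull2: "csc2 c (pull2 J \<alpha>) = pull2 J (csc2 c \<alpha>)"
  using pull2_linear_map[OF linear_cscale] by (simp add: vec_eq_iff csc2_def)

text \<open>The eigenvalue is a parameter, \<i> for self-dual and -\<i> for anti-self-dual forms, so
  that conjugation acts on it by \<open>cnj\<close> and one set of component formulas serves both
  chiralities.\<close>

definition dual_form :: "complex \<Rightarrow> real ^ 4 ^ 4 \<Rightarrow> cmat2 ^ 4 ^ 4 \<Rightarrow> bool" where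
  "dual_form \<epsilon> G \<alpha> \<longleftrightarrow> alternating2 \<alpha> \<and> hodge G \<alpha> = csc2 \<epsilon> \<alpha>"

lemma dual_form_pull2:
  assumes "invertible G" "det J > 0" "dual_form \<epsilon> G \<alpha>"
  shows "dual_form \<epsilon> (pull2 J G) (pull2 J \<alpha>)"
  using assms by (simp add: dual_form_def hodge_pull2 alternating2_pull2 csc2_pull2)

lemma dual_form_cj:
  assumes "dual_form \<epsilon> G \<alpha>"
  shows "dual_form (cnj \<epsilon>) G (cj \<alpha>)"
proof -
  have "alternating2 (cj \<alpha>)"
    using assms unfolding dual_form_def alternating2_def by (metis cj_nth linear_neg linear_phi)
  moreover have "hodge G (cj \<alpha>) = csc2 (cnj \<epsilon>) (cj \<alpha>)"
    using assms unfolding cj_hodge[symmetric] dual_form_def by (simp add: vec_eq_iff phi_nth)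
  ultimately show ?thesis by (simp add: dual_form_def)
qed

lemma dual_form_minkowski:
  assumes "dual_form \<epsilon> minkowski \<alpha>"
  shows "\<alpha> $ 2 $ 3 = cscale \<epsilon> (\<alpha> $ 0 $ 1)" "\<alpha> $ 3 $ 1 = cscale \<epsilon> (\<alpha> $ 0 $ 2)" "\<alpha> $ 1 $ 2 = cscale \<epsilon> (\<alpha> $ 0 $ 3)"
    "\<alpha> $ 3 $ 2 = - cscale \<epsilon> (\<alpha> $ 0 $ 1)" "\<alpha> $ 1 $ 3 = - cscale \<epsilon> (\<alpha> $ 0 $ 2)" "\<alpha> $ 2 $ 1 = - cscale \<epsilon> (\<alpha> $ 0 $ 3)"
    "\<alpha> $ 1 $ 0 = - \<alpha> $ 0 $ 1" "\<alpha> $ 2 $ 0 = - \<alpha> $ 0 $ 2" "\<alpha> $ 3 $ 0 = - \<alpha> $ 0 $ 3" "\<alpha> $ i $ i = 0"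
proof -
  have alt: "alternating2 \<alpha>" and h: "hodge minkowski \<alpha> = csc2 \<epsilon> \<alpha>"
    using assms by (auto simp: dual_form_def)
  have neg: "\<alpha> $ i $ j = - \<alpha> $ j $ i" for i j using alt unfolding alternating2_def by blast
  show 1: "\<alpha> $ 2 $ 3 = cscale \<epsilon> (\<alpha> $ 0 $ 1)" "\<alpha> $ 3 $ 1 = cscale \<epsilon> (\<alpha> $ 0 $ 2)" "\<alpha> $ 1 $ 2 = cscale \<epsilon> (\<alpha> $ 0 $ 3)"
    using hodge_minkowski[OF alt] unfolding h by simp_all
  show "\<alpha> $ 3 $ 2 = - cscale \<epsilon> (\<alpha> $ 0 $ 1)" "\<alpha> $ 1 $ 3 = - cscale \<epsilon> (\<alpha> $ 0 $ 2)" "\<alpha> $ 2 $ 1 = - cscale \<epsilon> (\<alpha> $ 0 $ 3)"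
    unfolding 1[symmetric] by (rule neg)+
  show "\<alpha> $ 1 $ 0 = - \<alpha> $ 0 $ 1" "\<alpha> $ 2 $ 0 = - \<alpha> $ 0 $ 2" "\<alpha> $ 3 $ 0 = - \<alpha> $ 0 $ 3"
    by (rule neg)+
  have "\<alpha> $ i $ i $ r $ s = 0" for r s
    using arg_cong[OF neg[of i i], of "\<lambda>X. X $ r $ s"] by simp
  then show "\<alpha> $ i $ i = 0" by (simp add: vec_eq_iff)
qed

lemma minkowski_nth: "minkowski $ i $ j = (if i = j then if i = 0 then - 1 else 1 else 0)"
  by (simp add: minkowski_def)

lemma matrix_add_mult_distrib:
  "(A + B) ** C = A ** C + B ** (C :: 'a::semiring_1 ^ 'n ^ 'k)"
  by (simp add: vec_eq_iff matrix_matrix_mult_def distrib_right sum.distrib)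

section \<open>Energy-momentum tensors\<close>

text \<open>The common core of \<open>clebsch_gordan\<close> and \<open>em_tensor\<close>: one index
  of each form is contracted and the values are paired by the trace.\<close>

definition contract :: "real ^ 4 ^ 4 \<Rightarrow> cmat2 ^ 4 ^ 4 \<Rightarrow> cmat2 ^ 4 ^ 4 \<Rightarrow> complex ^ 4 ^ 4" where
  "contract G \<alpha> \<beta> = (\<chi> m n. \<Sum>l\<in>UNIV. \<Sum>k\<in>UNIV.
     complex_of_real (matrix_inv G $ k $ l) * tr2 (\<alpha> $ m $ l) (\<beta> $ n $ k))"

text \<open>Splitting the trace into matrix entries leaves products of complex 4 by 4 matrices, for
  which the behaviour under congruence is immediate.\<close>

lemma contract_entries:
  "contract G \<alpha> \<beta> = (\<Sum>r\<in>UNIV. \<Sum>s\<in>UNIV.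
     entry r s \<alpha> ** transpose (cm (matrix_inv G)) ** transpose (entry s r \<beta>))"
proof -
  have "(entry r s \<alpha> ** transpose (cm (matrix_inv G)) ** transpose (entry s r \<beta>)) $ m $ n =
    (\<Sum>l\<in>UNIV. \<Sum>k\<in>UNIV. complex_of_real (matrix_inv G $ k $ l) * (\<alpha> $ m $ l $ r $ s * \<beta> $ n $ k $ s $ r))"
    for r s m n
    by (simp add: matrix_matrix_mult_def transpose_def entry_def sum_distrib_right sum_distrib_left mult_ac,
        rule sum.swap)
  then show ?thesis
    by (simp add: vec_eq_iff contract_def tr2_sum sum_2 sum.distrib distrib_left)
qed

lemma contract_pull2:
  assumes "invertible G" "invertible J"
  shows "contract (pull2 J G) (pull2 J \<alpha>) (pull2 J \<beta>) = pull2 J (contract G \<alpha> \<beta>)"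
proof -
  have H: "cm J ** cm (matrix_inv (pull2 J G)) ** transpose (cm J) = cm (matrix_inv G)"
    unfolding pull2_real cm_mult[symmetric] cm_transpose[symmetric] matrix_inv_congruence[OF assms] ..
  have "entry r s (pull2 J \<alpha>) ** transpose (cm (matrix_inv (pull2 J G))) ** transpose (entry s r (pull2 J \<beta>))
    = transpose (cm J) ** (entry r s \<alpha> ** transpose (cm (matrix_inv G)) ** transpose (entry s r \<beta>)) ** cm J" for r s
    unfolding entry_pull2 pull2_complex H[symmetric]
    by (simp only: matrix_transpose_mul transpose_transpose matrix_mul_assoc)
  then show ?thesis
    by (simp add: contract_entries pull2_complex sum_2 matrix_add_ldistrib matrix_add_mult_distrib)
qed

lemma clebsch_gordan_trace_tensor:
  "clebsch_gordan G (- trace_tensor \<alpha> \<beta>) = (\<chi> m n. - 2 * contract G \<alpha> \<beta> $ m $ n)"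
  by (simp add: clebsch_gordan_def contract_def trace_tensor_def tr2_def vec_eq_iff sum_negf sum_distrib_left)

text \<open>The scalar built from all four indices of F and F is the metric trace of
  \<open>contract\<close>; symmetry of the inverse metric brings its index pairs into the required
  order.\<close>

lemma em_tensor_contract:
  assumes "transpose (matrix_inv G) = matrix_inv G"
  shows "em_tensor G F = (\<chi> m n. - (contract G F F $ m $ n - complex_of_real (1 / 4 * G $ m $ n) *
     (\<Sum>a\<in>UNIV. \<Sum>k\<in>UNIV. complex_of_real (matrix_inv G $ a $ k) * contract G F F $ a $ k)))"
proof -
  let ?H = "matrix_inv G"
  have lin: "linear (trace :: cmat2 \<Rightarrow> complex)"
    by (rule linearI) (simp_all add: trace_2 algebra_simps)
  have sym: "?H $ a $ b = ?H $ b $ a" for a b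
    using arg_cong[OF assms, of "\<lambda>X. X $ b $ a"] by (simp add: transpose_def)
  have 1: "trace (\<Sum>l\<in>UNIV. \<Sum>k\<in>UNIV. ?H $ k $ l *\<^sub>R (F $ m $ l ** F $ n $ k)) = contract G F F $ m $ n" for m n
    by (simp add: linear_sum[OF lin] linear_scale[OF lin] contract_def tr2_def scaleR_conv_of_real[where 'a = complex])
  have 2: "trace (\<Sum>a\<in>UNIV. \<Sum>b\<in>UNIV. \<Sum>k\<in>UNIV. \<Sum>l\<in>UNIV. (?H $ a $ k * ?H $ b $ l) *\<^sub>R (F $ a $ b ** F $ k $ l))
    = (\<Sum>a\<in>UNIV. \<Sum>k\<in>UNIV. complex_of_real (?H $ a $ k) * contract G F F $ a $ k)"
  proof -
    have "trace (\<Sum>a\<in>UNIV. \<Sum>b\<in>UNIV. \<Sum>k\<in>UNIV. \<Sum>l\<in>UNIV. (?H $ a $ k * ?H $ b $ l) *\<^sub>R (F $ a $ b ** F $ k $ l))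
      = (\<Sum>a\<in>UNIV. \<Sum>b\<in>UNIV. \<Sum>k\<in>UNIV. \<Sum>l\<in>UNIV. complex_of_real (?H $ a $ k) *
          (complex_of_real (?H $ l $ b) * tr2 (F $ a $ b) (F $ k $ l)))"
      by (simp add: linear_sum[OF lin] linear_scale[OF lin] tr2_def scaleR_conv_of_real[where 'a = complex] sym mult.assoc)
    also have "\<dots> = (\<Sum>a\<in>UNIV. \<Sum>k\<in>UNIV. \<Sum>b\<in>UNIV. \<Sum>l\<in>UNIV. complex_of_real (?H $ a $ k) *
          (complex_of_real (?H $ l $ b) * tr2 (F $ a $ b) (F $ k $ l)))"
      by (rule sum.cong[OF refl], rule sum.swap)
    finally show ?thesis by (simp add: contract_def sum_distrib_left)
  qed
  show ?thesis
    unfolding em_tensor_def vec_eq_iff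
    by (simp only: vec_lambda_beta linear_diff[OF lin] linear_scale[OF lin] 1 2 scaleR_conv_of_real[where 'a = complex]) simp
qed

lemma contract_minkowski:
  "contract minkowski \<alpha> \<beta> $ m $ n = - tr2 (\<alpha> $ m $ 0) (\<beta> $ n $ 0) + tr2 (\<alpha> $ m $ 1) (\<beta> $ n $ 1)
    + tr2 (\<alpha> $ m $ 2) (\<beta> $ n $ 2) + tr2 (\<alpha> $ m $ 3) (\<beta> $ n $ 3)"
  by (simp add: contract_def matrix_inv_minkowski minkowski_nth sum_4_from_0)

text \<open>In an orthonormal frame the products of two forms of equal duality only contribute to the
  trace, which \<open>em_tensor\<close> removes.\<close>

lemma em_tensor_minkowski:
  assumes "dual_form \<i> minkowski \<alpha>" "dual_form (- \<i>) minkowski \<beta>"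
  shows "em_tensor minkowski (\<alpha> + \<beta>) = (\<chi> m n. - 2 * contract minkowski \<alpha> \<beta> $ m $ n)"
proof -
  note d = dual_form_minkowski[OF assms(1)] dual_form_minkowski[OF assms(2)]
  have sym: "transpose (matrix_inv minkowski) = matrix_inv minkowski"
    using lorentzian_imp[OF lorentzian_minkowski] by blast
  have tr: "(\<Sum>a\<in>UNIV. \<Sum>k\<in>UNIV. complex_of_real (matrix_inv minkowski $ a $ k) * c $ a $ k)
    = - c $ 0 $ 0 + c $ 1 $ 1 + c $ 2 $ 2 + c $ 3 $ 3" for c :: "complex ^ 4 ^ 4"
    by (simp add: matrix_inv_minkowski minkowski_nth sum_4_from_0)
  have c: "tr2 (\<beta> $ a $ b) (\<alpha> $ m $ n) = tr2 (\<alpha> $ m $ n) (\<beta> $ a $ b)" for a b m n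
    by (rule tr2_commute)
  have s: "tr2 (\<gamma> $ 0 $ 2) (\<gamma> $ 0 $ 1) = tr2 (\<gamma> $ 0 $ 1) (\<gamma> $ 0 $ 2)"
    "tr2 (\<gamma> $ 0 $ 3) (\<gamma> $ 0 $ 1) = tr2 (\<gamma> $ 0 $ 1) (\<gamma> $ 0 $ 3)"
    "tr2 (\<gamma> $ 0 $ 3) (\<gamma> $ 0 $ 2) = tr2 (\<gamma> $ 0 $ 2) (\<gamma> $ 0 $ 3)" for \<gamma> :: "cmat2 ^ 4 ^ 4"
    by (rule tr2_commute)+
  show ?thesis
    unfolding em_tensor_contract[OF sym] tr vec_eq_iff all_4_from_0
    by (intro conjI; simp add: contract_minkowski d minkowski_nth c s; simp add: field_simps)
qed

text \<open>The tensor part is natural by \<open>contract_pull2\<close>. The scalar part is the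
  trace of a matrix product, and its invariance is the cyclic symmetry of that trace.\<close>

lemma em_tensor_pull2:
  assumes "lorentzian G" "invertible J"
  shows "em_tensor (pull2 J G) (pull2 J F) = pull2 J (em_tensor G F)"
proof -
  have iG: "invertible G" and HT: "transpose (matrix_inv G) = matrix_inv G"
    using lorentzian_imp[OF assms(1)] by auto
  have HT': "transpose (matrix_inv (pull2 J G)) = matrix_inv (pull2 J G)"
    using lorentzian_imp[OF lorentzian_pull2[OF assms]] by auto
  define C where "C = contract G F F"
  define q where "q = (\<lambda>H C. \<Sum>a\<in>UNIV. \<Sum>k\<in>UNIV. complex_of_real (H $ a $ k) * (C :: complex ^ 4 ^ 4) $ a $ k)"
  have q: "q H C = trace (cm H ** transpose C)" for H C
    by (simp add: q_def trace_def matrix_matrix_mult_def transpose_def)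
  have "cm (matrix_inv G) = cm J ** cm (matrix_inv (pull2 J G)) ** transpose (cm J)"
    unfolding pull2_real cm_mult[symmetric] cm_transpose[symmetric] matrix_inv_congruence[OF iG assms(2)] ..
  then have "q (matrix_inv G) C = trace (cm J ** (cm (matrix_inv (pull2 J G)) ** transpose (cm J) ** transpose C))"
    by (simp add: q matrix_mul_assoc)
  also have "\<dots> = trace ((cm (matrix_inv (pull2 J G)) ** transpose (cm J) ** transpose C) ** cm J)"
    by (rule trace_mul_sym)
  also have "\<dots> = q (matrix_inv (pull2 J G)) (pull2 J C)"
    by (simp add: q pull2_complex matrix_transpose_mul matrix_mul_assoc)
  finally have qq: "q (matrix_inv (pull2 J G)) (pull2 J C) = q (matrix_inv G) C" ..
  have em: "em_tensor G F = (\<chi> m n. (q (matrix_inv G) C / 4) * cm G $ m $ n) - C"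
    if "C = contract G F F" "transpose (matrix_inv G) = matrix_inv G" for G F C
    using that by (simp add: em_tensor_contract q_def vec_eq_iff)
  have "em_tensor G F = (\<chi> m n. (q (matrix_inv G) C / 4) * cm G $ m $ n) - C"
    by (rule em[OF C_def HT])
  moreover have "em_tensor (pull2 J G) (pull2 J F)
    = (\<chi> m n. (q (matrix_inv (pull2 J G)) (pull2 J C) / 4) * cm (pull2 J G) $ m $ n) - pull2 J C"
    by (rule em[OF _ HT']) (simp add: C_def contract_pull2[OF iG assms(2)])
  moreover have "cm (pull2 J G) = pull2 J (cm G)"
    by (simp add: pull2_real pull2_complex cm_mult cm_transpose)
  moreover have "pull2 J ((\<chi> m n. c * X $ m $ n) - Y) = (\<chi> m n. c * pull2 J X $ m $ n) - pull2 J Y"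
    for c and X Y :: "complex ^ 4 ^ 4"
    by (simp add: pull2_def vec_eq_iff sum_subtractf scaleR_diff_right sum_distrib_left)
  ultimately show ?thesis by (simp only: qq)
qed

text \<open>The two mixed products of \<alpha> and \<beta> contribute equally, which explains the
  factor 2 in \<open>clebsch_gordan\<close>. The identity is checked in an orthonormal frame and
  pulled back.\<close>

lemma em_tensor_chiral:
  assumes "lorentzian G" "dual_form \<i> G \<alpha>" "dual_form (- \<i>) G \<beta>"
  shows "em_tensor G (\<alpha> + \<beta>) = clebsch_gordan G (- trace_tensor \<alpha> \<beta>)"
proof -
  obtain P where P: "det P > 0" and iP: "invertible P" and PG: "pull2 P G = minkowski"
    using lorentzian_pull2_frame[OF assms(1)] by blast
  have iG: "invertible G" using lorentzian_imp[OF assms(1)] by blast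
  have "pull2 P (em_tensor G (\<alpha> + \<beta>)) = em_tensor minkowski (pull2 P (\<alpha> + \<beta>))"
    by (simp add: em_tensor_pull2[OF assms(1) iP, symmetric] PG)
  also have "\<dots> = (\<chi> m n. - 2 * contract minkowski (pull2 P \<alpha>) (pull2 P \<beta>) $ m $ n)"
    unfolding pull2_add by (rule em_tensor_minkowski) (metis dual_form_pull2[OF iG P] assms PG)+
  also have "\<dots> = pull2 P (\<chi> m n. - 2 * contract G \<alpha> \<beta> $ m $ n)"
    unfolding PG[symmetric] contract_pull2[OF iG iP]
    by (simp add: pull2_def vec_eq_iff sum_distrib_left sum_negf)
  finally show ?thesis
    unfolding clebsch_gordan_trace_tensor by (rule pull2_inject_complex[OF iP])
qed

section \<open>Null vectors and the dominant energy condition\<close>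

text \<open>The flagpole of the spinor \<open>(p, q)\<close>.\<close>

definition null_vec :: "complex \<Rightarrow> complex \<Rightarrow> real ^ 4" where
  "null_vec p q = (\<chi> i. if i = 0 then (cmod p)\<^sup>2 + (cmod q)\<^sup>2 else if i = 1 then 2 * Re (cnj p * q)
     else if i = 2 then 2 * Im (cnj p * q) else (cmod p)\<^sup>2 - (cmod q)\<^sup>2)"

text \<open>These are the expectation values of the identity and the Pauli matrices in the spinor
  (p, q), written as polynomials in the spinor and its conjugate.\<close>

lemma null_vec_complex:
  "complex_of_real (null_vec p q $ 0) = p * cnj p + q * cnj q"
  "complex_of_real (null_vec p q $ 1) = cnj p * q + p * cnj q"
  "complex_of_real (null_vec p q $ 2) = - \<i> * (cnj p * q - p * cnj q)"
  "complex_of_real (null_vec p q $ 3) = p * cnj p - q * cnj q"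
  by (simp_all add: null_vec_def complex_eq_iff cmod_power2) (simp_all add: power2_eq_square)

lemma inner_prod_minkowski:
  "inner_prod minkowski v w = - v $ 0 * w $ 0 + v $ 1 * w $ 1 + v $ 2 * w $ 2 + v $ 3 * w $ 3"
  by (simp add: inner_prod_def inner_vec_def matrix_vector_mult_def minkowski_nth sum_4_from_0)

lemma null_vec_null: "inner_prod minkowski (null_vec p q) (null_vec p q) = 0"
  by (simp add: inner_prod_minkowski null_vec_def cmod_power2) algebra

lemma null_vec_time_pos: "p \<noteq> 0 \<or> q \<noteq> 0 \<Longrightarrow> null_vec p q $ 0 > 0"
  by (simp add: null_vec_def) (metis add_nonneg_pos add_pos_nonneg norm_ge_zero zero_le_power2 zero_less_norm_iff zero_less_power)

text \<open>Here \<open>y\<close> is the value of the self-dual form on the symmetrised product of the two spinors.\<close>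

lemma null_vec_contraction:
  fixes a :: "complex ^ 4 ^ 4" and p q r s y :: complex
  assumes "a $ 2 $ 3 = \<i> * a $ 0 $ 1" "a $ 3 $ 1 = \<i> * a $ 0 $ 2" "a $ 1 $ 2 = \<i> * a $ 0 $ 3"
    "a $ 3 $ 2 = - \<i> * a $ 0 $ 1" "a $ 1 $ 3 = - \<i> * a $ 0 $ 2" "a $ 2 $ 1 = - \<i> * a $ 0 $ 3"
    "a $ 1 $ 0 = - a $ 0 $ 1" "a $ 2 $ 0 = - a $ 0 $ 2" "a $ 3 $ 0 = - a $ 0 $ 3" "\<And>i. a $ i $ i = 0"
    and y_def: "y = (p * r - q * s) * a $ 0 $ 1 + \<i> * (p * r + q * s) * a $ 0 $ 2 - (p * s + q * r) * a $ 0 $ 3"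
  shows "(\<Sum>m\<in>UNIV. \<Sum>n\<in>UNIV. complex_of_real (null_vec p q $ m) * complex_of_real (null_vec r s $ n) *
    (- a $ m $ 0 * cnj (a $ n $ 0) + a $ m $ 1 * cnj (a $ n $ 1) + a $ m $ 2 * cnj (a $ n $ 2)
      + a $ m $ 3 * cnj (a $ n $ 3))) = 2 * (y * cnj y)"
proof -
  \<comment> \<open>Component 2 of a null vector carries a factor -\<i>. Splitting \<i> off
    \<open>a $ 0 $ 2\<close> absorbs it, so that \<i> survives only as an overall factor of
    \<open>u 2\<close> and \<open>w 2\<close>.\<close>
  obtain e1 e2 e3 where e: "a $ 0 $ 1 = e1" "a $ 0 $ 2 = \<i> * e2" "a $ 0 $ 3 = e3"
    by (metis complex_i_mult_minus minus_minus)
  \<comment> \<open>For each contracted index l the double sum factors into the contraction of a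
    with either null vector.\<close>
  define u where "u = (\<lambda>l. \<Sum>m\<in>UNIV. complex_of_real (null_vec p q $ m) * a $ m $ l)"
  define w where "w = (\<lambda>l. \<Sum>n\<in>UNIV. complex_of_real (null_vec r s $ n) * a $ n $ l)"
  have *: "(\<Sum>m\<in>UNIV. \<Sum>n\<in>UNIV. complex_of_real (null_vec p q $ m) * complex_of_real (null_vec r s $ n) *
    (- a $ m $ 0 * cnj (a $ n $ 0) + a $ m $ 1 * cnj (a $ n $ 1) + a $ m $ 2 * cnj (a $ n $ 2)
      + a $ m $ 3 * cnj (a $ n $ 3))) = - u 0 * cnj (w 0) + u 1 * cnj (w 1) + u 2 * cnj (w 2) + u 3 * cnj (w 3)"
  proof -
    have uw: "u l * cnj (w l) = (\<Sum>m\<in>UNIV. \<Sum>n\<in>UNIV.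
      complex_of_real (null_vec p q $ m) * complex_of_real (null_vec r s $ n) * (a $ m $ l * cnj (a $ n $ l)))" for l
      by (simp add: u_def w_def sum_product mult_ac)
    have "- (u 0 * cnj (w 0)) + u 1 * cnj (w 1) + u 2 * cnj (w 2) + u 3 * cnj (w 3) =
      (\<Sum>m\<in>UNIV. \<Sum>n\<in>UNIV. complex_of_real (null_vec p q $ m) * complex_of_real (null_vec r s $ n) *
    (- a $ m $ 0 * cnj (a $ n $ 0) + a $ m $ 1 * cnj (a $ n $ 1) + a $ m $ 2 * cnj (a $ n $ 2)
      + a $ m $ 3 * cnj (a $ n $ 3)))"
      unfolding uw sum_negf[symmetric] sum.distrib[symmetric] by (intro sum.cong refl) (simp add: algebra_simps)
    then show ?thesis by simp
  qed
  have row: "f 0 = - (A 1 * e1 + A 2 * (\<i> * e2) + A 3 * e3)"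
    "f 1 = A 0 * e1 - A 2 * (\<i> * e3) - A 3 * e2"
    "f 2 = A 0 * (\<i> * e2) + A 1 * (\<i> * e3) - A 3 * (\<i> * e1)"
    "f 3 = A 0 * e3 + A 1 * e2 + A 2 * (\<i> * e1)"
    if f: "f = (\<lambda>l. \<Sum>m\<in>UNIV. A m * a $ m $ l)" for f :: "4 \<Rightarrow> complex" and A
    unfolding f sum_4_from_0 assms(1-10) e by (simp_all add: algebra_simps)
  note rows = row[OF u_def] row[OF w_def]
  \<comment> \<open>Conjugates become independent indeterminates, and the claim becomes a polynomial
    identity.\<close>
  define P Q R S E1 E2 E3 where "P = cnj p" "Q = cnj q" "R = cnj r" "S = cnj s"
    and "E1 = cnj e1" "E2 = cnj e2" "E3 = cnj e3"
  note defs = this and fold = this[symmetric]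
  have cc: "cnj R = r" "cnj S = s" by (simp_all add: defs)
  have u: "u 0 = - ((P * q + p * Q) * e1 + (P * q - p * Q) * e2 + (p * P - q * Q) * e3)"
    "u 1 = (p * P + q * Q) * e1 - (P * q - p * Q) * e3 - (p * P - q * Q) * e2"
    "u 2 = \<i> * ((p * P + q * Q) * e2 + (P * q + p * Q) * e3 - (p * P - q * Q) * e1)"
    "u 3 = (p * P + q * Q) * e3 + (P * q + p * Q) * e2 + (P * q - p * Q) * e1"
    unfolding rows null_vec_complex fold by (simp_all add: algebra_simps)
  have w: "cnj (w 0) = - ((R * s + r * S) * E1 - (R * s - r * S) * E2 + (r * R - s * S) * E3)"
    "cnj (w 1) = (r * R + s * S) * E1 + (R * s - r * S) * E3 - (r * R - s * S) * E2"
    "cnj (w 2) = - \<i> * ((r * R + s * S) * E2 + (R * s + r * S) * E3 - (r * R - s * S) * E1)"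
    "cnj (w 3) = (r * R + s * S) * E3 + (R * s + r * S) * E2 - (R * s - r * S) * E1"
    unfolding rows null_vec_complex fold by (simp_all add: algebra_simps fold cc)
  have y: "y = (p * r - q * s) * e1 - (p * r + q * s) * e2 - (p * s + q * r) * e3"
    unfolding y_def e by (simp add: algebra_simps)
  have cy: "cnj y = (P * R - Q * S) * E1 - (P * R + Q * S) * E2 - (P * S + Q * R) * E3"
    unfolding y by (simp add: fold)
  have ii: "\<i> * X * (- \<i> * Y) = X * Y" for X Y using i_squared by algebra
  show ?thesis unfolding * u w ii cy unfolding y by algebra
qed

text \<open>The binary form A X^2 + C X Y + B Y^2 splits over the complex numbers into the linear
  factors p X + q Y and r X + s Y.\<close>

lemma binary_quadratic_factor:
  fixes A B C :: complex
  obtains p q r s where "p * r = A" "q * s = B" "p * s + q * r = C"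
proof (cases "A = 0")
  case True
  then show ?thesis using that[of 0 C 1 B] by simp
next
  case False
  \<comment> \<open>With p = 1 and r = A the third equation forces s = C - x A for q = x, and the
    second becomes a quadratic equation with this root.\<close>
  define x where "x = (C + csqrt (C\<^sup>2 - 4 * A * B)) / (2 * A)"
  have "(2 * A * x - C)\<^sup>2 = C\<^sup>2 - 4 * A * B" using False by (simp add: x_def)
  then have "4 * A * (x * (C - x * A)) = 4 * A * B" by algebra
  then have "x * (C - x * A) = B" using False by simp
  then show ?thesis using that[of 1 A x "C - x * A"] by simp
qed

text \<open>A linear relation between the components is a symmetric spinor, hence a symmetrised product
  of two spinors, and \<open>T\<close> vanishes on the pair of their null vectors.\<close>

lemma chiral_components_independent:
  assumes "dual_form \<i> minkowski \<omega>"
    and T: "clebsch_gordan minkowski (- trace_tensor \<omega> (cj \<omega>)) = cm T"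
    and pos: "\<And>p q r s. p \<noteq> 0 \<or> q \<noteq> 0 \<Longrightarrow> r \<noteq> 0 \<or> s \<noteq> 0 \<Longrightarrow>
      (\<Sum>m\<in>UNIV. \<Sum>n\<in>UNIV. null_vec p q $ m * null_vec r s $ n * T $ m $ n) \<noteq> 0"
    and z: "cscale x (\<omega> $ 0 $ 1) + cscale y (\<omega> $ 0 $ 2) + cscale z (\<omega> $ 0 $ 3) = 0"
  shows "x = 0 \<and> y = 0 \<and> z = 0"
proof (rule ccontr)
  assume nz: "\<not> (x = 0 \<and> y = 0 \<and> z = 0)"
  \<comment> \<open>These values solve p r - q s = x, \<i> (p r + q s) = y and p s + q r = -z, the
    coefficients of the linear expression in \<open>null_vec_contraction\<close>.\<close>
  obtain p q r s where pq: "p * r = (x - \<i> * y) / 2" "q * s = (- x - \<i> * y) / 2" "p * s + q * r = - z"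
    by (rule binary_quadratic_factor)
  have x: "p * r - q * s = x" unfolding pq by (simp add: field_simps)
  have y: "\<i> * (p * r + q * s) = y" unfolding pq by (simp add: field_simps)
  have "p \<noteq> 0 \<or> q \<noteq> 0" "r \<noteq> 0 \<or> s \<noteq> 0" using x y pq(3) nz by auto
  then have ne: "(\<Sum>m\<in>UNIV. \<Sum>n\<in>UNIV. null_vec p q $ m * null_vec r s $ n * T $ m $ n) \<noteq> 0"
    by (rule pos)
  \<comment> \<open>Since \<open>phi\<close> is minus the adjoint, -tr(X phi(Y)) is the Hermitian
    product of the entries of X and Y. Thus T is a sum of scalar contributions, one for each matrix
    entry.\<close>
  let ?f = "\<lambda>a b m n. - \<omega> $ m $ 0 $ a $ b * cnj (\<omega> $ n $ 0 $ a $ b) + \<omega> $ m $ 1 $ a $ b * cnj (\<omega> $ n $ 1 $ a $ b)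
    + \<omega> $ m $ 2 $ a $ b * cnj (\<omega> $ n $ 2 $ a $ b) + \<omega> $ m $ 3 $ a $ b * cnj (\<omega> $ n $ 3 $ a $ b)"
  have T': "cm T $ m $ n = 2 * (\<Sum>a\<in>UNIV. \<Sum>b\<in>UNIV. ?f a b m n)" for m n
    unfolding T[symmetric] clebsch_gordan_trace_tensor
    by (simp add: contract_minkowski tr2_sum phi_nth sum_2 algebra_simps)
  note d = dual_form_minkowski[OF assms(1)]
  \<comment> \<open>The assumed relation holds in every matrix entry separately, so the linear
    expression whose squared modulus appears is zero for each of them.\<close>
  have vanish: "(\<Sum>m\<in>UNIV. \<Sum>n\<in>UNIV. complex_of_real (null_vec p q $ m) * complex_of_real (null_vec r s $ n) * ?f a b m n) = 0"
    for a b
  proof -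
    have "x * \<omega> $ 0 $ 1 $ a $ b + y * \<omega> $ 0 $ 2 $ a $ b + z * \<omega> $ 0 $ 3 $ a $ b = 0"
      using arg_cong[OF z, of "\<lambda>X. X $ a $ b"] by simp
    then have "(p * r - q * s) * entry a b \<omega> $ 0 $ 1 + \<i> * (p * r + q * s) * entry a b \<omega> $ 0 $ 2
        - (p * s + q * r) * entry a b \<omega> $ 0 $ 3 = 0"
      unfolding x y pq(3) by (simp add: entry_def)
    then show ?thesis
      using null_vec_contraction[where a = "entry a b \<omega>" and p = p and q = q and r = r and s = s] by (simp add: entry_def d)
  qed
  have "complex_of_real (\<Sum>m\<in>UNIV. \<Sum>n\<in>UNIV. null_vec p q $ m * null_vec r s $ n * T $ m $ n)
    = (\<Sum>m\<in>UNIV. \<Sum>n\<in>UNIV. complex_of_real (null_vec p q $ m) * complex_of_real (null_vec r s $ n) * cm T $ m $ n)"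
    by simp
  also have "\<dots> = (\<Sum>m\<in>UNIV. \<Sum>n\<in>UNIV. \<Sum>a\<in>UNIV. \<Sum>b\<in>UNIV.
      2 * (complex_of_real (null_vec p q $ m) * complex_of_real (null_vec r s $ n) * ?f a b m n))"
    unfolding T' sum_distrib_left by (simp only: mult.left_commute)
  also have "\<dots> = (\<Sum>a\<in>UNIV. \<Sum>b\<in>UNIV. \<Sum>m\<in>UNIV. \<Sum>n\<in>UNIV.
      2 * (complex_of_real (null_vec p q $ m) * complex_of_real (null_vec r s $ n) * ?f a b m n))"
    by (rule sum_swap22)
  also have "\<dots> = 0" unfolding sum_distrib_left[symmetric] vanish by simp
  finally show False using ne by (simp only: of_real_eq_0_iff)
qed

text \<open>The Cauchy-Schwarz inequality makes the spatial part of the product smaller in modulus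
  than the time part, which therefore decides the sign. Strictness comes from the timelike vector
  a.\<close>

lemma minkowski_causal_time_sign:
  assumes "inner_prod minkowski a a < 0" "inner_prod minkowski b b \<le> 0" "b \<noteq> 0"
  shows "inner_prod minkowski a b < 0 \<longleftrightarrow> a $ 0 * b $ 0 > 0"
proof -
  define A where "A = a $ 1 * a $ 1 + a $ 2 * a $ 2 + a $ 3 * a $ 3"
  define B where "B = b $ 1 * b $ 1 + b $ 2 * b $ 2 + b $ 3 * b $ 3"
  define d where "d = a $ 1 * b $ 1 + a $ 2 * b $ 2 + a $ 3 * b $ 3"
  have a: "A < a $ 0 * a $ 0" and b: "B \<le> b $ 0 * b $ 0"
    using assms by (simp_all add: inner_prod_minkowski A_def B_def)
  have nn: "A \<ge> 0" "B \<ge> 0" by (simp_all add: A_def B_def)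
  \<comment> \<open>Lagrange's identity for the spatial parts.\<close>
  have "A * B - d * d = (a $ 1 * b $ 2 - a $ 2 * b $ 1)\<^sup>2 + (a $ 1 * b $ 3 - a $ 3 * b $ 1)\<^sup>2 + (a $ 2 * b $ 3 - a $ 3 * b $ 2)\<^sup>2"
    unfolding A_def B_def d_def by algebra
  then have cs: "d * d \<le> A * B"
    by (metis add_nonneg_nonneg diff_ge_0_iff_ge zero_le_power2)
  have b0: "b $ 0 \<noteq> 0"
  proof
    assume "b $ 0 = 0"
    then have "B = 0" using b nn by simp
    then have "b $ 1 = 0" "b $ 2 = 0" "b $ 3 = 0"
      unfolding B_def by (smt (verit) mult_eq_0_iff zero_le_square)+
    then have "b = 0" using \<open>b $ 0 = 0\<close> by (simp add: vec_eq_iff all_4_from_0)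
    then show False using assms(3) by simp
  qed
  have "d * d < (a $ 0 * b $ 0) * (a $ 0 * b $ 0)"
  proof -
    have "A * B \<le> A * (b $ 0 * b $ 0)" by (rule mult_left_mono[OF b nn(1)])
    also have "\<dots> < (a $ 0 * a $ 0) * (b $ 0 * b $ 0)"
      by (rule mult_strict_right_mono[OF a]) (use b0 in \<open>simp add: zero_less_mult_iff\<close>, linarith)
    finally show ?thesis using cs by (simp add: algebra_simps)
  qed
  then have "d\<^sup>2 < (a $ 0 * b $ 0)\<^sup>2" by (simp add: power2_eq_square)
  then have "\<bar>d\<bar> < \<bar>a $ 0 * b $ 0\<bar>" by (meson abs_le_square_iff not_le)
  moreover have "inner_prod minkowski a b = d - a $ 0 * b $ 0" by (simp add: inner_prod_minkowski d_def)
  ultimately show ?thesis by linarith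
qed

lemma inner_transpose: "(A *v x) \<bullet> y = x \<bullet> (transpose A *v y)" for A :: "real ^ 'n ^ 'm"
  using dot_lmul_matrix[of x "transpose A" y] by simp

lemma inner_prod_pull2: "inner_prod G (P *v v) (P *v w) = inner_prod (pull2 P G) v w"
  unfolding inner_prod_def pull2_real by (simp only: inner_transpose matrix_vector_mul_assoc matrix_mul_assoc)

lemma inner_prod_matrix_inv:
  assumes "lorentzian G"
  shows "inner_prod G (matrix_inv G *v u) w = u \<bullet> w"
  unfolding inner_prod_def using lorentzian_imp[OF assms]
  by (simp add: inner_transpose matrix_vector_mul_assoc matrix_inv_left)

text \<open>Along a null vector the strict dominant energy condition makes \<open>- T v\<close> timelike, so its
  product with a second null vector does not vanish.\<close>

lemma DEC_null_vec_nonzero: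
  fixes P :: "real ^ 4 ^ 4"
  assumes P: "det P > 0" "pull2 P G = minkowski" and "lorentzian G" and t: "inner_prod G t t < 0"
    and dec: "\<And>v. future_causal G t v \<Longrightarrow> future_timelike G t (- ((matrix_inv G ** T) *v v))"
    and nz: "p \<noteq> 0 \<or> q \<noteq> 0" "r \<noteq> 0 \<or> s \<noteq> 0"
  shows "(\<Sum>m\<in>UNIV. \<Sum>n\<in>UNIV. null_vec p q $ m * null_vec r s $ n * pull2 P T $ m $ n) \<noteq> 0"
proof -
  have iP: "invertible P" using P(1) by (simp add: invertible_det_nz)
  have PP: "P *v (matrix_inv P *v x) = x" for x
    by (simp add: matrix_vector_mul_assoc matrix_inv_right[OF iP])
  define t' where "t' = matrix_inv P *v t"
  have t': "P *v t' = t" unfolding t'_def by (rule PP)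
  have tt: "inner_prod minkowski t' t' < 0" using t unfolding t'[symmetric] inner_prod_pull2 P(2) .
  \<comment> \<open>The frame may be past-directed. Multiplying both null vectors by this sign makes
    them future-directed and leaves their value under T unchanged, as the sign squares to 1.\<close>
  define \<epsilon> where "\<epsilon> = sgn (t' $ 0)"
  have t0: "t' $ 0 \<noteq> 0"
    using tt unfolding inner_prod_minkowski by (smt (verit) mult_eq_0_iff zero_le_square)
  have eps: "\<epsilon> * \<epsilon> = 1" using t0 by (simp add: \<epsilon>_def sgn_if)
  have future: "inner_prod minkowski t' (\<epsilon> *\<^sub>R n) < 0" "\<epsilon> *\<^sub>R n \<noteq> 0" "inner_prod minkowski (\<epsilon> *\<^sub>R n) (\<epsilon> *\<^sub>R n) = 0"
    if "n = null_vec a b" "a \<noteq> 0 \<or> b \<noteq> 0" for n a b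
  proof -
    have n0: "n $ 0 > 0" using null_vec_time_pos that by simp
    show nz: "\<epsilon> *\<^sub>R n \<noteq> 0" using n0 eps by (metis mult_zero_left scaleR_eq_0_iff zero_index less_irrefl zero_neq_one)
    have "inner_prod minkowski (\<epsilon> *\<^sub>R n) (\<epsilon> *\<^sub>R n) = (\<epsilon> * \<epsilon>) * inner_prod minkowski n n"
      by (simp add: inner_prod_minkowski algebra_simps)
    then show null: "inner_prod minkowski (\<epsilon> *\<^sub>R n) (\<epsilon> *\<^sub>R n) = 0" using that null_vec_null by simp
    have "t' $ 0 * (\<epsilon> *\<^sub>R n) $ 0 > 0" using n0 t0 by (simp add: \<epsilon>_def sgn_if zero_less_mult_iff)
    then show "inner_prod minkowski t' (\<epsilon> *\<^sub>R n) < 0"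
      using minkowski_causal_time_sign[OF tt _ nz] null by simp
  qed
  define v where "v = \<epsilon> *\<^sub>R null_vec p q"
  define u where "u = \<epsilon> *\<^sub>R null_vec r s"
  have v: "inner_prod minkowski t' v < 0" "v \<noteq> 0" "inner_prod minkowski v v = 0"
    unfolding v_def using future[OF refl nz(1)] by simp_all
  have u: "inner_prod minkowski t' u < 0" "u \<noteq> 0" "inner_prod minkowski u u = 0"
    unfolding u_def using future[OF refl nz(2)] by simp_all
  have comm: "inner_prod minkowski x y = inner_prod minkowski y x" for x y
    by (simp add: inner_prod_minkowski mult.commute)
  define w where "w = - ((matrix_inv G ** T) *v (P *v u))"
  define w' where "w' = matrix_inv P *v w"
  have w': "P *v w' = w" unfolding w'_def by (rule PP)
  have "P *v u \<noteq> 0"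
    using u(2) iP by (metis matrix_inv_left matrix_vector_mul_assoc matrix_vector_mul_lid matrix_vector_mult_0_right)
  then have "future_causal G t (P *v u)"
    unfolding future_causal_def using u comm by (simp add: t'[symmetric] inner_prod_pull2 P(2))
  then have "future_timelike G t w" unfolding w_def by (rule dec)
  then have "inner_prod minkowski w' w' < 0" "inner_prod minkowski w' t' < 0"
    unfolding future_timelike_def w'[symmetric] t'[symmetric] inner_prod_pull2 P(2) by simp_all
  \<comment> \<open>Both vectors lie in the same half of the light cone as the time-orienting
    vector, hence in the same half as each other.\<close>
  moreover have "w' $ 0 * v $ 0 > 0"
  proof -
    have "t' $ 0 * v $ 0 > 0" using minkowski_causal_time_sign[OF tt _ v(2)] v by simp
    moreover have "w' \<noteq> 0" using \<open>inner_prod minkowski w' w' < 0\<close> by (auto simp: inner_prod_minkowski)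
    then have "t' $ 0 * w' $ 0 > 0"
      using minkowski_causal_time_sign[OF tt, of w'] \<open>inner_prod minkowski w' w' < 0\<close>
        \<open>inner_prod minkowski w' t' < 0\<close> comm by simp
    ultimately show ?thesis by (auto simp: zero_less_mult_iff)
  qed
  ultimately have "inner_prod minkowski w' v < 0"
    using minkowski_causal_time_sign[OF _ _ v(2), of w'] v by simp
  \<comment> \<open>The metric cancels the inverse metric in w, so that the product of w with the
    second vector is a value of -T.\<close>
  moreover have "inner_prod minkowski w' v = - (v \<bullet> (pull2 P T *v u))"
  proof -
    have "inner_prod minkowski w' v = inner_prod G w (P *v v)"
      unfolding w'[symmetric] inner_prod_pull2 P(2) ..
    also have "\<dots> = - inner_prod G (matrix_inv G *v (T *v (P *v u))) (P *v v)"
      unfolding w_def inner_prod_def by (simp add: matrix_vector_mul_assoc matrix_mul_assoc)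
    also have "\<dots> = - ((T *v (P *v u)) \<bullet> (P *v v))" by (simp only: inner_prod_matrix_inv[OF assms(3)])
    also have "\<dots> = - (v \<bullet> (pull2 P T *v u))"
      by (simp only: inner_commute[of _ "P *v v"] inner_transpose matrix_vector_mul_assoc matrix_mul_assoc pull2_real)
    finally show ?thesis .
  qed
  moreover have "v \<bullet> (pull2 P T *v u) = (\<epsilon> * \<epsilon>) *
      (\<Sum>m\<in>UNIV. \<Sum>n\<in>UNIV. null_vec p q $ m * null_vec r s $ n * pull2 P T $ m $ n)"
    by (simp add: v_def u_def inner_vec_def matrix_vector_mult_def sum_distrib_left mult_ac)
  ultimately show ?thesis by auto
qed

section \<open>Injectivity of the adjoint action\<close>

lemma commutator_simps [simp]:
  "commutator (X + Y) Z = commutator X Z + commutator Y Z" "commutator Z (X + Y) = commutator Z X + commutator Z Y"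
  "commutator (- X) Z = - commutator X Z" "commutator Z (- X) = - commutator Z X"
  "commutator (cscale c X) Z = cscale c (commutator X Z)" "commutator Z (cscale c X) = cscale c (commutator Z X)"
  "commutator X X = 0" "commutator 0 X = 0" "commutator X 0 = 0"
  by (simp_all add: vec_eq_iff commutator_def matrix_matrix_mult_def sum_2 algebra_simps)

lemma commutator_skew: "commutator Y X = - commutator X Y"
  by (simp add: commutator_def)

lemma commutator_sl2: "commutator X Y \<in> sl2"
  by (simp add: sl2_def commutator_def trace_2 matrix_matrix_mult_def sum_2)

lemma sl2_iff: "X \<in> sl2 \<longleftrightarrow> X $ 2 $ 2 = - X $ 1 $ 1"
  by (simp add: sl2_def trace_2 add_eq_0_iff)

lemma subspace_sl2: "subspace sl2"
  by (rule subspaceI) (simp_all add: sl2_iff)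

lemma cscale_sl2: "X \<in> sl2 \<Longrightarrow> cscale c X \<in> sl2"
  by (simp add: sl2_iff)

lemma tr2_commutator [simp]: "tr2 X (commutator X Y) = 0" "tr2 Y (commutator X Y) = 0"
  by (simp_all add: tr2_sum commutator_def matrix_matrix_mult_def sum_2 algebra_simps)

text \<open>tr(X [Y, Z]) is the invariant volume form of sl2; its cyclic symmetry reduces the triple
  products of a basis to a single number up to sign.\<close>

lemma tr2_commutator_cyclic: "tr2 X (commutator Y Z) = tr2 Z (commutator X Y)"
  by (simp add: tr2_sum commutator_def matrix_matrix_mult_def sum_2 algebra_simps)

text \<open>The entries 11, 12, 21 are coordinates on sl2, in which tr(X [Y, Z]) is twice the
  determinant of the three coordinate rows. Independence thus gives both a nonzero volume and a
  basis.\<close>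

lemma sl2_basis:
  assumes sl: "X \<in> sl2" "Y \<in> sl2" "Z \<in> sl2"
    and ind: "\<And>x y z. cscale x X + cscale y Y + cscale z Z = 0 \<Longrightarrow> x = 0 \<and> y = 0 \<and> z = 0"
  shows "tr2 X (commutator Y Z) \<noteq> 0"
    and "V \<in> sl2 \<Longrightarrow> \<exists>x y z. V = cscale x X + cscale y Y + cscale z Z"
proof -
  note sl22 = sl2_iff[THEN iffD1]
  define row3 where "row3 = (\<lambda>W :: cmat2. vector [W $ 1 $ 1, W $ 1 $ 2, W $ 2 $ 1] :: complex ^ 3)"
  define E :: "complex ^ 3 ^ 3" where "E = vector [row3 X, row3 Y, row3 Z]"
  have "\<exists>B. E ** B = mat 1"
    unfolding matrix_right_invertible_independent_rows
  proof (intro allI impI)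
    fix c :: "3 \<Rightarrow> complex" and i
    assume "(\<Sum>i\<in>UNIV. c i *s row i E) = 0"
    then have "c 1 *s row3 X + c 2 *s row3 Y + c 3 *s row3 Z = 0"
      by (simp add: sum_3 row_def E_def vec_nth_inverse)
    then have r: "c 1 * X $ 1 $ 1 + c 2 * Y $ 1 $ 1 + c 3 * Z $ 1 $ 1 = 0"
      "c 1 * X $ 1 $ 2 + c 2 * Y $ 1 $ 2 + c 3 * Z $ 1 $ 2 = 0"
      "c 1 * X $ 2 $ 1 + c 2 * Y $ 2 $ 1 + c 3 * Z $ 2 $ 1 = 0"
      by (simp_all add: vec_eq_iff forall_3 row3_def)
    have "c 1 * X $ 2 $ 2 + c 2 * Y $ 2 $ 2 + c 3 * Z $ 2 $ 2 = 0"
      unfolding sl[THEN sl22] using r(1) by algebra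
    then have "cscale (c 1) X + cscale (c 2) Y + cscale (c 3) Z = 0"
      using r by (simp only: vec_eq_iff forall_2) simp
    then have "c 1 = 0 \<and> c 2 = 0 \<and> c 3 = 0" by (rule ind)
    then show "c i = 0" using forall_3[of "\<lambda>i. c i = 0"] by blast
  qed
  then have iE: "invertible E" by (simp add: invertible_right_inverse)
  have detE: "det E = X $ 1 $ 1 * (Y $ 1 $ 2 * Z $ 2 $ 1 - Y $ 2 $ 1 * Z $ 1 $ 2)
     + X $ 1 $ 2 * (Y $ 2 $ 1 * Z $ 1 $ 1 - Y $ 1 $ 1 * Z $ 2 $ 1) + X $ 2 $ 1 * (Y $ 1 $ 1 * Z $ 1 $ 2 - Y $ 1 $ 2 * Z $ 1 $ 1)"
    by (simp add: det_3 E_def row3_def algebra_simps)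
  have "tr2 X (commutator Y Z) = 2 * det E"
    unfolding detE by (simp add: tr2_sum commutator_def matrix_matrix_mult_def sum_2 sl22 sl algebra_simps)
  then show "tr2 X (commutator Y Z) \<noteq> 0" using iE by (simp add: invertible_det_nz)
  assume V: "V \<in> sl2"
  have "transpose E *v (matrix_inv (transpose E) *v row3 V) = row3 V"
    using iE by (simp add: matrix_vector_mul_assoc matrix_inv_right invertible_transpose_iff)
  then obtain b where b: "transpose E *v b = row3 V" by blast
  have "V = cscale (b $ 1) X + cscale (b $ 2) Y + cscale (b $ 3) Z"
    using b by (simp add: vec_eq_iff forall_3 forall_2 row3_def E_def sl22 sl V matrix_vector_mult_def
        transpose_def sum_3 algebra_simps)
  then show "\<exists>x y z. V = cscale x X + cscale y Y + cscale z Z" by blast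
qed

text \<open>Pointwise injectivity of \<open>ad\<close>, through which alone the energy condition
  enters the later arguments.\<close>

definition nondegenerate :: "cmat2 ^ 4 ^ 4 \<Rightarrow> bool" where
  "nondegenerate \<omega> \<longleftrightarrow> (\<forall>B. (\<forall>i. B $ i \<in> sl2) \<longrightarrow> wedge12 commutator B \<omega> = 0 \<longrightarrow> B = 0)"

text \<open>Each B_i is expanded in the basis formed by the components 01, 02, 03. Pairing the four
  independent components of the 3-form with this basis by the trace gives twelve scalar equations,
  each carrying the nonzero factor tr(X [Y, Z]).\<close>

lemma nondegenerate_minkowski:
  assumes "dual_form \<i> minkowski \<omega>" and sl: "\<And>i j. \<omega> $ i $ j \<in> sl2"
    and ind: "\<And>x y z. cscale x (\<omega> $ 0 $ 1) + cscale y (\<omega> $ 0 $ 2) + cscale z (\<omega> $ 0 $ 3) = 0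
      \<Longrightarrow> x = 0 \<and> y = 0 \<and> z = 0"
  shows "nondegenerate \<omega>"
  unfolding nondegenerate_def
proof (intro allI impI)
  fix B :: "cmat2 ^ 4" assume B: "\<forall>i. B $ i \<in> sl2" and W: "wedge12 commutator B \<omega> = 0"
  note d = dual_form_minkowski[OF assms(1)]
  define X Y Z where "X = \<omega> $ 0 $ 1" and "Y = \<omega> $ 0 $ 2" and "Z = \<omega> $ 0 $ 3"
  note fold = this[symmetric]
  note basis = sl2_basis[of X Y Z, unfolded X_def Y_def Z_def, OF sl sl sl ind, folded X_def Y_def Z_def]
  have "\<exists>x y z. B $ i = cscale x X + cscale y Y + cscale z Z" for i
    using basis(2) B by blast
  then obtain x y z where xyz: "\<And>i. B $ i = cscale (x i) X + cscale (y i) Y + cscale (z i) Z"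
    by metis
  define D where "D = tr2 X (commutator Y Z)"
  have D: "D \<noteq> 0" unfolding D_def using basis(1) by simp
  have "- tr2 Y (commutator X Z) = D"
    using tr2_commutator_cyclic[of Y Z X] by (simp add: D_def commutator_skew[of Z X])
  then have "tr2 Y (commutator X Z) = - D" by (metis minus_minus)
  then have tr: "tr2 X (commutator Y Z) = D" "tr2 Y (commutator X Z) = - D" "tr2 Z (commutator X Y) = D"
    using tr2_commutator_cyclic[of X Y Z] by (simp_all add: D_def)
  have sk: "commutator Y X = - commutator X Y" "commutator Z X = - commutator X Z" "commutator Z Y = - commutator Y Z"
    by (rule commutator_skew)+
  have eq: "commutator (B $ i) (\<omega> $ j $ k) + commutator (B $ j) (\<omega> $ k $ i) + commutator (B $ k) (\<omega> $ i $ j) = 0" for i j k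
    using arg_cong[OF W, of "\<lambda>w. w $ i $ j $ k"] by (simp add: wedge12_def)
  have pair: "tr2 V (commutator (B $ i) (\<omega> $ j $ k) + commutator (B $ j) (\<omega> $ k $ i) + commutator (B $ k) (\<omega> $ i $ j)) = 0"
    for V i j k unfolding eq by simp
  \<comment> \<open>The purely spatial component 123 says that the 3 by 3 matrix of spatial
    coefficients is symmetric.\<close>
  have "D * (y 3 - z 2) = 0" "D * (z 1 - x 3) = 0" "D * (x 2 - y 1) = 0"
    using pair[of X 1 2 3] pair[of Y 1 2 3] pair[of Z 1 2 3]
    by (simp_all add: xyz d fold tr sk algebra_simps neg_eq_iff_add_eq_0)
  then have s: "y 3 = z 2" "z 1 = x 3" "x 2 = y 1" using D by simp_all
  have "D * (\<i> * y 0 + z 1) = 0" "D * (- \<i> * x 0 + z 2) = 0" "D * (x 1 + y 2) = 0"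
    using pair[of X 0 1 2] pair[of Y 0 1 2] pair[of Z 0 1 2]
    by (simp_all add: xyz d fold tr sk algebra_simps neg_eq_iff_add_eq_0)
  then have a: "z 1 = - \<i> * y 0" "z 2 = \<i> * x 0" "x 1 + y 2 = 0" using D by (simp_all add: add_eq_0_iff)
  have "D * (y 2 + z 3) = 0" "D * (\<i> * z 0 + x 2) = 0" "D * (- \<i> * y 0 + x 3) = 0"
    using pair[of X 0 2 3] pair[of Y 0 2 3] pair[of Z 0 2 3]
    by (simp_all add: xyz d fold tr sk algebra_simps neg_eq_iff_add_eq_0)
  then have b: "y 2 + z 3 = 0" "x 2 = - \<i> * z 0" "x 3 = \<i> * y 0" using D by (simp_all add: add_eq_0_iff)
  have "D * (- \<i> * z 0 + y 1) = 0" "D * (z 3 + x 1) = 0" "D * (\<i> * x 0 + y 3) = 0"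
    using pair[of X 0 3 1] pair[of Y 0 3 1] pair[of Z 0 3 1]
    by (simp_all add: xyz d fold tr sk algebra_simps neg_eq_iff_add_eq_0)
  then have c: "y 1 = \<i> * z 0" "z 3 + x 1 = 0" "y 3 = - \<i> * x 0" using D by (simp_all add: add_eq_0_iff)
  \<comment> \<open>Off-diagonal spatial coefficients with exchanged positions are opposite
    multiples of one time coefficient, but equal by symmetry, so all of these vanish. For the
    diagonal the three pairwise sums are zero.\<close>
  have "x 0 = 0" "y 0 = 0" "z 0 = 0" using s a b c by simp_all
  moreover have "x 1 = 0" "y 2 = 0" "z 3 = 0" using a(3) b(1) c(2) by algebra+
  ultimately have "B $ 0 = 0 \<and> B $ 1 = 0 \<and> B $ 2 = 0 \<and> B $ 3 = 0"
    using s a b c unfolding xyz by (simp add: vec_eq_iff)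
  then show "B = 0" by (simp add: vec_eq_iff[of B] all_4_from_0)
qed

text \<open>Cyclic permutation of the form indices corresponds to rotating the three
  summations.\<close>

lemma wedge12_pull:
  fixes m :: "'a::real_normed_vector \<Rightarrow> 'a \<Rightarrow> 'a"
  assumes "bounded_bilinear m"
  shows "wedge12 m (pull1 J \<alpha>) (pull2 J \<beta>) = pull3 J (wedge12 m \<alpha> \<beta>)"
proof -
  interpret bounded_bilinear m by (rule assms)

  have prod: "m (pull1 J \<alpha> $ i) (pull2 J \<beta> $ j $ k) = (\<Sum>a\<in>UNIV. \<Sum>b\<in>UNIV. \<Sum>c\<in>UNIV.
     (J $ a $ i * J $ b $ j * J $ c $ k) *\<^sub>R m (\<alpha> $ a) (\<beta> $ b $ c))" for i j k
  proof -
    have "m (pull1 J \<alpha> $ i) (pull2 J \<beta> $ j $ k) = (\<Sum>b\<in>UNIV. \<Sum>c\<in>UNIV. \<Sum>a\<in>UNIV.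
      (J $ a $ i * J $ b $ j * J $ c $ k) *\<^sub>R m (\<alpha> $ a) (\<beta> $ b $ c))"
      by (simp add: pull1_def pull2_def sum_left sum_right scaleR_left scaleR_right scaleR_sum_right mult_ac)
    then show ?thesis by (simp only: sum_rotate[of "\<lambda>b c a. (J $ a $ i * J $ b $ j * J $ c $ k) *\<^sub>R m (\<alpha> $ a) (\<beta> $ b $ c)"])
  qed
  have 2: "m (pull1 J \<alpha> $ j) (pull2 J \<beta> $ k $ i) = (\<Sum>a\<in>UNIV. \<Sum>b\<in>UNIV. \<Sum>c\<in>UNIV.
     (J $ a $ i * J $ b $ j * J $ c $ k) *\<^sub>R m (\<alpha> $ b) (\<beta> $ c $ a))" for i j k
    unfolding prod by (subst sum_rotate) (simp add: mult_ac)
  have 3: "m (pull1 J \<alpha> $ k) (pull2 J \<beta> $ i $ j) = (\<Sum>a\<in>UNIV. \<Sum>b\<in>UNIV. \<Sum>c\<in>UNIV.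
     (J $ a $ i * J $ b $ j * J $ c $ k) *\<^sub>R m (\<alpha> $ c) (\<beta> $ a $ b))" for i j k
    unfolding prod by (subst sum_rotate, subst sum_rotate) (simp add: mult_ac)
  have "wedge12 m (pull1 J \<alpha>) (pull2 J \<beta>) $ i $ j $ k = pull3 J (wedge12 m \<alpha> \<beta>) $ i $ j $ k" for i j k
    using prod[of i j k] 2[of j k i] 3[of k i j]
    by (simp add: wedge12_def pull3_def scaleR_add_right sum.distrib)
  then show ?thesis by (simp add: vec_eq_iff)
qed

lemma bounded_bilinear_commutator: "bounded_bilinear commutator"
proof -
  have "bilinear commutator"
    unfolding bilinear_def linear_iff
    by (simp add: vec_eq_iff commutator_def matrix_matrix_mult_def sum_2 algebra_simps)
  then show ?thesis by (simp add: bilinear_conv_bounded_bilinear)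
qed

lemma pull1_sl2: "(\<And>i. B $ i \<in> sl2) \<Longrightarrow> pull1 J B $ i \<in> sl2"
  by (simp add: pull1_def subspace_sum subspace_scale subspace_sl2)

lemma pull2_sl2: "(\<And>i j. \<omega> $ i $ j \<in> sl2) \<Longrightarrow> pull2 J \<omega> $ i $ j \<in> sl2"
  by (simp add: pull2_def subspace_sum subspace_scale subspace_sl2)

lemma nondegenerate_pull2:
  assumes "invertible J" "nondegenerate (pull2 J \<omega>)"
  shows "nondegenerate \<omega>"
  unfolding nondegenerate_def
proof (intro allI impI)
  fix B assume B: "\<forall>i. B $ i \<in> sl2" "wedge12 commutator B \<omega> = 0"
  have "wedge12 commutator (pull1 J B) (pull2 J \<omega>) = 0"
    unfolding wedge12_pull[OF bounded_bilinear_commutator] B(2) by (simp add: pull3_def vec_eq_iff)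
  then have "pull1 J B = 0"
    using assms(2) B(1) pull1_sl2 unfolding nondegenerate_def by blast
  then show "B = 0" by (simp add: pull1_eq_0_iff[OF assms(1)])
qed

text \<open>A frame at this single point suffices, since the conclusion is invariant under pullback
  and involves no derivative.\<close>

lemma sqrt_nondegenerate:
  assumes G: "lorentzian G" and t: "inner_prod G t t < 0"
    and dec: "\<And>v. future_causal G t v \<Longrightarrow> future_timelike G t (- ((matrix_inv G ** T) *v v))"
    and \<omega>: "dual_form \<i> G \<omega>" "\<And>i j. \<omega> $ i $ j \<in> sl2"
    and T: "clebsch_gordan G (- trace_tensor \<omega> (cj \<omega>)) = cm T"
  shows "nondegenerate \<omega>"
proof -
  obtain P where P: "det P > 0" and iP: "invertible P" and PG: "pull2 P G = minkowski"
    using lorentzian_pull2_frame[OF G] by blast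
  have iG: "invertible G" using lorentzian_imp[OF G] by blast
  have d: "dual_form \<i> minkowski (pull2 P \<omega>)"
    using dual_form_pull2[OF iG P \<omega>(1)] by (simp only: PG)
  have "clebsch_gordan minkowski (- trace_tensor (pull2 P \<omega>) (cj (pull2 P \<omega>)))
    = (\<chi> m n. - 2 * pull2 P (contract G \<omega> (cj \<omega>)) $ m $ n)"
    unfolding PG[symmetric] clebsch_gordan_trace_tensor cj_pull2 contract_pull2[OF iG iP] ..
  also have "\<dots> = pull2 P (\<chi> m n. - 2 * contract G \<omega> (cj \<omega>) $ m $ n)"
    by (simp add: pull2_def vec_eq_iff sum_distrib_left sum_negf)
  also have "\<dots> = pull2 P (cm T)" unfolding clebsch_gordan_trace_tensor[symmetric] T ..
  also have "\<dots> = cm (pull2 P T)" by (simp add: pull2_complex pull2_real cm_mult cm_transpose)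
  finally have T': "clebsch_gordan minkowski (- trace_tensor (pull2 P \<omega>) (cj (pull2 P \<omega>))) = cm (pull2 P T)" .
  have "nondegenerate (pull2 P \<omega>)"
  proof (rule nondegenerate_minkowski[OF d pull2_sl2[OF \<omega>(2)]])
    fix x y z
    assume "cscale x (pull2 P \<omega> $ 0 $ 1) + cscale y (pull2 P \<omega> $ 0 $ 2) + cscale z (pull2 P \<omega> $ 0 $ 3) = 0"
    then show "x = 0 \<and> y = 0 \<and> z = 0"
      by (rule chiral_components_independent[OF d T'
            DEC_null_vec_nonzero[where t = t, OF P PG G t dec], rotated -1])
  qed
  then show ?thesis by (rule nondegenerate_pull2[OF iP])
qed

section \<open>The adjoint matrix\<close>

definition sl2_coord :: "3 \<Rightarrow> cmat2 \<Rightarrow> complex" where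
  "sl2_coord k X = (if k = 1 then X $ 1 $ 1 else if k = 2 then X $ 1 $ 2 else X $ 2 $ 1)"

lemma sl2_coord_eqI:
  assumes "X \<in> sl2" "Y \<in> sl2" "\<And>k. sl2_coord k X = sl2_coord k Y"
  shows "X = Y"
  using assms(1,2) assms(3)[of 1] assms(3)[of 2] assms(3)[of 3]
  by (simp add: vec_eq_iff forall_2 sl2_iff sl2_coord_def)

lemma linear_sl2_coord: "linear (sl2_coord k)"
  by (rule linearI) (simp_all add: sl2_coord_def)

text \<open>Coordinates on sl2-valued covectors with index type \<open>4 \<times> 3\<close>; the
  entry 22 is determined by the vanishing trace.\<close>

definition sl2_vec :: "complex ^ (4 \<times> 3) \<Rightarrow> cmat2 ^ 4" where
  "sl2_vec v = (\<chi> i r s. if r = 1 then (if s = 1 then v $ (i, 1) else v $ (i, 2))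
     else (if s = 1 then v $ (i, 3) else - v $ (i, 1)))"

lemma sl2_vec_in: "sl2_vec v $ i \<in> sl2"
  by (simp add: sl2_vec_def sl2_iff)

lemma sl2_vec_linear: "sl2_vec (v + w) = sl2_vec v + sl2_vec w" "sl2_vec (c *s v) $ i = cscale c (sl2_vec v $ i)"
  by (simp_all add: sl2_vec_def vec_eq_iff)

lemma sl2_vec_eq_0: "sl2_vec v = 0 \<Longrightarrow> v = 0"
proof -
  assume "sl2_vec v = 0"
  then have "v $ (i, 1) = 0" "v $ (i, 2) = 0" "v $ (i, 3) = 0" for i
    by (simp_all add: vec_eq_iff sl2_vec_def forall_2)
  then have "v $ (i, k) = 0" for i k using forall_3[of "\<lambda>k. v $ (i, k) = 0"] by blast
  then show "v = 0" by (simp add: vec_eq_iff split_paired_all)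
qed

definition sl2_vec_inv :: "cmat2 ^ 4 \<Rightarrow> complex ^ (4 \<times> 3)" where
  "sl2_vec_inv B = (\<chi> q. sl2_coord (snd q) (B $ fst q))"

lemma sl2_vec_inv:
  assumes "\<And>i. B $ i \<in> sl2"
  shows "sl2_vec (sl2_vec_inv B) = B"
  using assms by (simp add: vec_eq_iff forall_2 sl2_vec_def sl2_vec_inv_def sl2_coord_def sl2_iff)

text \<open>The independent components of a 3-form are labelled by the missing index, which gives
  3-forms the same index type as 1-forms and makes the matrix of \<open>ad\<close> square.\<close>

definition omit :: "4 \<Rightarrow> 'a ^ 4 ^ 4 ^ 4 \<Rightarrow> 'a" where
  "omit i C = (if i = 0 then C $ 1 $ 2 $ 3 else if i = 1 then C $ 0 $ 2 $ 3
     else if i = 2 then C $ 0 $ 1 $ 3 else C $ 0 $ 1 $ 2)"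

lemma alternating3_eqI:
  fixes C D :: "'a::real_vector ^ 4 ^ 4 ^ 4"
  assumes "alternating3 C" "alternating3 D" "\<And>i. omit i C = omit i D"
  shows "C = D"
proof -
  have eq_neg: "x = 0" if "x = - x" for x :: 'a
  proof -
    have "(2::real) *\<^sub>R x = 0" using that by (metis add.right_inverse scaleR_2)
    then show ?thesis by simp
  qed
  have perm: "E $ j $ i $ k = - E $ i $ j $ k" "E $ i $ k $ j = - E $ i $ j $ k"
    "E $ j $ k $ i = E $ i $ j $ k" "E $ k $ i $ j = E $ i $ j $ k" "E $ k $ j $ i = - E $ i $ j $ k"
    if "alternating3 E" for E :: "'a ^ 4 ^ 4 ^ 4" and i j k
    using that unfolding alternating3_def by (metis minus_minus)+
  have zero: "E $ i $ i $ k = 0" "E $ i $ k $ k = 0" "E $ i $ k $ i = 0"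
    if "alternating3 E" for E :: "'a ^ 4 ^ 4 ^ 4" and i k
    using perm[OF that] eq_neg by metis+
  have base: "C $ 1 $ 2 $ 3 = D $ 1 $ 2 $ 3" "C $ 0 $ 2 $ 3 = D $ 0 $ 2 $ 3"
    "C $ 0 $ 1 $ 3 = D $ 0 $ 1 $ 3" "C $ 0 $ 1 $ 2 = D $ 0 $ 1 $ 2"
    using assms(3)[of 0] assms(3)[of 1] assms(3)[of 2] assms(3)[of 3] by (simp_all add: omit_def)
  note C = zero[OF assms(1)] perm[OF assms(1), where i = 1 and j = 2 and k = 3] perm[OF assms(1), where i = 0 and j = 2 and k = 3]
    perm[OF assms(1), where i = 0 and j = 1 and k = 3] perm[OF assms(1), where i = 0 and j = 1 and k = 2]
  note D = zero[OF assms(2)] perm[OF assms(2), where i = 1 and j = 2 and k = 3] perm[OF assms(2), where i = 0 and j = 2 and k = 3]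
    perm[OF assms(2), where i = 0 and j = 1 and k = 3] perm[OF assms(2), where i = 0 and j = 1 and k = 2]
  show ?thesis
    unfolding vec_eq_iff all_4_from_0 by (simp add: C D base)
qed

lemma alternating3_wedge12:
  assumes "bounded_bilinear m" "alternating2 \<beta>"
  shows "alternating3 (wedge12 m \<alpha> \<beta>)"
proof -
  interpret bounded_bilinear m by (rule assms)
  have neg: "m a (\<beta> $ i $ j) = - m a (\<beta> $ j $ i)" for a i j
    using assms(2) minus_right unfolding alternating2_def by metis
  show ?thesis
    unfolding alternating3_def wedge12_def vec_lambda_beta
  proof (intro allI conjI)
    fix i j k
    show "m (\<alpha> $ i) (\<beta> $ j $ k) + m (\<alpha> $ j) (\<beta> $ k $ i) + m (\<alpha> $ k) (\<beta> $ i $ j) =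
      - (m (\<alpha> $ j) (\<beta> $ i $ k) + m (\<alpha> $ i) (\<beta> $ k $ j) + m (\<alpha> $ k) (\<beta> $ j $ i))"
      using neg[of "\<alpha> $ j" i k] neg[of "\<alpha> $ i" k j] neg[of "\<alpha> $ k" j i] by simp
    show "m (\<alpha> $ i) (\<beta> $ j $ k) + m (\<alpha> $ j) (\<beta> $ k $ i) + m (\<alpha> $ k) (\<beta> $ i $ j) =
      - (m (\<alpha> $ i) (\<beta> $ k $ j) + m (\<alpha> $ k) (\<beta> $ j $ i) + m (\<alpha> $ j) (\<beta> $ i $ k))"
      using neg[of "\<alpha> $ j" i k] neg[of "\<alpha> $ i" k j] neg[of "\<alpha> $ k" j i] by simp
  qed
qed

lemma wedge12_sl2: "wedge12 commutator B \<omega> $ i $ j $ k \<in> sl2"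
  by (simp add: wedge12_def subspace_add subspace_sl2 commutator_sl2)

definition form3_vec :: "cmat2 ^ 4 ^ 4 ^ 4 \<Rightarrow> complex ^ (4 \<times> 3)" where
  "form3_vec C = (\<chi> q. sl2_coord (snd q) (omit (fst q) C))"

lemma form3_vec_eqI:
  assumes "alternating3 C" "alternating3 D" "\<And>i j k. C $ i $ j $ k \<in> sl2" "\<And>i j k. D $ i $ j $ k \<in> sl2"
    and "form3_vec C = form3_vec D"
  shows "C = D"
proof (rule alternating3_eqI[OF assms(1,2)], rule sl2_coord_eqI)
  fix i k
  show "sl2_coord k (omit i C) = sl2_coord k (omit i D)"
    using arg_cong[OF assms(5), of "\<lambda>v. v $ (i, k)"] by (simp add: form3_vec_def)
qed (simp_all add: omit_def assms)

definition ad_matrix :: "cmat2 ^ 4 ^ 4 \<Rightarrow> complex ^ (4 \<times> 3) ^ (4 \<times> 3)" where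
  "ad_matrix \<omega> = matrix (\<lambda>v. form3_vec (wedge12 commutator (sl2_vec v) \<omega>))"

lemma ad_matrix_mult: "ad_matrix \<omega> *v v = form3_vec (wedge12 commutator (sl2_vec v) \<omega>)"
proof -
  have "Vector_Spaces.linear (*s) (*s) (\<lambda>v. form3_vec (wedge12 commutator (sl2_vec v) \<omega>))"
    by unfold_locales
      (simp_all add: vec_eq_iff form3_vec_def omit_def sl2_coord_def wedge12_def sl2_vec_linear algebra_simps)
  then show ?thesis unfolding ad_matrix_def by (rule matrix_works)
qed

text \<open>The matrix is square, so a trivial kernel already makes it invertible; the kernel is
  trivial because an alternating sl2-valued 3-form is determined by
  \<open>form3_vec\<close>.\<close>

lemma det_ad_matrix:
  assumes "alternating2 \<omega>" "nondegenerate \<omega>"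
  shows "det (ad_matrix \<omega>) \<noteq> 0"
proof -
  have "v = 0" if "ad_matrix \<omega> *v v = 0" for v
  proof -
    have "wedge12 commutator (sl2_vec v) \<omega> = 0"
    proof (rule form3_vec_eqI)
      show "form3_vec (wedge12 commutator (sl2_vec v) \<omega>) = form3_vec 0"
        using that by (simp add: ad_matrix_mult form3_vec_def omit_def sl2_coord_def vec_eq_iff)
      show "alternating3 (0 :: cmat2 ^ 4 ^ 4 ^ 4)" by (simp add: alternating3_def)
      show "(0 :: cmat2 ^ 4 ^ 4 ^ 4) $ i $ j $ k \<in> sl2" for i j k by (simp add: sl2_iff)
    qed (rule alternating3_wedge12[OF bounded_bilinear_commutator assms(1)] wedge12_sl2)+
    then have "sl2_vec v = 0" using assms(2) sl2_vec_in unfolding nondegenerate_def by blast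
    then show ?thesis by (rule sl2_vec_eq_0)
  qed
  then have "\<exists>B. B ** ad_matrix \<omega> = mat 1" unfolding matrix_left_invertible_ker by blast
  then show ?thesis by (simp add: invertible_left_inverse[symmetric] invertible_det_nz)
qed

lemma nondegenerate_inject:
  assumes "nondegenerate \<omega>" "\<And>i. B $ i \<in> sl2" "\<And>i. B' $ i \<in> sl2"
    and "wedge12 commutator B \<omega> = wedge12 commutator B' \<omega>"
  shows "B = B'"
proof -
  interpret bounded_bilinear commutator by (rule bounded_bilinear_commutator)
  have "wedge12 commutator (B - B') \<omega> = 0"
    using assms(4) by (simp add: wedge12_def vec_eq_iff diff_left algebra_simps)
  moreover have "(B - B') $ i \<in> sl2" for i using assms(2,3) by (simp add: subspace_diff subspace_sl2)
  ultimately show ?thesis using assms(1) unfolding nondegenerate_def by (metis eq_iff_diff_eq_0)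
qed

lemma ad_matrix_solve:
  assumes "alternating2 \<omega>" "nondegenerate \<omega>" "alternating3 C" "\<And>i j k. C $ i $ j $ k \<in> sl2"
  shows "\<exists>B. (\<forall>i. B $ i \<in> sl2) \<and> wedge12 commutator B \<omega> = C"
proof -
  have "invertible (ad_matrix \<omega>)" using det_ad_matrix[OF assms(1,2)] by (simp add: invertible_det_nz)
  then have "ad_matrix \<omega> *v (matrix_inv (ad_matrix \<omega>) *v form3_vec C) = form3_vec C"
    by (simp add: matrix_vector_mul_assoc matrix_inv_right)
  then obtain v where "ad_matrix \<omega> *v v = form3_vec C" by blast
  then have "wedge12 commutator (sl2_vec v) \<omega> = C"
    unfolding ad_matrix_mult
    by (intro form3_vec_eqI alternating3_wedge12 bounded_bilinear_commutator assms wedge12_sl2)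
  then show ?thesis using sl2_vec_in by blast
qed

lemma smooth_on_wedge12:
  assumes "bounded_bilinear m" "open S" "smooth_on S \<alpha>" "smooth_on S \<beta>"
  shows "smooth_on S (\<lambda>x. wedge12 m (\<alpha> x) (\<beta> x))"
  unfolding wedge12_def
  by (rule smooth_on_vecI[OF assms(2)], simp, rule smooth_on_vecI[OF assms(2)], simp,
      rule smooth_on_vecI[OF assms(2)], simp)
    (intro smooth_on_add smooth_on_bilinear[OF assms(1)] smooth_on_nth assms)

lemma smooth_on_form3_vec:
  assumes "open S" "smooth_on S C"
  shows "smooth_on S (\<lambda>x. form3_vec (C x) $ q)"
proof -
  have "smooth_on S (\<lambda>x. omit (fst q) (C x))"
    unfolding omit_def using assms
    by (cases "fst q = 0"; cases "fst q = 1"; cases "fst q = 2"; simp add: smooth_on_nth)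
  then show ?thesis
    unfolding form3_vec_def vec_lambda_beta
    by (intro smooth_on_linear[of "sl2_coord (snd q)"] assms(1))
      (simp add: linear_sl2_coord linear_conv_bounded_linear[symmetric])
qed

text \<open>B is an arbitrary pointwise solution. Its coordinate vector solves a square system with
  smooth coefficients and nonvanishing determinant, to which \<open>smooth_on_cramer\<close>
  applies.\<close>

lemma smooth_on_ad_inv:
  assumes "open S" "smooth_on S \<omega>" "smooth_on S C"
    and B: "\<And>x i. x \<in> S \<Longrightarrow> B x $ i \<in> sl2" "\<And>x. x \<in> S \<Longrightarrow> wedge12 commutator (B x) (\<omega> x) = C x"
    and nd: "\<And>x. x \<in> S \<Longrightarrow> alternating2 (\<omega> x)" "\<And>x. x \<in> S \<Longrightarrow> nondegenerate (\<omega> x)"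
  shows "smooth_on S B"
proof -
  have "smooth_on S (\<lambda>x. sl2_vec_inv (B x))"
  proof (rule smooth_on_cramer[OF assms(1), where A = "\<lambda>x. ad_matrix (\<omega> x)" and b = "\<lambda>x. form3_vec (C x)"])
    show "smooth_on S (\<lambda>x. ad_matrix (\<omega> x) $ i $ j)" for i j
      unfolding ad_matrix_def matrix_def
      by (simp, intro smooth_on_form3_vec smooth_on_wedge12 bounded_bilinear_commutator smooth_on_const assms)
    show "ad_matrix (\<omega> x) *v sl2_vec_inv (B x) = form3_vec (C x)" if "x \<in> S" for x
      using B that by (simp add: ad_matrix_mult sl2_vec_inv)
  qed (use assms det_ad_matrix nd smooth_on_form3_vec in auto)
  then have v: "smooth_on S (\<lambda>x. sl2_vec_inv (B x) $ q)" for q by (rule smooth_on_nth[OF assms(1)])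
  have "smooth_on S (\<lambda>x. sl2_vec (sl2_vec_inv (B x)) $ i $ r $ s)" for i r s
    unfolding sl2_vec_def by (cases "r = 1"; cases "s = 1"; simp add: v smooth_on_minus assms(1))
  then have "smooth_on S (\<lambda>x. sl2_vec (sl2_vec_inv (B x)))"
    by (intro smooth_on_vecI assms(1))
  then show ?thesis
    by (rule smooth_on_cong[OF assms(1), rotated]) (simp add: sl2_vec_inv B)
qed

section \<open>Forms on a spacetime\<close>

lemma spacetime_chart: "is_spacetime M \<Longrightarrow> c \<in> charts M \<Longrightarrow> is_chart c"
  by (simp add: is_spacetime_def oriented_atlas_def)

lemma coord_inv_coord:
  assumes "is_chart c" "p \<in> chart_dom c"
  shows "coord_inv c (coord c p) = p"
  using assms homeomorphism_apply1 unfolding is_chart_def by blast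

lemma coord_image_iff:
  assumes "is_chart c"
  shows "x \<in> coord c ` (U \<inter> chart_dom c) \<longleftrightarrow>
    coord_inv c x \<in> U \<inter> chart_dom c \<and> coord c (coord_inv c x) = x"
  using coord_inv_coord[OF assms] by force

lemma open_coord_image:
  assumes "is_chart c" "open U"
  shows "open (coord c ` (U \<inter> chart_dom c))"
proof -
  have h: "homeomorphism (chart_dom c) (coord c ` chart_dom c) (coord c) (coord_inv c)"
    and o: "open (coord c ` chart_dom c)"
    using assms(1) by (auto simp: is_chart_def)
  have "openin (top_of_set (chart_dom c)) (U \<inter> chart_dom c)"
    using assms(2) by (auto simp: openin_open)
  then have "openin (top_of_set (coord c ` chart_dom c)) (coord c ` (U \<inter> chart_dom c))"
    using homeomorphism_imp_open_map[OF h] by blast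
  then show ?thesis using o openin_open_trans by blast
qed

lemma jacobian_det_pos:
  "is_spacetime M \<Longrightarrow> c \<in> charts M \<Longrightarrow> c' \<in> charts M \<Longrightarrow> p \<in> chart_dom c \<inter> chart_dom c' \<Longrightarrow>
    det (jacobian c c' p) > 0"
  by (simp add: is_spacetime_def oriented_atlas_def)

lemma spacetime_lorentzian:
  "is_spacetime M \<Longrightarrow> c \<in> charts M \<Longrightarrow> p \<in> chart_dom c \<Longrightarrow> lorentzian (metric M c p)"
  by (simp add: is_spacetime_def)

lemma metric_pull2:
  "is_spacetime M \<Longrightarrow> c \<in> charts M \<Longrightarrow> c' \<in> charts M \<Longrightarrow> p \<in> chart_dom c \<inter> chart_dom c' \<Longrightarrow>
    metric M c p = pull2 (jacobian c c' p) (metric M c' p)"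
  unfolding is_spacetime_def covariant_def points_def by blast

text \<open>Forms are functions of all charts and points; since components vanish where they carry
  no meaning, agreement on U is equality.\<close>

lemma field_eqI:
  assumes "off_zero M U \<alpha>" "off_zero M U \<beta>"
    and "\<And>c p. c \<in> charts M \<Longrightarrow> p \<in> U \<inter> chart_dom c \<Longrightarrow> \<alpha> c p = \<beta> c p"
  shows "\<alpha> = \<beta>"
  using assms unfolding off_zero_def by (intro ext) metis

lemma forms1D:
  assumes "\<alpha> \<in> forms1 M U V"
  shows "off_zero M U \<alpha>" "covariant pull1 M U \<alpha>" "smooth_field M U \<alpha>" "\<alpha> c p $ i \<in> V"
  using assms unfolding forms1_def by blast+

lemma forms2D:
  assumes "\<alpha> \<in> forms2 M U V"
  shows "off_zero M U \<alpha>" "covariant pull2 M U \<alpha>" "smooth_field M U \<alpha>"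
    "alternating2 (\<alpha> c p)" "\<alpha> c p $ i $ j \<in> V"
  using assms unfolding forms2_def by blast+

lemma forms3D:
  assumes "\<alpha> \<in> forms3 M U V"
  shows "off_zero M U \<alpha>" "covariant pull3 M U \<alpha>" "smooth_field M U \<alpha>"
    "alternating3 (\<alpha> c p)" "\<alpha> c p $ i $ j $ k \<in> V"
  using assms unfolding forms3_def by blast+

lemma wedge12_0: "wedge12 commutator 0 0 = 0"
  by (simp add: wedge12_def vec_eq_iff)

lemma ad_in_forms3:
  assumes M: "is_spacetime M" and U: "open U" and \<omega>: "\<omega> \<in> forms2 M U sl2" and B: "B \<in> forms1 M U sl2"
  shows "ad \<omega> B \<in> forms3 M U sl2"
proof -
  have "off_zero M U (ad \<omega> B)"
    using \<omega> B by (simp add: forms1_def forms2_def off_zero_def ad_def bracket12_def wedge12_0)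
  moreover have "covariant pull3 M U (ad \<omega> B)"
    unfolding covariant_def
  proof (intro ballI)
    fix c c' p assume c: "c \<in> charts M" "c' \<in> charts M" "p \<in> U \<inter> chart_dom c \<inter> chart_dom c'"
    have "\<omega> c p = pull2 (jacobian c c' p) (\<omega> c' p)" "B c p = pull1 (jacobian c c' p) (B c' p)"
      using c \<omega> B unfolding forms1_def forms2_def covariant_def by blast+
    then show "ad \<omega> B c p = pull3 (jacobian c c' p) (ad \<omega> B c' p)"
      by (simp only: ad_def bracket12_def wedge12_pull[OF bounded_bilinear_commutator])
  qed
  moreover have "smooth_field M U (ad \<omega> B)"
    unfolding smooth_field_def ad_def bracket12_def
  proof
    fix c assume c: "c \<in> charts M"
    show "smooth_on (coord c ` (U \<inter> chart_dom c))
        (\<lambda>x. wedge12 commutator (B c (coord_inv c x)) (\<omega> c (coord_inv c x)))"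
      using c \<omega> B open_coord_image[OF spacetime_chart[OF M c] U]
      by (intro smooth_on_wedge12 bounded_bilinear_commutator) (auto simp: forms1_def forms2_def smooth_field_def)
  qed
  ultimately show ?thesis
    using \<omega> by (simp add: forms3_def forms2_def ad_def bracket12_def wedge12_sl2
        alternating3_wedge12[OF bounded_bilinear_commutator])
qed

lemma bij_betw_ad:
  assumes M: "is_spacetime M" and U: "open U" and \<omega>: "\<omega> \<in> forms2 M U sl2"
    and nd: "\<And>c p. c \<in> charts M \<Longrightarrow> p \<in> U \<inter> chart_dom c \<Longrightarrow> nondegenerate (\<omega> c p)"
  shows "bij_betw (ad \<omega>) (forms1 M U sl2) (forms3 M U sl2)"
  unfolding bij_betw_def
proof
  show "inj_on (ad \<omega>) (forms1 M U sl2)"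
  proof (rule inj_onI)
    fix B B' assume B: "B \<in> forms1 M U sl2" "B' \<in> forms1 M U sl2" "ad \<omega> B = ad \<omega> B'"
    show "B = B'"
    proof (rule field_eqI)
      fix c p assume cp: "c \<in> charts M" "p \<in> U \<inter> chart_dom c"
      have "wedge12 commutator (B c p) (\<omega> c p) = wedge12 commutator (B' c p) (\<omega> c p)"
        using fun_cong[OF fun_cong[OF B(3), of c], of p] by (simp add: ad_def bracket12_def)
      then show "B c p = B' c p"
        using B(1,2) unfolding forms1_def by (intro nondegenerate_inject[OF nd[OF cp]]) blast+
    qed (use B in \<open>auto simp: forms1_def\<close>)
  qed
  have "\<exists>B\<in>forms1 M U sl2. ad \<omega> B = C" if C: "C \<in> forms3 M U sl2" for C
  proof -
    \<comment> \<open>The default value 0 outside U makes the chosen field satisfy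
      \<open>off_zero\<close>.\<close>
    have "\<forall>c p. \<exists>B. (\<forall>i. B $ i \<in> sl2) \<and> (if c \<in> charts M \<and> p \<in> U \<inter> chart_dom c
        then wedge12 commutator B (\<omega> c p) = C c p else B = 0)"
    proof (intro allI)
      fix c p
      show "\<exists>B. (\<forall>i. B $ i \<in> sl2) \<and> (if c \<in> charts M \<and> p \<in> U \<inter> chart_dom c
        then wedge12 commutator B (\<omega> c p) = C c p else B = 0)"
      proof (cases "c \<in> charts M \<and> p \<in> U \<inter> chart_dom c")
        case True
        then have "\<exists>B. (\<forall>i. B $ i \<in> sl2) \<and> wedge12 commutator B (\<omega> c p) = C c p"
          using forms3D[OF C] forms2D[OF \<omega>] by (intro ad_matrix_solve nd) auto
        then show ?thesis using True by simp
      next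
        case False
        then show ?thesis by (auto intro!: exI[of _ 0] simp: sl2_iff)
      qed
    qed
    then obtain B where sl: "\<And>c p i. B c p $ i \<in> sl2"
      and B: "\<And>c p. c \<in> charts M \<Longrightarrow> p \<in> U \<inter> chart_dom c \<Longrightarrow> wedge12 commutator (B c p) (\<omega> c p) = C c p"
      and B0: "\<And>c p. \<not> (c \<in> charts M \<and> p \<in> U \<inter> chart_dom c) \<Longrightarrow> B c p = 0"
      by metis
    have "off_zero M U B" using B0 by (simp add: off_zero_def)
    moreover have "covariant pull1 M U B"
      unfolding covariant_def
    proof (intro ballI)
      fix c c' p assume c: "c \<in> charts M" "c' \<in> charts M" "p \<in> U \<inter> chart_dom c \<inter> chart_dom c'"
      let ?J = "jacobian c c' p"
      have \<omega>J: "\<omega> c p = pull2 ?J (\<omega> c' p)" and CJ: "C c p = pull3 ?J (C c' p)"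
        using c \<omega> C unfolding forms2_def forms3_def covariant_def by blast+
      \<comment> \<open>Both sides solve the same equation in the chart c, because the bracket,
        \<omega> and C are covariant; uniqueness identifies them.\<close>
      show "B c p = pull1 ?J (B c' p)"
      proof (rule nondegenerate_inject[OF nd])
        show "wedge12 commutator (B c p) (\<omega> c p) = wedge12 commutator (pull1 ?J (B c' p)) (\<omega> c p)"
          unfolding \<omega>J wedge12_pull[OF bounded_bilinear_commutator]
          using B[of c p] B[of c' p] c CJ \<omega>J by simp
      qed (use c sl pull1_sl2 in auto)
    qed
    moreover have "smooth_field M U B"
      unfolding smooth_field_def
    proof
      fix c assume c: "c \<in> charts M"
      have ch: "is_chart c" by (rule spacetime_chart[OF M c])
      show "smooth_on (coord c ` (U \<inter> chart_dom c)) (\<lambda>x. B c (coord_inv c x))"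
      proof (rule smooth_on_ad_inv[OF open_coord_image[OF ch U]])
        show "smooth_on (coord c ` (U \<inter> chart_dom c)) (\<lambda>x. \<omega> c (coord_inv c x))"
          "smooth_on (coord c ` (U \<inter> chart_dom c)) (\<lambda>x. C c (coord_inv c x))"
          using forms2D[OF \<omega>] forms3D[OF C] c by (auto simp: smooth_field_def)
      qed (use sl B nd c forms2D[OF \<omega>] coord_image_iff[OF ch] in auto)
    qed
    ultimately have "B \<in> forms1 M U sl2" using sl by (simp add: forms1_def)
    moreover have "ad \<omega> B = C"
    proof (rule field_eqI)
      show "off_zero M U (ad \<omega> B)" using ad_in_forms3[OF M U \<omega> \<open>B \<in> forms1 M U sl2\<close>] by (simp add: forms3_def)
      show "off_zero M U C" using C by (simp add: forms3_def)
    qed (simp add: ad_def bracket12_def B)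
    ultimately show ?thesis by blast
  qed
  then have "forms3 M U sl2 \<subseteq> ad \<omega> ` forms1 M U sl2" by (fastforce simp only: image_iff)
  moreover have "ad \<omega> ` forms1 M U sl2 \<subseteq> forms3 M U sl2"
    by (rule image_subsetI) (rule ad_in_forms3[OF M U \<omega>])
  ultimately show "ad \<omega> ` forms1 M U sl2 = forms3 M U sl2" by (rule equalityI[rotated])
qed

lemma internal_sqrt_dual_form:
  assumes "internal_sqrt M U T \<omega>" "c \<in> charts M" "p \<in> U \<inter> chart_dom c"
  shows "dual_form \<i> (metric M c p) (\<omega> c p)"
proof -
  have "alternating2 (\<omega> c p)" using assms(1) unfolding internal_sqrt_def forms2_def by blast
  moreover have "hodge (metric M c p) (\<omega> c p) $ i $ j $ r $ s = \<i> * \<omega> c p $ i $ j $ r $ s" for i j r s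
    using assms unfolding internal_sqrt_def self_dual_def hodge_star_def by blast
  ultimately show ?thesis unfolding dual_form_def by (simp add: vec_eq_iff)
qed

lemma internal_sqrt_nondegenerate:
  assumes M: "is_spacetime M" and dec: "strict_DEC M T" and sq: "internal_sqrt M U T \<omega>"
    and c: "c \<in> charts M" and p: "p \<in> U \<inter> chart_dom c"
  shows "nondegenerate (\<omega> c p)"
proof (rule sqrt_nondegenerate)
  show "lorentzian (metric M c p)" using spacetime_lorentzian[OF M c] p by blast
  show "inner_prod (metric M c p) (time_dir M c p) (time_dir M c p) < 0"
    using M c p unfolding is_spacetime_def by blast
  show "future_timelike (metric M c p) (time_dir M c p) (- ((matrix_inv (metric M c p) ** T c p) *v v))"
    if "future_causal (metric M c p) (time_dir M c p) v" for v
    using dec c p that by (simp add: strict_DEC_def)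
  show "dual_form \<i> (metric M c p) (\<omega> c p)" by (rule internal_sqrt_dual_form[OF sq c p])
  show "\<omega> c p $ i $ j \<in> sl2" for i j
    using sq unfolding internal_sqrt_def forms2_def by blast
  show "clebsch_gordan (metric M c p) (- trace_tensor (\<omega> c p) (cj (\<omega> c p))) = cm (T c p)"
    using sq c p by (simp add: internal_sqrt_def corresponds_def conj2_cj cm_def)
qed

section \<open>Exterior derivatives in coordinates\<close>

definition dform1 :: "(real ^ 4 \<Rightarrow> 'v::real_normed_vector ^ 4) \<Rightarrow> real ^ 4 \<Rightarrow> 'v ^ 4 ^ 4" where
  "dform1 a x = (\<chi> i j. partial i (\<lambda>x. a x $ j) x - partial j (\<lambda>x. a x $ i) x)"

definition dform2 :: "(real ^ 4 \<Rightarrow> 'v::real_normed_vector ^ 4 ^ 4) \<Rightarrow> real ^ 4 \<Rightarrow> 'v ^ 4 ^ 4 ^ 4" where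
  "dform2 w x = (\<chi> i j k. partial i (\<lambda>x. w x $ j $ k) x + partial j (\<lambda>x. w x $ k $ i) x
     + partial k (\<lambda>x. w x $ i $ j) x)"

lemma ext_d1_coord:
  "c \<in> charts M \<Longrightarrow> p \<in> U \<inter> chart_dom c \<Longrightarrow>
    ext_d1 M U \<alpha> c p = dform1 (\<lambda>x. \<alpha> c (coord_inv c x)) (coord c p)"
  by (simp add: ext_d1_def dform1_def chart_partial_def o_def)

lemma ext_d2_coord:
  "c \<in> charts M \<Longrightarrow> p \<in> U \<inter> chart_dom c \<Longrightarrow>
    ext_d2 M U \<alpha> c p = dform2 (\<lambda>x. \<alpha> c (coord_inv c x)) (coord c p)"
  by (simp add: ext_d2_def dform2_def chart_partial_def o_def)

lemma dform2_cong:
  assumes "open S" "x \<in> S" "\<And>y. y \<in> S \<Longrightarrow> w y = v y"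
  shows "dform2 w x = dform2 v x"
proof -
  have "partial i (\<lambda>x. w x $ j $ k) x = partial i (\<lambda>x. v x $ j $ k) x" for i j k
    using frechet_derivative_cong_open[OF assms(1,2), of "\<lambda>x. w x $ j $ k" "\<lambda>x. v x $ j $ k"] assms(3) by simp
  then show ?thesis by (simp add: dform2_def)
qed

lemma dform2_add:
  assumes "open S" "smooth_on S w" "smooth_on S v" "x \<in> S"
  shows "dform2 (\<lambda>x. w x + v x) x = dform2 w x + dform2 v x"
proof -
  have "partial i (\<lambda>x. w x $ j $ k + v x $ j $ k) x = partial i (\<lambda>x. w x $ j $ k) x + partial i (\<lambda>x. v x $ j $ k) x" for i j k
    by (rule partial_add[OF assms(1) _ _ assms(4)]) (intro smooth_on_nth assms)+
  then show ?thesis by (simp add: dform2_def vec_eq_iff)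
qed

lemma dform2_linear:
  assumes "bounded_linear h" "open S" "smooth_on S w" "x \<in> S"
  shows "dform2 (\<lambda>x. \<chi> j k. h (w x $ j $ k)) x = (\<chi> i j k. h (dform2 w x $ i $ j $ k))"
proof -
  have "partial i (\<lambda>x. h (w x $ j $ k)) x = h (partial i (\<lambda>x. w x $ j $ k) x)" for i j k
    by (rule partial_linear[OF assms(1,2) _ assms(4)]) (intro smooth_on_nth assms)
  then show ?thesis
    using linear_add[OF bounded_linear.linear[OF assms(1)]] by (simp add: dform2_def vec_eq_iff)
qed

lemma smooth_on_dform2:
  assumes "open S" "smooth_on S w"
  shows "smooth_on S (dform2 w)"
proof (rule smooth_on_vecI[OF assms(1)], rule smooth_on_vecI[OF assms(1)], rule smooth_on_vecI[OF assms(1)])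
  show "smooth_on S (\<lambda>x. dform2 w x $ i $ j $ k)" for i j k
    unfolding dform2_def vec_lambda_beta by (intro smooth_on_add smooth_on_partial smooth_on_nth assms)
qed

text \<open>Second derivatives of the coordinate change cancel by their symmetry and the
  antisymmetry of the form.\<close>

lemma dform2_pull:
  fixes w w' :: "real ^ 4 \<Rightarrow> 'v::euclidean_space ^ 4 ^ 4"
  assumes S: "open S" "open S'" and \<tau>: "smooth_on S \<tau>" "\<tau> ` S \<subseteq> S'"
    and w': "smooth_on S' w'" "\<And>y. alternating2 (w' y)"
    and w: "\<And>y. y \<in> S \<Longrightarrow> w y = pull2 (matrix (frechet_derivative \<tau> (at y))) (w' (\<tau> y))"
    and x: "x \<in> S"
  shows "dform2 w x = pull3 (matrix (frechet_derivative \<tau> (at x))) (dform2 w' (\<tau> x))"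
proof -
  define J where "J = (\<lambda>a i y. partial i \<tau> y $ a)"
  have Jm: "matrix (frechet_derivative \<tau> (at y)) $ a $ i = J a i y" for a i y
    by (simp add: matrix_def J_def)
  have smJ: "smooth_on S (J a i)" for a i
    unfolding J_def by (intro smooth_on_nth smooth_on_partial S \<tau>)
  define h where "h = (\<lambda>i j a. partial i (J a j) x)"
  have h_sym: "h i j a = h j i a" for i j a
  proof -
    have "h i j a = partial i (partial j \<tau>) x $ a" for i j
      unfolding h_def J_def
      by (rule partial_linear[OF bounded_linear_vec_nth S(1) smooth_on_partial[OF \<tau>(1)] x])
    then show ?thesis using partial_commute[OF S(1) \<tau>(1) x] by simp
  qed
  define W where "W = (\<lambda>a b y. w' (\<tau> y) $ a $ b)"
  define D where "D = (\<lambda>c a b. partial c (\<lambda>y. w' y $ a $ b) (\<tau> x))"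
  have sm': "smooth_on S' (\<lambda>y. w' y $ a $ b)" for a b by (intro smooth_on_nth S w')
  have \<tau>d: "\<tau> differentiable at y" if "y \<in> S" for y by (rule smooth_on_differentiable[OF S(1) \<tau>(1) that])
  have w'd: "(\<lambda>y. w' y $ a $ b) differentiable at (\<tau> y)" if "y \<in> S" for a b y
    by (rule smooth_on_differentiable[OF S(2) sm']) (use \<tau>(2) that in blast)
  have WD: "W a b differentiable at x" for a b
    using differentiable_chain_at[OF \<tau>d[OF x] w'd[OF x]] by (simp add: W_def o_def)
  have dW: "partial i (W a b) x = (\<Sum>c\<in>UNIV. J c i x *\<^sub>R D c a b)" for i a b
    unfolding W_def J_def D_def by (rule partial_compose[OF \<tau>d[OF x] w'd[OF x]])
  \<comment> \<open>Q collects the terms with second derivatives of \<tau>, R the tensorial ones. By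
    antisymmetry of w' the other second-derivative term is -Q with j and k exchanged.\<close>
  define Q where "Q = (\<lambda>i j k. \<Sum>a\<in>UNIV. \<Sum>b\<in>UNIV. (h i j a * J b k x) *\<^sub>R W a b x)"
  define R where "R = (\<lambda>i j k. \<Sum>a\<in>UNIV. \<Sum>b\<in>UNIV. \<Sum>c\<in>UNIV. (J a i x * J b j x * J c k x) *\<^sub>R D a b c)"
  have W_alt: "W a b y = - W b a y" for a b y
    using w'(2) unfolding W_def alternating2_def by blast
  have main: "partial i (\<lambda>y. w y $ j $ k) x = Q i j k - Q i k j + R i j k" for i j k
  proof -
    have "partial i (\<lambda>y. w y $ j $ k) x = partial i (\<lambda>y. \<Sum>a\<in>UNIV. \<Sum>b\<in>UNIV. (J a j y * J b k y) *\<^sub>R W a b y) x"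
      using frechet_derivative_cong_open[OF S(1) x, of "\<lambda>y. w y $ j $ k"
          "\<lambda>y. \<Sum>a\<in>UNIV. \<Sum>b\<in>UNIV. (J a j y * J b k y) *\<^sub>R W a b y"]
      by (simp add: w pull2_def Jm W_def)
    also have "\<dots> = (\<Sum>a\<in>UNIV. \<Sum>b\<in>UNIV. (J a j x * J b k x) *\<^sub>R partial i (W a b) x
        + (J a j x * h i k b + h i j a * J b k x) *\<^sub>R W a b x)"
    proof -
      have dJ: "(J a j has_derivative frechet_derivative (J a j) (at x)) (at x)" for a j
        by (rule smooth_on_has_derivative[OF S(1) smJ x])
      have dW: "(W a b has_derivative frechet_derivative (W a b) (at x)) (at x)" for a b
        using WD frechet_derivative_works by blast
      have "((\<lambda>y. \<Sum>a\<in>UNIV. \<Sum>b\<in>UNIV. (J a j y * J b k y) *\<^sub>R W a b y) has_derivative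
        (\<lambda>v. \<Sum>a\<in>UNIV. \<Sum>b\<in>UNIV. (J a j x * J b k x) *\<^sub>R frechet_derivative (W a b) (at x) v
        + (J a j x * frechet_derivative (J b k) (at x) v + frechet_derivative (J a j) (at x) v * J b k x) *\<^sub>R W a b x)) (at x)"
        by (intro has_derivative_sum has_derivative_scaleR has_derivative_mult dJ dW)
      from partial_eqI[OF this, of i] show ?thesis by (simp only: h_def)
    qed
    also have "\<dots> = (\<Sum>a\<in>UNIV. \<Sum>b\<in>UNIV. (J a j x * J b k x) *\<^sub>R partial i (W a b) x)
        + (\<Sum>a\<in>UNIV. \<Sum>b\<in>UNIV. (J a j x * h i k b) *\<^sub>R W a b x) + Q i j k"
      by (simp add: Q_def scaleR_add_left sum.distrib add.assoc)
    also have "(\<Sum>a\<in>UNIV. \<Sum>b\<in>UNIV. (J a j x * h i k b) *\<^sub>R W a b x) = - Q i k j"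
    proof -
      have "(\<Sum>a\<in>UNIV. \<Sum>b\<in>UNIV. (J a j x * h i k b) *\<^sub>R W a b x)
        = (\<Sum>b\<in>UNIV. \<Sum>a\<in>UNIV. - ((h i k b * J a j x) *\<^sub>R W b a x))"
        by (subst sum.swap, intro sum.cong refl) (metis W_alt mult.commute scaleR_minus_right)
      then show ?thesis by (simp add: Q_def sum_negf)
    qed
    also have "(\<Sum>a\<in>UNIV. \<Sum>b\<in>UNIV. (J a j x * J b k x) *\<^sub>R partial i (W a b) x) = R i j k"
    proof -
      have "(\<Sum>a\<in>UNIV. \<Sum>b\<in>UNIV. (J a j x * J b k x) *\<^sub>R partial i (W a b) x)
        = (\<Sum>a\<in>UNIV. \<Sum>b\<in>UNIV. \<Sum>c\<in>UNIV. (J c i x * J a j x * J b k x) *\<^sub>R D c a b)"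
        by (simp add: dW scaleR_sum_right mult_ac)
      then show ?thesis unfolding R_def by (simp only: sum_rotate[of "\<lambda>a b c. (J c i x * J a j x * J b k x) *\<^sub>R D c a b"])
    qed
    finally show ?thesis by simp
  qed
  have R2: "R j k i = (\<Sum>a\<in>UNIV. \<Sum>b\<in>UNIV. \<Sum>c\<in>UNIV. (J a i x * J b j x * J c k x) *\<^sub>R D b c a)" for i j k
    unfolding R_def by (subst sum_rotate) (simp add: mult_ac)
  have R3: "R k i j = (\<Sum>a\<in>UNIV. \<Sum>b\<in>UNIV. \<Sum>c\<in>UNIV. (J a i x * J b j x * J c k x) *\<^sub>R D c a b)" for i j k
    unfolding R_def by (subst sum_rotate, subst sum_rotate) (simp add: mult_ac)
  have "dform2 w x $ i $ j $ k = pull3 (matrix (frechet_derivative \<tau> (at x))) (dform2 w' (\<tau> x)) $ i $ j $ k" for i j k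
  proof -
    have "dform2 w x $ i $ j $ k = R i j k + R j k i + R k i j"
    proof -
      \<comment> \<open>Symmetry of Q in its first two indices cancels its six occurrences in the
        cyclic sum in pairs.\<close>
      have "Q i j k = Q j i k" "Q j k i = Q k j i" "Q k i j = Q i k j" by (simp_all add: Q_def h_sym)
      then show ?thesis by (simp add: dform2_def main)
    qed
    also have "\<dots> = pull3 (matrix (frechet_derivative \<tau> (at x))) (dform2 w' (\<tau> x)) $ i $ j $ k"
      unfolding R2[of j k i] R3[of k i j]
      by (simp add: R_def pull3_def dform2_def Jm D_def scaleR_add_right sum.distrib)
    finally show ?thesis .
  qed
  then show ?thesis by (simp add: vec_eq_iff)
qed

lemma alternating3_dform2:
  assumes "open S" "smooth_on S w" "x \<in> S" "\<And>y. alternating2 (w y)"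
  shows "alternating3 (dform2 w x)"
proof -
  have neg: "partial i (\<lambda>y. w y $ k $ j) x = - partial i (\<lambda>y. w y $ j $ k) x" for i j k
  proof -
    have "(\<lambda>y. w y $ k $ j) = (\<lambda>y. - (w y $ j $ k))"
      using assms(4) unfolding alternating2_def by blast
    then show ?thesis
      using partial_linear[OF bounded_linear_minus[OF bounded_linear_ident] assms(1), of "\<lambda>y. w y $ j $ k" x i]
        smooth_on_nth[OF assms(1) smooth_on_nth[OF assms(1,2)]] assms(3) by simp
  qed
  show ?thesis
    unfolding alternating3_def dform2_def vec_lambda_beta
  proof (intro allI conjI)
    fix i j k
    show "partial i (\<lambda>x. w x $ j $ k) x + partial j (\<lambda>x. w x $ k $ i) x + partial k (\<lambda>x. w x $ i $ j) x =
      - (partial j (\<lambda>x. w x $ i $ k) x + partial i (\<lambda>x. w x $ k $ j) x + partial k (\<lambda>x. w x $ j $ i) x)"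
      using neg[of i j k] neg[of j k i] neg[of k i j] by simp
    show "partial i (\<lambda>x. w x $ j $ k) x + partial j (\<lambda>x. w x $ k $ i) x + partial k (\<lambda>x. w x $ i $ j) x =
      - (partial i (\<lambda>x. w x $ k $ j) x + partial k (\<lambda>x. w x $ j $ i) x + partial j (\<lambda>x. w x $ i $ k) x)"
      using neg[of i j k] neg[of j k i] neg[of k i j] by simp
  qed
qed

lemma dform2_sl2:
  assumes "open S" "smooth_on S w" "x \<in> S" "\<And>y i j. w y $ i $ j \<in> sl2"
  shows "dform2 w x $ i $ j $ k \<in> sl2"
proof -
  have "partial i (\<lambda>y. w y $ j $ k) x \<in> sl2" for i j k
  proof -
    have "bounded_linear (\<lambda>X :: cmat2. X $ 1 $ 1 + X $ 2 $ 2)"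
      by (intro bounded_linear_add bounded_linear_compose[OF bounded_linear_vec_nth] bounded_linear_vec_nth)
    then have "partial i (\<lambda>y. w y $ j $ k $ 1 $ 1 + w y $ j $ k $ 2 $ 2) x
      = partial i (\<lambda>y. w y $ j $ k) x $ 1 $ 1 + partial i (\<lambda>y. w y $ j $ k) x $ 2 $ 2"
      by (rule partial_linear[OF _ assms(1) _ assms(3)]) (intro smooth_on_nth assms)
    moreover have "w y $ j $ k $ 1 $ 1 + w y $ j $ k $ 2 $ 2 = 0" for y
      using assms(4)[of y j k] by (simp add: sl2_iff)
    ultimately show ?thesis by (simp add: sl2_iff add_eq_0_iff)
  qed
  then show ?thesis by (simp add: dform2_def subspace_add subspace_sl2)
qed

text \<open>\<open>ad_inv\<close> returns a true preimage only on the range of \<open>ad\<close>.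
  That range is the full space of 3-forms, so d\<omega> has to be shown to belong to it, including
  its transformation law.\<close>

lemma ext_d2_in_forms3:
  assumes M: "is_spacetime M" and U: "open U" and \<omega>: "\<omega> \<in> forms2 M U sl2"
  shows "ext_d2 M U \<omega> \<in> forms3 M U sl2"
proof -
  let ?w = "\<lambda>c x. \<omega> c (coord_inv c x)"
  have op: "open (coord c ` (U \<inter> chart_dom c))" if "c \<in> charts M" for c
    by (rule open_coord_image[OF spacetime_chart[OF M that] U])
  have sm: "smooth_on (coord c ` (U \<inter> chart_dom c)) (?w c)" if "c \<in> charts M" for c
    using forms2D(3)[OF \<omega>] that by (simp add: smooth_field_def)
  have zero: "ext_d2 M U \<omega> c p = 0" if "\<not> (c \<in> charts M \<and> p \<in> U \<inter> chart_dom c)" for c p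
    using that by (auto simp: ext_d2_def)
  have "covariant pull3 M U (ext_d2 M U \<omega>)"
    unfolding covariant_def
  proof (intro ballI)
    fix c c' p assume c: "c \<in> charts M" "c' \<in> charts M" and p: "p \<in> U \<inter> chart_dom c \<inter> chart_dom c'"
    note ch = spacetime_chart[OF M c(1)] and ch' = spacetime_chart[OF M c(2)]
    let ?S = "coord c ` ((U \<inter> chart_dom c') \<inter> chart_dom c)"
    have oS: "open ?S" by (rule open_coord_image[OF ch]) (use U ch' in \<open>auto simp: is_chart_def\<close>)
    have pt: "q \<in> U \<inter> chart_dom c'" "q \<in> chart_dom c" "coord c q = y" "transition c c' y = coord c' q"
      if "y \<in> ?S" "q = coord_inv c y" for y q
      using that coord_image_iff[OF ch, of y "U \<inter> chart_dom c'"] by (auto simp: transition_def)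
    have "dform2 (?w c) (coord c p)
      = pull3 (matrix (frechet_derivative (transition c c') (at (coord c p)))) (dform2 (?w c') (transition c c' (coord c p)))"
    proof (rule dform2_pull[OF oS op[OF c(2)] _ _ sm[OF c(2)]])
      show "smooth_on ?S (transition c c')"
      proof (rule smooth_on_subset)
        show "smooth_on (coord c ` (chart_dom c \<inter> chart_dom c')) (transition c c')"
          using M c unfolding is_spacetime_def oriented_atlas_def by blast
      qed auto
      show "transition c c' ` ?S \<subseteq> coord c' ` (U \<inter> chart_dom c')"
      proof (rule image_subsetI)
        fix y assume y: "y \<in> ?S"
        show "transition c c' y \<in> coord c' ` (U \<inter> chart_dom c')"
          unfolding pt(4)[OF y refl] by (rule imageI[OF pt(1)[OF y refl]])
      qed
      show "?w c y = pull2 (matrix (frechet_derivative (transition c c') (at y))) (?w c' (transition c c' y))"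
        if y: "y \<in> ?S" for y
      proof -
        define q where "q = coord_inv c y"
        note q = pt[OF y q_def]
        have "\<omega> c q = pull2 (jacobian c c' q) (\<omega> c' q)"
          using forms2D(2)[OF \<omega>] c q(1,2) unfolding covariant_def by blast
        moreover have "coord_inv c' (transition c c' y) = q"
          using q coord_inv_coord[OF ch', of q] by (metis IntD2)
        ultimately show ?thesis by (simp only: q_def[symmetric] jacobian_def q(3))
      qed
      show "alternating2 (?w c' y)" for y by (rule forms2D(4)[OF \<omega>])
      show "coord c p \<in> ?S" using p by blast
    qed
    moreover have "transition c c' (coord c p) = coord c' p"
      using p coord_inv_coord[OF ch, of p] by (simp add: transition_def)
    moreover have "p \<in> U \<inter> chart_dom c" "p \<in> U \<inter> chart_dom c'" using p by auto
    ultimately show "ext_d2 M U \<omega> c p = pull3 (jacobian c c' p) (ext_d2 M U \<omega> c' p)"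
      using ext_d2_coord[OF c(1), of p U \<omega>] ext_d2_coord[OF c(2), of p U \<omega>] by (simp add: jacobian_def)
  qed
  moreover have "smooth_field M U (ext_d2 M U \<omega>)"
    unfolding smooth_field_def
  proof
    fix c assume c: "c \<in> charts M"
    note ch = spacetime_chart[OF M c]
    show "smooth_on (coord c ` (U \<inter> chart_dom c)) (\<lambda>x. ext_d2 M U \<omega> c (coord_inv c x))"
      using smooth_on_cong[OF op[OF c] _ smooth_on_dform2[OF op[OF c] sm[OF c]],
          of "\<lambda>x. ext_d2 M U \<omega> c (coord_inv c x)"] coord_image_iff[OF ch] ext_d2_coord[OF c] by metis
  qed
  moreover have "alternating3 (ext_d2 M U \<omega> c p) \<and> (\<forall>i j k. ext_d2 M U \<omega> c p $ i $ j $ k \<in> sl2)" for c p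
  proof (cases "c \<in> charts M \<and> p \<in> U \<inter> chart_dom c")
    case True
    then have x: "coord c p \<in> coord c ` (U \<inter> chart_dom c)" and c: "c \<in> charts M" by auto
    show ?thesis
      using True alternating3_dform2[OF op[OF c] sm[OF c] x forms2D(4)[OF \<omega>]]
        dform2_sl2[OF op[OF c] sm[OF c] x forms2D(5)[OF \<omega>]] by (simp add: ext_d2_coord)
  next
    case False
    then show ?thesis by (simp add: zero alternating3_def sl2_iff)
  qed
  ultimately show ?thesis using zero unfolding forms3_def off_zero_def by blast
qed

section \<open>Covariant derivatives\<close>

lemma matrix_diff_distrib:
  "(A - B) ** C = A ** C - B ** (C :: 'a::ring_1 ^ 'n ^ 'n)" "C ** (A - B) = C ** A - C ** (B :: 'a ^ 'n ^ 'n)"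
  by (simp_all add: vec_eq_iff matrix_matrix_mult_def left_diff_distrib right_diff_distrib sum_subtractf)

lemma bounded_bilinear_matrix_mult: "bounded_bilinear ((**) :: cmat2 \<Rightarrow> cmat2 \<Rightarrow> cmat2)"
proof -
  have "bilinear ((**) :: cmat2 \<Rightarrow> cmat2 \<Rightarrow> cmat2)"
    unfolding bilinear_def linear_iff
    by (simp add: vec_eq_iff matrix_matrix_mult_def sum_2 algebra_simps)
  then show ?thesis by (simp add: bilinear_conv_bounded_bilinear)
qed

definition cov_d :: "(real ^ 4 \<Rightarrow> cmat2 ^ 4) \<Rightarrow> (real ^ 4 \<Rightarrow> cmat2 ^ 4 ^ 4) \<Rightarrow> real ^ 4 \<Rightarrow> cmat2 ^ 4 ^ 4 ^ 4" where
  "cov_d a w x = dform2 w x + wedge12 commutator (a x) (w x)"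

lemma cov_d2_coord:
  assumes "is_chart c" "c \<in> charts M" "p \<in> U \<inter> chart_dom c"
  shows "cov_d2 M U A \<Omega> c p = cov_d (\<lambda>x. A c (coord_inv c x)) (\<lambda>x. \<Omega> c (coord_inv c x)) (coord c p)"
  using assms by (simp add: cov_d2_def cov_d_def ext_d2_coord bracket12_def coord_inv_coord)

text \<open>Second derivatives of the potential cancel by symmetry, the terms with one derivative
  cancel against the commutator with the linear part of F, and the cubic terms cancel by
  associativity of the matrix product.\<close>

lemma bianchi:
  assumes S: "open S" and a: "smooth_on S a" and x: "x \<in> S"
    and F: "\<And>y. y \<in> S \<Longrightarrow> F y = dform1 a y + wedge11 (**) (a y) (a y)"
  shows "cov_d a F x = 0"
proof -
  let ?a = "\<lambda>j y. a y $ j"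
  have sm: "smooth_on S (?a j)" for j by (intro smooth_on_nth S a)
  define P where "P = (\<lambda>i j. partial i (?a j) x)"
  define Q where "Q = (\<lambda>i j k. partial i (partial j (?a k)) x)"
  have Q: "Q i j k = Q j i k" for i j k
    unfolding Q_def by (rule partial_commute[OF S sm x])
  have dF: "partial i (\<lambda>y. F y $ j $ k) x = Q i j k - Q i k j
      + (a x $ j ** P i k + P i j ** a x $ k) - (a x $ k ** P i j + P i k ** a x $ j)" for i j k
  proof -
    have "partial i (\<lambda>y. F y $ j $ k) x = partial i (\<lambda>y. partial j (?a k) y - partial k (?a j) y
        + ?a j y ** ?a k y - ?a k y ** ?a j y) x"
      using frechet_derivative_cong_open[OF S x, of "\<lambda>y. F y $ j $ k"
          "\<lambda>y. partial j (?a k) y - partial k (?a j) y + ?a j y ** ?a k y - ?a k y ** ?a j y"]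
      by (simp add: F dform1_def wedge11_def)
    also have "\<dots> = Q i j k - Q i k j
      + (a x $ j ** P i k + P i j ** a x $ k) - (a x $ k ** P i j + P i k ** a x $ j)"
      unfolding Q_def P_def
      by (rule partial_eqI[where D = "\<lambda>v. frechet_derivative (partial j (?a k)) (at x) v - frechet_derivative (partial k (?a j)) (at x) v
         + (?a j x ** frechet_derivative (?a k) (at x) v + frechet_derivative (?a j) (at x) v ** ?a k x)
         - (?a k x ** frechet_derivative (?a j) (at x) v + frechet_derivative (?a k) (at x) v ** ?a j x)"])
        (intro has_derivative_add has_derivative_diff bounded_bilinear.FDERIV[OF bounded_bilinear_matrix_mult]
          smooth_on_has_derivative[OF S _ x] smooth_on_partial sm)
    finally show ?thesis .
  qed
  have Fx: "F x $ j $ k = P j k - P k j + a x $ j ** a x $ k - a x $ k ** a x $ j" for j k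
    by (simp add: F[OF x] dform1_def wedge11_def P_def)
  have "cov_d a F x $ i $ j $ k = 0" for i j k
    using Q[of i j k] Q[of j k i] Q[of k i j]
    by (simp add: cov_d_def dform2_def wedge12_def dF Fx commutator_def matrix_add_ldistrib
        matrix_add_mult_distrib matrix_diff_distrib matrix_mul_assoc)
  then show ?thesis by (simp add: vec_eq_iff)
qed

lemma cov_d_add:
  assumes "open S" "smooth_on S w" "smooth_on S v" "x \<in> S"
  shows "cov_d a (\<lambda>x. w x + v x) x = cov_d a w x + cov_d a v x"
  by (simp add: cov_d_def dform2_add[OF assms] wedge12_def vec_eq_iff)

lemma bounded_linear_cscale: "bounded_linear (cscale c)"
  using linear_cscale linear_conv_bounded_linear by blast

lemma bounded_linear_phi: "bounded_linear phi"
  using linear_phi linear_conv_bounded_linear by blast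

lemma cov_d_csc2:
  assumes "open S" "smooth_on S w" "x \<in> S"
  shows "cov_d a (\<lambda>x. csc2 c (w x)) x = (\<chi> i j k. cscale c (cov_d a w x $ i $ j $ k))"
  using dform2_linear[OF bounded_linear_cscale assms, of c]
  by (simp add: cov_d_def csc2_def wedge12_def vec_eq_iff algebra_simps)

definition cj1 :: "cmat2 ^ 4 \<Rightarrow> cmat2 ^ 4" where
  "cj1 a = (\<chi> i. phi (a $ i))"

text \<open>\<open>phi\<close> is real-linear and preserves commutators, so conjugating a covariant
  derivative conjugates both the potential and the form.\<close>

lemma cov_d_cj:
  assumes "open S" "smooth_on S w" "x \<in> S"
  shows "cov_d (\<lambda>x. cj1 (a x)) (\<lambda>x. cj (w x)) x = (\<chi> i j k. phi (cov_d a w x $ i $ j $ k))"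
  using dform2_linear[OF bounded_linear_phi assms]
  by (simp add: cov_d_def cj_def cj1_def wedge12_def vec_eq_iff phi_commutator linear_add[OF linear_phi])

lemma smooth_on_map2:
  assumes "bounded_linear h" "open S" "smooth_on S w"
  shows "smooth_on S (\<lambda>x. \<chi> i j. h (w x $ i $ j))"
  by (rule smooth_on_vecI[OF assms(2)], simp, rule smooth_on_vecI[OF assms(2)], simp)
    (intro smooth_on_linear[OF assms(1)] smooth_on_nth assms)

lemma smooth_on_csc2: "open S \<Longrightarrow> smooth_on S w \<Longrightarrow> smooth_on S (\<lambda>x. csc2 c (w x))"
  unfolding csc2_def by (rule smooth_on_map2[OF bounded_linear_cscale])

lemma smooth_on_cj: "open S \<Longrightarrow> smooth_on S w \<Longrightarrow> smooth_on S (\<lambda>x. cj (w x))"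
  unfolding cj_def by (rule smooth_on_map2[OF bounded_linear_phi])

section \<open>Square roots and Yang-Mills fields\<close>

lemma smooth_on_matrix_inv:
  fixes A :: "real ^ 4 \<Rightarrow> 'b::real_normed_field ^ 'n ^ 'n"
  assumes "open S" "smooth_on S A" "\<And>x. x \<in> S \<Longrightarrow> det (A x) \<noteq> 0"
  shows "smooth_on S (\<lambda>x. matrix_inv (A x) $ i $ j)"
proof -
  have col: "A x *v column j (matrix_inv (A x)) = column j (mat 1)" if "x \<in> S" for x
  proof -
    have "A x *v column j (matrix_inv (A x)) = column j (A x ** matrix_inv (A x))"
      by (simp add: vec_eq_iff matrix_vector_mult_def matrix_matrix_mult_def column_def)
    then show ?thesis using assms(3)[OF that] by (simp add: matrix_inv_right invertible_det_nz)
  qed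
  have "smooth_on S (\<lambda>x. column j (matrix_inv (A x)))"
    by (rule smooth_on_cramer[OF assms(1) _ _ assms(3) col]) (intro smooth_on_nth smooth_on_const assms)+
  then show ?thesis using smooth_on_nth[OF assms(1), of "\<lambda>x. column j (matrix_inv (A x))" i] by (simp add: column_def)
qed

lemma smooth_on_hodge:
  fixes \<beta> :: "real ^ 4 \<Rightarrow> 'a::real_normed_vector ^ 4 ^ 4"
  assumes S: "open S" and G: "smooth_on S G" "\<And>x. x \<in> S \<Longrightarrow> det (G x) < 0" and \<beta>: "smooth_on S \<beta>"
  shows "smooth_on S (\<lambda>x. hodge (G x) (\<beta> x))"
proof (rule smooth_on_vecI[OF S], rule smooth_on_vecI[OF S])
  fix i j
  have det: "smooth_on S (\<lambda>x. det (G x))" by (intro smooth_on_det smooth_on_nth S G)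
  \<comment> \<open>The determinant is negative, so its absolute value is the smooth positive
    function \<open>- det (G x)\<close>.\<close>
  have "smooth_on S (\<lambda>x. sqrt (- det (G x)))"
    by (rule smooth_on_sqrt[OF S _ smooth_on_minus[OF S det]]) (simp add: G)
  then have vol: "smooth_on S (\<lambda>x. sqrt \<bar>det (G x)\<bar>)"
    by (rule smooth_on_cong[OF S, rotated]) (use G(2) in \<open>simp add: abs_of_neg\<close>)
  have \<beta>n: "smooth_on S (\<lambda>x. \<beta> x $ k $ l)" for k l by (intro smooth_on_nth S \<beta>)
  have "smooth_on S (\<lambda>x. matrix_inv (G x) $ a $ k)" for a k
    by (rule smooth_on_matrix_inv[OF S G(1)]) (use G(2) in force)
  then show "smooth_on S (\<lambda>x. hodge (G x) (\<beta> x) $ i $ j)"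
    unfolding hodge_def vec_lambda_beta
    by (intro smooth_on_sum smooth_on_scaleR smooth_on_mult smooth_on_const vol \<beta>n S)
qed

lemma cov_d_cong:
  assumes "open S" "x \<in> S" "\<And>y. y \<in> S \<Longrightarrow> w y = v y"
  shows "cov_d a w x = cov_d a v x"
  using dform2_cong[OF assms] assms(2,3) by (simp add: cov_d_def)

lemma dform1_minus:
  assumes "open S" "smooth_on S a" "x \<in> S"
  shows "dform1 (\<lambda>x. - a x) x = - dform1 a x"
proof -
  have "partial i (\<lambda>x. - a x $ j) x = - partial i (\<lambda>x. a x $ j) x" for i j
    by (rule partial_linear[OF bounded_linear_minus[OF bounded_linear_ident] assms(1) _ assms(3)])
      (intro smooth_on_nth assms)
  then show ?thesis by (simp add: dform1_def vec_eq_iff)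
qed

lemma wedge11_uminus: "wedge11 (**) (- a) (- b) = wedge11 (**) a (b :: cmat2 ^ 4)"
  by (simp add: wedge11_def vec_eq_iff matrix_matrix_mult_def sum_2)

lemma wedge12_uminus: "wedge12 commutator (- a) w = - wedge12 commutator a w"
  by (simp add: wedge12_def vec_eq_iff)

lemma phi_0 [simp]: "phi 0 = 0"
  using linear_0[OF linear_phi] .

text \<open>By the Bianchi identity both \<open>w\<close> and its conjugate are covariantly constant for \<open>a\<close>; conjugating
  the equation for \<open>w\<close> gives one for the conjugate potential, and injectivity of the adjoint
  action identifies the two potentials.\<close>

lemma potential_real:
  assumes S: "open S" and a: "smooth_on S a" "\<And>y i. y \<in> S \<Longrightarrow> a y $ i \<in> sl2" and w: "smooth_on S w"
    and F: "\<And>y. y \<in> S \<Longrightarrow> w y + cj (w y) = dform1 a y + wedge11 (**) (a y) (a y)"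
    and D: "\<And>y. y \<in> S \<Longrightarrow> cov_d a w y = 0" and x: "x \<in> S" and nd: "nondegenerate (w x)"
  shows "cov_d a (\<lambda>y. cj (w y)) x = 0" "cj1 (a x) = a x"
proof -
  have "cov_d a (\<lambda>y. w y + cj (w y)) x = 0" by (rule bianchi[OF S a(1) x F])
  then show D': "cov_d a (\<lambda>y. cj (w y)) x = 0"
    using cov_d_add[OF S w smooth_on_cj[OF S w] x] D[OF x] by simp
  have "cov_d (\<lambda>x. cj1 (a x)) (\<lambda>x. cj (w x)) x = 0"
    unfolding cov_d_cj[OF S w x] D[OF x] by (simp add: vec_eq_iff)
  \<comment> \<open>Both equations contain the same exterior derivative, so subtracting leaves a
    comparison of brackets with the two potentials.\<close>
  with D' have eq: "wedge12 commutator (cj1 (a x)) (cj (w x)) = wedge12 commutator (a x) (cj (w x))"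
    by (simp add: cov_d_def) (metis add_left_cancel)
  have conj: "(\<chi> i j k. phi (wedge12 commutator b v $ i $ j $ k)) = wedge12 commutator (cj1 b) (cj v)" for b v
    by (simp add: wedge12_def vec_eq_iff cj1_def phi_commutator linear_add[OF linear_phi])
  have cc: "cj1 (cj1 b) = b" "cj (cj v) = v" for b v
    by (simp_all add: vec_eq_iff cj1_def)
  have "wedge12 commutator (a x) (w x) = wedge12 commutator (cj1 (a x)) (w x)"
    using arg_cong[OF eq, of "\<lambda>v. \<chi> i j k. phi (v $ i $ j $ k)"] unfolding conj cc .
  then have "a x = cj1 (a x)"
    by (rule nondegenerate_inject[OF nd _ _, rotated 2]) (use a(2)[OF x] phi_sl2 in \<open>auto simp: cj1_def\<close>)
  then show "cj1 (a x) = a x" ..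
qed

section \<open>Chiral forms and their conjugates\<close>

lemma cj_0 [simp]: "cj 0 = 0"
  by (simp add: vec_eq_iff[of "cj 0"] vec_eq_iff[of "cj 0 $ _"])

lemma csc2_0 [simp]: "csc2 c 0 = 0"
  by (simp add: vec_eq_iff)

lemma hodge_add: "hodge G (\<alpha> + \<beta>) = hodge G \<alpha> + hodge G \<beta>"
  by (simp add: hodge_def vec_eq_iff scaleR_add_right sum.distrib)

lemma hodge_csc2: "hodge G (csc2 c \<alpha>) = csc2 c (hodge G \<alpha>)"
  using hodge_linear_map[OF linear_cscale] by (simp add: vec_eq_iff csc2_def)

lemma hodge_0: "hodge G 0 = 0"
  by (simp add: hodge_def vec_eq_iff)

lemma cj_add: "cj (\<alpha> + \<beta>) = cj \<alpha> + cj \<beta>"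
  by (simp add: vec_eq_iff linear_add[OF linear_phi])

lemma cj_csc2: "cj (csc2 c \<alpha>) = csc2 (cnj c) (cj \<alpha>)"
  by (simp add: vec_eq_iff phi_nth)

lemma hodge_chiral:
  assumes "dual_form \<i> G \<alpha>"
  shows "hodge G (\<alpha> + cj \<alpha>) = csc2 \<i> \<alpha> + csc2 (- \<i>) (cj \<alpha>)"
  using assms dual_form_cj[OF assms] by (simp add: dual_form_def hodge_add)

text \<open>Fixing one pair of indices leaves a linear functional applied to the values of the other
  form; such functionals commute with the star and preserve antisymmetry.\<close>

lemma trace_tensor_in_Lambda:
  assumes "dual_form \<i> G \<alpha>" "dual_form (- \<i>) G \<beta>"
  shows "- trace_tensor \<alpha> \<beta> \<in> Lambda_plus_minus G"
proof -
  have lin: "linear (\<lambda>X. - tr2 X Y)" "linear (\<lambda>X. - tr2 Y X)" for Y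
    using linear_compose_neg[OF linear_tr2(2)[of Y]] linear_compose_neg[OF linear_tr2(1)[of Y]] by simp_all
  have alt: "alternating2 (\<chi> i j. f (\<gamma> $ i $ j))" if "linear f" "alternating2 \<gamma>"
    for f :: "cmat2 \<Rightarrow> complex" and \<gamma>
    using that linear_neg[OF that(1)] unfolding alternating2_def by (metis (no_types, lifting) vec_lambda_beta)
  show ?thesis
    unfolding Lambda_plus_minus_def Lambda_plus_def Lambda_minus_def
  proof (intro CollectI conjI allI)
    fix n k
    have eq: "(\<chi> m l. (- trace_tensor \<alpha> \<beta>) $ m $ l $ n $ k) = (\<chi> m l. - tr2 (\<alpha> $ m $ l) (\<beta> $ n $ k))"
      by (simp add: trace_tensor_def tr2_def)
    show "alternating2 (\<chi> m l. (- trace_tensor \<alpha> \<beta>) $ m $ l $ n $ k)"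
      unfolding eq using alt[OF lin(1)] assms(1) by (simp add: dual_form_def)
    fix i j
    show "hodge G (\<chi> m l. (- trace_tensor \<alpha> \<beta>) $ m $ l $ n $ k) $ i $ j
      = \<i> * (\<chi> m l. (- trace_tensor \<alpha> \<beta>) $ m $ l $ n $ k) $ i $ j"
      unfolding eq hodge_linear_map[OF lin(1), symmetric] using assms(1) by (simp add: dual_form_def)
  next
    fix m l
    have eq: "(- trace_tensor \<alpha> \<beta>) $ m $ l = (\<chi> n k. - tr2 (\<alpha> $ m $ l) (\<beta> $ n $ k))"
      by (simp add: trace_tensor_def tr2_def vec_eq_iff)
    show "alternating2 ((- trace_tensor \<alpha> \<beta>) $ m $ l)"
      unfolding eq using alt[OF lin(2)] assms(2) by (simp add: dual_form_def)
    fix i j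
    show "hodge G ((- trace_tensor \<alpha> \<beta>) $ m $ l) $ i $ j = - \<i> * (- trace_tensor \<alpha> \<beta>) $ m $ l $ i $ j"
      unfolding eq hodge_linear_map[OF lin(2), symmetric] using assms(2) by (simp add: dual_form_def)
  qed
qed

text \<open>Membership in the fibre is automatic for a trace tensor of this kind, and the remaining
  equation is \<open>em_tensor_chiral\<close>. This bridge serves both directions of the
  equivalence.\<close>

lemma corresponds_iff:
  assumes "lorentzian G" "dual_form \<i> G \<alpha>"
  shows "corresponds G t (- trace_tensor \<alpha> (cj \<alpha>)) \<longleftrightarrow>
    (\<forall>m n. em_tensor G (\<alpha> + cj \<alpha>) $ m $ n = complex_of_real (t $ m $ n))"
proof -
  have d: "dual_form (- \<i>) G (cj \<alpha>)" using dual_form_cj[OF assms(2)] by simp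
  show ?thesis
    unfolding corresponds_def em_tensor_chiral[OF assms d]
    using trace_tensor_in_Lambda[OF assms(2) d] by (simp add: vec_eq_iff)
qed

section \<open>From the Rainich condition to Yang-Mills fields\<close>

lemma coord_point:
  assumes "is_chart c" "p \<in> U \<inter> chart_dom c"
  shows "coord c p \<in> coord c ` (U \<inter> chart_dom c)" "coord_inv c (coord c p) = p"
  using assms(2) coord_inv_coord[OF assms(1)] by blast+

lemma smooth_fieldD:
  "smooth_field M U \<alpha> \<Longrightarrow> c \<in> charts M \<Longrightarrow> smooth_on (coord c ` (U \<inter> chart_dom c)) (\<lambda>x. \<alpha> c (coord_inv c x))"
  by (simp add: smooth_field_def)

lemma real_part_forms2:
  assumes M: "is_spacetime M" and U: "open U" and \<omega>: "\<omega> \<in> forms2 M U sl2"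
  shows "(\<lambda>c p. \<omega> c p + conj2 \<omega> c p) \<in> forms2 M U su2"
proof -
  note \<omega> = forms2D[OF \<omega>]
  have "off_zero M U (\<lambda>c p. \<omega> c p + cj (\<omega> c p))"
    unfolding off_zero_def
  proof (intro allI impI)
    fix c p assume "\<not> (c \<in> charts M \<and> p \<in> U \<inter> chart_dom c)"
    then have "\<omega> c p = 0" using \<omega>(1) unfolding off_zero_def by blast
    then show "\<omega> c p + cj (\<omega> c p) = 0" by simp
  qed
  moreover have "covariant pull2 M U (\<lambda>c p. \<omega> c p + cj (\<omega> c p))"
    unfolding covariant_def
  proof (intro ballI)
    fix c c' p assume "c \<in> charts M" "c' \<in> charts M" "p \<in> U \<inter> chart_dom c \<inter> chart_dom c'"
    then have "\<omega> c p = pull2 (jacobian c c' p) (\<omega> c' p)" using \<omega>(2) unfolding covariant_def by blast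
    then show "\<omega> c p + cj (\<omega> c p) = pull2 (jacobian c c' p) (\<omega> c' p + cj (\<omega> c' p))"
      by (simp only: pull2_add cj_pull2)
  qed
  moreover have "smooth_field M U (\<lambda>c p. \<omega> c p + cj (\<omega> c p))"
    unfolding smooth_field_def
    using smooth_fieldD[OF \<omega>(3)] open_coord_image[OF spacetime_chart[OF M] U]
    by (auto intro!: smooth_on_add smooth_on_cj)
  moreover have "alternating2 (\<omega> c p + cj (\<omega> c p))" for c p
  proof -
    have "\<omega> c p $ i $ j = - \<omega> c p $ j $ i" for i j using \<omega>(4)[of c p] unfolding alternating2_def by blast
    then have "(\<omega> c p + cj (\<omega> c p)) $ i $ j = - (\<omega> c p + cj (\<omega> c p)) $ j $ i" for i j
      by (metis (no_types, lifting) cj_nth linear_neg[OF linear_phi] minus_add_distrib vector_add_component)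
    then show ?thesis unfolding alternating2_def by blast
  qed
  moreover have "(\<omega> c p + cj (\<omega> c p)) $ i $ j \<in> su2" for c p i j
    using \<omega>(5)[of c p i j] phi_sl2[OF \<omega>(5)[of c p i j]]
    by (simp add: su2_def subspace_add[OF subspace_sl2] linear_add[OF linear_phi] add.commute)
  ultimately show ?thesis unfolding forms2_def conj2_cj by blast
qed

lemma covariant_pull1_uminus:
  assumes "covariant pull1 M U \<alpha>"
  shows "covariant pull1 M U (\<lambda>c p. - \<alpha> c p)"
  using assms unfolding covariant_def
  by (metis (no_types, lifting) pull1_uminus)

lemma rainich_yang_mills:
  assumes M: "is_spacetime M" and U: "open U" and sq: "internal_sqrt M U T \<omega>" and R: "rainich M U \<omega>"
    and nd: "\<And>c p. c \<in> charts M \<Longrightarrow> p \<in> U \<inter> chart_dom c \<Longrightarrow> nondegenerate (\<omega> c p)"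
  shows "yang_mills_field M U (\<lambda>c p. \<omega> c p + conj2 \<omega> c p)"
proof -
  have \<omega>: "\<omega> \<in> forms2 M U sl2" using sq by (simp add: internal_sqrt_def)
  note \<omega>s = forms2D[OF \<omega>]
  define B where "B = ad_inv M U \<omega> (ext_d2 M U \<omega>)"
  \<comment> \<open>Surjectivity ensures that \<open>inv_into\<close> yields an actual solution B
    and not an arbitrary value.\<close>
  have "ext_d2 M U \<omega> \<in> ad \<omega> ` forms1 M U sl2"
    using bij_betw_imp_surj_on[OF bij_betw_ad[OF M U \<omega> nd]] ext_d2_in_forms3[OF M U \<omega>] by simp
  then have B: "B \<in> forms1 M U sl2" and adB: "ad \<omega> B = ext_d2 M U \<omega>"
    unfolding B_def ad_inv_def by (rule inv_into_into, rule f_inv_into_f)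
  note Bs = forms1D[OF B]
  define A where "A = (\<lambda>c p. - B c p)"
  have main: "cj1 (A c p) = A c p"
      "\<omega> c p + cj (\<omega> c p) = curvature M U A c p"
      "cov_d2 M U A (hodge_star M (\<lambda>c p. \<omega> c p + cj (\<omega> c p))) c p = 0"
    if c: "c \<in> charts M" and p: "p \<in> U \<inter> chart_dom c" for c p
  proof -
    note ch = spacetime_chart[OF M c]
    let ?S = "coord c ` (U \<inter> chart_dom c)"
    note S = open_coord_image[OF ch U]
    let ?b = "\<lambda>x. B c (coord_inv c x)" and ?a = "\<lambda>x. A c (coord_inv c x)" and ?w = "\<lambda>x. \<omega> c (coord_inv c x)"
    note w = smooth_fieldD[OF \<omega>s(3) c] and b = smooth_fieldD[OF Bs(3) c]
    have a: "smooth_on ?S ?a" unfolding A_def by (rule smooth_on_minus[OF S b])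
    have pt: "coord_inv c y \<in> U \<inter> chart_dom c" "coord c (coord_inv c y) = y" if "y \<in> ?S" for y
      using that coord_image_iff[OF ch] by auto
    \<comment> \<open>Replacing B by A = -B changes the sign of the exterior derivative but not of
      the quadratic term.\<close>
    have F: "?w y + cj (?w y) = dform1 ?a y + wedge11 (**) (?a y) (?a y)" if y: "y \<in> ?S" for y
    proof -
      have "ext_d1 M U B c (coord_inv c y) + ?w y + cj (?w y) = wedge11 (**) (?b y) (?b y)"
        using R c pt(1)[OF y] unfolding rainich_def B_def[symmetric] conj2_cj by blast
      then have "dform1 ?b y + ?w y + cj (?w y) = wedge11 (**) (?b y) (?b y)"
        unfolding ext_d1_coord[OF c pt(1)[OF y]] pt(2)[OF y] .
      then show ?thesis
        using dform1_minus[OF S b y] by (simp add: A_def wedge11_uminus algebra_simps)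
    qed
    have D: "cov_d ?a ?w y = 0" if y: "y \<in> ?S" for y
    proof -
      have "dform2 ?w y = wedge12 commutator (?b y) (?w y)"
        using ext_d2_coord[OF c pt(1)[OF y], of \<omega>] fun_cong[OF fun_cong[OF adB, of c], of "coord_inv c y"] pt[OF y]
        by (simp add: ad_def bracket12_def)
      then show ?thesis by (simp add: cov_d_def A_def wedge12_uminus)
    qed
    have sl: "?a y $ i \<in> sl2" for y i using Bs(4) by (simp add: A_def sl2_iff)
    note x = coord_point[OF ch p]
    have real: "cov_d ?a (\<lambda>y. cj (?w y)) z = 0" "cj1 (?a z) = ?a z" if "z \<in> ?S" "nondegenerate (?w z)" for z
      by (rule potential_real[of ?S ?a ?w, OF S a _ w]; (rule sl F D that)?; assumption?)+
    show "cj1 (A c p) = A c p" using real(2)[OF x(1)] nd[OF c p] x(2) by simp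
    show "\<omega> c p + cj (\<omega> c p) = curvature M U A c p"
      using F[OF x(1)] x(2) ext_d1_coord[OF c p, of A] by (simp add: curvature_def)
    have "cov_d2 M U A (hodge_star M (\<lambda>c p. \<omega> c p + cj (\<omega> c p))) c p
      = cov_d ?a (\<lambda>y. hodge (metric M c (coord_inv c y)) (?w y + cj (?w y))) (coord c p)"
      unfolding cov_d2_coord[OF ch c p] hodge_star_def ..
    \<comment> \<open>The star multiplies the two chiral parts by \<i> and -\<i>, so the Yang-Mills
      equation follows from the covariant constancy of each part.\<close>
    also have "\<dots> = cov_d ?a (\<lambda>y. csc2 \<i> (?w y) + csc2 (- \<i>) (cj (?w y))) (coord c p)"
      by (rule cov_d_cong[OF S x(1)]) (intro hodge_chiral internal_sqrt_dual_form[OF sq c] pt)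
    also have "\<dots> = 0"
    proof -
      have "cov_d ?a (\<lambda>y. cj (?w y)) (coord c p) = 0"
        using real(1)[OF x(1)] nd[OF c p] x(2) by simp
      then show ?thesis
        using D[OF x(1)]
        by (simp add: cov_d_add[OF S smooth_on_csc2[OF S w] smooth_on_csc2[OF S smooth_on_cj[OF S w]] x(1)]
            cov_d_csc2[OF S w x(1)] cov_d_csc2[OF S smooth_on_cj[OF S w] x(1)] vec_eq_iff)
    qed
    finally show "cov_d2 M U A (hodge_star M (\<lambda>c p. \<omega> c p + cj (\<omega> c p))) c p = 0" .
  qed
  have zero: "A c p = 0" if "\<not> (c \<in> charts M \<and> p \<in> U \<inter> chart_dom c)" for c p
  proof -
    have "B c p = 0" using Bs(1) that unfolding off_zero_def by blast
    then show ?thesis by (simp add: A_def)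
  qed
  have "covariant pull1 M U A" unfolding A_def by (rule covariant_pull1_uminus[OF Bs(2)])
  moreover have "smooth_field M U A"
    using smooth_fieldD[OF Bs(3)] open_coord_image[OF spacetime_chart[OF M] U]
    unfolding smooth_field_def A_def by (auto intro!: smooth_on_minus)
  moreover have "A c p $ i \<in> su2" for c p i
  proof (cases "c \<in> charts M \<and> p \<in> U \<inter> chart_dom c")
    case True
    then have "phi (A c p $ i) = A c p $ i" using arg_cong[OF main(1), of c p "\<lambda>v. v $ i"] by (simp add: cj1_def)
    moreover have "A c p $ i \<in> sl2" using Bs(4)[of c p i] by (simp add: A_def sl2_iff)
    ultimately show ?thesis by (simp add: su2_def)
  qed (simp add: zero su2_def sl2_iff)
  ultimately have "A \<in> forms1 M U su2" using zero unfolding forms1_def off_zero_def by blast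
  then show ?thesis
    unfolding yang_mills_field_def using real_part_forms2[OF M U \<omega>] main(2,3) by (auto simp: conj2_cj)
qed

lemma internal_sqrt_em_tensor:
  assumes "is_spacetime M" "internal_sqrt M U T \<omega>"
  shows "has_em_tensor M U (\<lambda>c p. \<omega> c p + conj2 \<omega> c p) T"
  unfolding has_em_tensor_def
proof (intro ballI)
  fix c p assume cp: "c \<in> charts M" "p \<in> U \<inter> chart_dom c"
  then have "corresponds (metric M c p) (T c p) (- trace_tensor (\<omega> c p) (cj (\<omega> c p)))"
    using assms(2) by (simp add: internal_sqrt_def conj2_cj)
  then show "\<forall>m n. em_tensor (metric M c p) (\<omega> c p + conj2 \<omega> c p) $ m $ n = complex_of_real (T c p $ m $ n)"
    using corresponds_iff[OF spacetime_lorentzian[OF assms(1)] internal_sqrt_dual_form[OF assms(2)]] cp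
    by (simp add: conj2_cj)
qed

section \<open>From Yang-Mills fields to internal square roots\<close>

definition self_dual_part :: "('m, 'z) spacetime_scheme \<Rightarrow> ('m, cmat2 ^ 4 ^ 4) field \<Rightarrow> ('m, cmat2 ^ 4 ^ 4) field" where
  "self_dual_part M F = (\<lambda>c p. csc2 (1 / 2) (F c p + csc2 (- \<i>) (hodge_star M F c p)))"

lemma cj_su2: "(\<And>i j. \<alpha> $ i $ j \<in> su2) \<Longrightarrow> cj \<alpha> = \<alpha>"
  by (simp add: vec_eq_iff[of _ \<alpha>] vec_eq_iff[of "_ $ _"] su2_def)

text \<open>The star squares to -1, so (1 - \<i> star)/2 projects onto its eigenvalue \<i>. For real
  F conjugation turns this projection into the complementary one, and the two add up to F.\<close>

lemma self_dual_part_pointwise: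
  assumes "cj (F c p) = F c p"
  shows "self_dual_part M F c p + cj (self_dual_part M F c p) = F c p"
    and "lorentzian (metric M c p) \<Longrightarrow> alternating2 (F c p) \<Longrightarrow> dual_form \<i> (metric M c p) (self_dual_part M F c p)"
proof -
  let ?h = "hodge (metric M c p) (F c p)"
  have def: "self_dual_part M F c p = csc2 (1 / 2) (F c p + csc2 (- \<i>) ?h)"
    by (simp add: self_dual_part_def hodge_star_def)
  have "cj ?h = ?h" by (simp add: cj_hodge assms)
  then have "cj (self_dual_part M F c p) = csc2 (1 / 2) (F c p + csc2 \<i> ?h)"
    by (simp add: def cj_csc2 cj_add assms)
  then show "self_dual_part M F c p + cj (self_dual_part M F c p) = F c p"
    by (simp add: def vec_eq_iff field_simps)
  assume L: "lorentzian (metric M c p)" and alt: "alternating2 (F c p)"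
  have alts: "\<alpha> $ j $ i = - \<alpha> $ i $ j" if "alternating2 \<alpha>" for \<alpha> :: "cmat2 ^ 4 ^ 4" and i j
    using that unfolding alternating2_def by blast
  have "alternating2 (self_dual_part M F c p)"
    unfolding alternating2_def
  proof (intro allI)
    fix i j
    show "self_dual_part M F c p $ i $ j = - self_dual_part M F c p $ j $ i"
      using alts[OF alt, of i j] alts[OF alternating2_hodge, of "metric M c p" "F c p" i j]
      by (simp add: def vec_eq_iff algebra_simps)
  qed
  moreover have "hodge (metric M c p) (self_dual_part M F c p) = csc2 \<i> (self_dual_part M F c p)"
    by (simp add: def hodge_csc2 hodge_add hodge_hodge[OF L alt] vec_eq_iff field_simps)
  ultimately show "dual_form \<i> (metric M c p) (self_dual_part M F c p)" by (simp add: dual_form_def)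
qed

lemma self_dual_part_forms2:
  assumes M: "is_spacetime M" and U: "open U" "U \<subseteq> points M" and F: "F \<in> forms2 M U su2"
  shows "self_dual_part M F \<in> forms2 M U sl2"
proof -
  note Fs = forms2D[OF F]
  have def: "self_dual_part M F c p = csc2 (1 / 2) (F c p + csc2 (- \<i>) (hodge (metric M c p) (F c p)))" for c p
    by (simp add: self_dual_part_def hodge_star_def)
  have off: "off_zero M U (self_dual_part M F)"
    unfolding off_zero_def
  proof (intro allI impI)
    fix c p assume "\<not> (c \<in> charts M \<and> p \<in> U \<inter> chart_dom c)"
    then have "F c p = 0" using Fs(1) unfolding off_zero_def by blast
    then show "self_dual_part M F c p = 0" by (simp add: def hodge_0)
  qed
  have "covariant pull2 M U (self_dual_part M F)"
    unfolding covariant_def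
  proof (intro ballI)
    fix c c' p assume c: "c \<in> charts M" "c' \<in> charts M" "p \<in> U \<inter> chart_dom c \<inter> chart_dom c'"
    let ?J = "jacobian c c' p"
    have p: "p \<in> chart_dom c \<inter> chart_dom c'" using c by blast
    have FJ: "F c p = pull2 ?J (F c' p)" using Fs(2) c unfolding covariant_def by blast
    have G: "metric M c p = pull2 ?J (metric M c' p)" by (rule metric_pull2[OF M c(1,2) p])
    have iG: "invertible (metric M c' p)"
      using lorentzian_imp(2) spacetime_lorentzian[OF M c(2)] p by blast
    \<comment> \<open>The star commutes with this pullback because transition maps of the oriented
      atlas have positive Jacobian determinant.\<close>
    show "self_dual_part M F c p = pull2 ?J (self_dual_part M F c' p)"
      unfolding def FJ G hodge_pull2[OF iG jacobian_det_pos[OF M c(1,2) p]] csc2_pull2 pull2_add[symmetric] ..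
  qed
  moreover have "smooth_field M U (self_dual_part M F)"
    unfolding smooth_field_def
  proof
    fix c assume c: "c \<in> charts M"
    note ch = spacetime_chart[OF M c] and S = open_coord_image[OF spacetime_chart[OF M c] U(1)]
    have "smooth_field M (points M) (metric M)" using M unfolding is_spacetime_def by blast
    then have G: "smooth_on (coord c ` (U \<inter> chart_dom c)) (\<lambda>x. metric M c (coord_inv c x))"
      using smooth_fieldD[OF _ c] smooth_on_subset[of "coord c ` (U \<inter> chart_dom c)" "coord c ` (points M \<inter> chart_dom c)"]
        U(2) by (metis Int_mono image_mono order_refl)
    have det: "det (metric M c (coord_inv c x)) < 0" if "x \<in> coord c ` (U \<inter> chart_dom c)" for x
      using lorentzian_imp(1) spacetime_lorentzian[OF M c] that coord_image_iff[OF ch] by blast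
    show "smooth_on (coord c ` (U \<inter> chart_dom c)) (\<lambda>x. self_dual_part M F c (coord_inv c x))"
      unfolding def using det by (intro smooth_on_csc2 smooth_on_add smooth_on_hodge G smooth_fieldD[OF Fs(3) c] S)
  qed
  moreover have "alternating2 (self_dual_part M F c p)" for c p
  proof (cases "c \<in> charts M \<and> p \<in> U \<inter> chart_dom c")
    case True
    then have "dual_form \<i> (metric M c p) (self_dual_part M F c p)"
      using Fs(4,5) spacetime_lorentzian[OF M]
      by (intro self_dual_part_pointwise(2) cj_su2) auto
    then show ?thesis by (simp add: dual_form_def)
  next
    case False
    then have "self_dual_part M F c p = 0" using off unfolding off_zero_def by blast
    then show ?thesis by (simp add: alternating2_def)
  qed
  moreover have "self_dual_part M F c p $ i $ j \<in> sl2" for c p i j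
  proof -
    have sl: "F c p $ k $ l \<in> sl2" for k l using Fs(5)[of c p k l] by (simp add: su2_def)
    have "hodge (metric M c p) (F c p) $ i $ j \<in> sl2"
      unfolding hodge_def vec_lambda_beta
      by (intro subspace_sum[OF subspace_sl2] subspace_scale[OF subspace_sl2] sl)
    then show ?thesis unfolding def using sl[of i j] by (simp add: cscale_sl2 subspace_add[OF subspace_sl2])
  qed
  ultimately show ?thesis using off unfolding forms2_def by blast
qed

lemma yang_mills_internal_sqrt:
  assumes M: "is_spacetime M" and U: "open U" "U \<subseteq> points M"
    and F: "F \<in> forms2 M U su2" and em: "has_em_tensor M U F T"
  shows "internal_sqrt M U T (self_dual_part M F)"
  unfolding internal_sqrt_def
proof (intro conjI)
  let ?\<omega> = "self_dual_part M F"
  note Fs = forms2D[OF F]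
  show "?\<omega> \<in> forms2 M U sl2" by (rule self_dual_part_forms2[OF M U F])
  have d: "dual_form \<i> (metric M c p) (?\<omega> c p)" if "c \<in> charts M" "p \<in> U \<inter> chart_dom c" for c p
    using that Fs(4,5) spacetime_lorentzian[OF M] by (intro self_dual_part_pointwise(2) cj_su2) auto
  show "self_dual M U ?\<omega>"
    unfolding self_dual_def hodge_star_def using d by (auto simp: dual_form_def)
  show "\<forall>c\<in>charts M. \<forall>p\<in>U \<inter> chart_dom c.
      corresponds (metric M c p) (T c p) (- trace_tensor (?\<omega> c p) (conj2 ?\<omega> c p))"
  proof (intro ballI)
    fix c p assume cp: "c \<in> charts M" "p \<in> U \<inter> chart_dom c"
    have F: "?\<omega> c p + cj (?\<omega> c p) = F c p"
      by (rule self_dual_part_pointwise(1)) (rule cj_su2, rule Fs(5))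
    have L: "lorentzian (metric M c p)" using spacetime_lorentzian[OF M] cp by blast
    show "corresponds (metric M c p) (T c p) (- trace_tensor (?\<omega> c p) (conj2 ?\<omega> c p))"
      unfolding conj2_cj corresponds_iff[OF L d[OF cp]] F using em cp unfolding has_em_tensor_def by blast
  qed
qed

lemma yang_mills_rainich:
  assumes M: "is_spacetime M" and U: "open U" "U \<subseteq> points M" and ym: "yang_mills_field M U F"
    and nd: "\<And>c p. c \<in> charts M \<Longrightarrow> p \<in> U \<inter> chart_dom c \<Longrightarrow> nondegenerate (self_dual_part M F c p)"
  shows "rainich M U (self_dual_part M F)"
proof -
  let ?\<omega> = "self_dual_part M F"
  obtain A where F: "F \<in> forms2 M U su2" and A: "A \<in> forms1 M U su2"
    and curv: "\<And>c p. c \<in> charts M \<Longrightarrow> p \<in> U \<inter> chart_dom c \<Longrightarrow> F c p = curvature M U A c p"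
    and YM: "\<And>c p. c \<in> charts M \<Longrightarrow> p \<in> U \<inter> chart_dom c \<Longrightarrow> cov_d2 M U A (hodge_star M F) c p = 0"
    using ym unfolding yang_mills_field_def by blast
  note Fs = forms2D[OF F] and As = forms1D[OF A]
  have \<omega>: "?\<omega> \<in> forms2 M U sl2" by (rule self_dual_part_forms2[OF M U F])
  define B where "B = (\<lambda>c p. - A c p)"
  have "off_zero M U B" using As(1) by (simp add: off_zero_def B_def)
  moreover have "covariant pull1 M U B" unfolding B_def by (rule covariant_pull1_uminus[OF As(2)])
  moreover have "smooth_field M U B"
    using smooth_fieldD[OF As(3)] open_coord_image[OF spacetime_chart[OF M] U(1)]
    unfolding smooth_field_def B_def by (auto intro!: smooth_on_minus)
  moreover have "B c p $ i \<in> sl2" for c p i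
    using As(4)[of c p i] by (simp add: B_def su2_def sl2_iff)
  ultimately have B: "B \<in> forms1 M U sl2" unfolding forms1_def by blast
  have local: "dform2 (\<lambda>x. ?\<omega> c (coord_inv c x)) (coord c p) = wedge12 commutator (B c p) (?\<omega> c p)"
      "dform1 (\<lambda>x. B c (coord_inv c x)) (coord c p) + F c p = wedge11 (**) (B c p) (B c p)"
    if c: "c \<in> charts M" and p: "p \<in> U \<inter> chart_dom c" for c p
  proof -
    note ch = spacetime_chart[OF M c]
    let ?S = "coord c ` (U \<inter> chart_dom c)"
    note S = open_coord_image[OF ch U(1)] and x = coord_point[OF ch p]
    let ?a = "\<lambda>x. A c (coord_inv c x)" and ?f = "\<lambda>x. F c (coord_inv c x)"
      and ?h = "\<lambda>x. hodge_star M F c (coord_inv c x)"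
    note a = smooth_fieldD[OF As(3) c] and f = smooth_fieldD[OF Fs(3) c]
    have w: "smooth_on ?S (\<lambda>x. ?\<omega> c (coord_inv c x))" by (rule smooth_fieldD[OF forms2D(3)[OF \<omega>] c])
    have pt: "coord_inv c y \<in> U \<inter> chart_dom c" "coord c (coord_inv c y) = y" if "y \<in> ?S" for y
      using that coord_image_iff[OF ch] by auto
    have Feq: "?f y = dform1 ?a y + wedge11 (**) (?a y) (?a y)" if y: "y \<in> ?S" for y
      using curv[OF c pt(1)[OF y]] ext_d1_coord[OF c pt(1)[OF y], of A] pt(2)[OF y]
      by (simp add: curvature_def)
    have DF: "cov_d ?a ?f (coord c p) = 0" by (rule bianchi[OF S a x(1) Feq])
    have Dh: "cov_d ?a ?h (coord c p) = 0" using YM[OF c p] unfolding cov_d2_coord[OF ch c p] .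
    have h: "smooth_on ?S ?h"
    proof -
      \<comment> \<open>Solving the definition of the self-dual part for the star gives star F = 2
        \<i> \<omega> - \<i> F, so smoothness of star F follows from that of \<omega> and F.\<close>
      have "?h = (\<lambda>x. csc2 (2 * \<i>) (?\<omega> c (coord_inv c x)) + csc2 (- \<i>) (?f x))"
        by (rule ext) (simp add: self_dual_part_def vec_eq_iff field_simps)
      then show ?thesis using S w f by (auto intro!: smooth_on_add smooth_on_csc2)
    qed
    \<comment> \<open>The Bianchi identity covers F and the Yang-Mills equation star F; the
      self-dual part is a constant complex combination of the two.\<close>
    have "cov_d ?a (\<lambda>x. ?\<omega> c (coord_inv c x)) (coord c p) = 0"
      unfolding self_dual_part_def using DF Dh
      by (simp add: cov_d_csc2[OF S smooth_on_add[OF S f smooth_on_csc2[OF S h]] x(1)]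
          cov_d_add[OF S f smooth_on_csc2[OF S h] x(1)] cov_d_csc2[OF S h x(1)] vec_eq_iff)
    then show "dform2 (\<lambda>x. ?\<omega> c (coord_inv c x)) (coord c p) = wedge12 commutator (B c p) (?\<omega> c p)"
      by (simp add: cov_d_def x(2) B_def wedge12_uminus add_eq_0_iff2)
    show "dform1 (\<lambda>x. B c (coord_inv c x)) (coord c p) + F c p = wedge11 (**) (B c p) (B c p)"
      using Feq[OF x(1)] dform1_minus[OF S a x(1)] x(2) by (simp add: B_def wedge11_uminus)
  qed
  have "ad ?\<omega> B = ext_d2 M U ?\<omega>"
  proof (rule field_eqI)
    show "off_zero M U (ad ?\<omega> B)" using forms3D(1)[OF ad_in_forms3[OF M U(1) \<omega> B]] .
    show "off_zero M U (ext_d2 M U ?\<omega>)" using forms3D(1)[OF ext_d2_in_forms3[OF M U(1) \<omega>]] .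
    show "ad ?\<omega> B c p = ext_d2 M U ?\<omega> c p" if "c \<in> charts M" "p \<in> U \<inter> chart_dom c" for c p
      using local(1)[OF that] ext_d2_coord[OF that, of ?\<omega>] by (simp add: ad_def bracket12_def)
  qed
  \<comment> \<open>Injectivity of \<open>ad\<close> makes B the only preimage, hence the value
    chosen by \<open>inv_into\<close>.\<close>
  then have "ad_inv M U ?\<omega> (ext_d2 M U ?\<omega>) = B"
    unfolding ad_inv_def using inv_into_f_f[OF bij_betw_imp_inj_on[OF bij_betw_ad[OF M U(1) \<omega> nd]] B] by simp
  moreover have "?\<omega> c p + cj (?\<omega> c p) = F c p" for c p
    by (rule self_dual_part_pointwise(1)) (rule cj_su2, rule Fs(5))
  ultimately show ?thesis
    unfolding rainich_def using local(2) by (simp add: ext_d1_coord conj2_cj add.assoc)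
qed

theorem theorem2p3:
  fixes M :: "'m::{t2_space, second_countable_topology} spacetime"
    and T :: "('m, real ^ 4 ^ 4) field"
  assumes "is_spacetime M"
    and "traceless_symmetric_tensor M T"
    and "strict_DEC M T"
  shows
    "(\<forall>U \<omega>. open U \<and> U \<subseteq> points M \<and> internal_sqrt M U T \<omega> \<longrightarrow>
        bij_betw (ad \<omega>) (forms1 M U sl2) (forms3 M U sl2)) \<and>
     ((\<forall>x\<in>points M. \<exists>U \<omega>. open U \<and> x \<in> U \<and> U \<subseteq> points M \<and>
         internal_sqrt M U T \<omega> \<and> rainich M U \<omega>)
      \<longleftrightarrow>
      (\<forall>x\<in>points M. \<exists>U F. open U \<and> x \<in> U \<and> U \<subseteq> points M \<and>
         yang_mills_field M U F \<and> has_em_tensor M U F T)) \<and>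
     (\<forall>U \<omega>. open U \<and> U \<subseteq> points M \<and> internal_sqrt M U T \<omega> \<and> rainich M U \<omega> \<longrightarrow>
        yang_mills_field M U (\<lambda>c p. \<omega> c p + conj2 \<omega> c p) \<and>
        has_em_tensor M U (\<lambda>c p. \<omega> c p + conj2 \<omega> c p) T)"
proof -
  note nd = internal_sqrt_nondegenerate[OF assms(1,3)]
  \<comment> \<open>This is the invertibility implicit in the notation for the inverse of
    \<open>ad\<close>; it holds for every internal square root, with or without the Rainich
    condition.\<close>
  have bij: "bij_betw (ad \<omega>) (forms1 M U sl2) (forms3 M U sl2)"
    if "open U" "internal_sqrt M U T \<omega>" for U \<omega>
    using that(2) by (intro bij_betw_ad[OF assms(1) that(1) _ nd[OF that(2)]]) (simp_all add: internal_sqrt_def)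
  have to_ym: "yang_mills_field M U (\<lambda>c p. \<omega> c p + conj2 \<omega> c p) \<and>
      has_em_tensor M U (\<lambda>c p. \<omega> c p + conj2 \<omega> c p) T"
    if "open U" "internal_sqrt M U T \<omega>" "rainich M U \<omega>" for U \<omega>
    using rainich_yang_mills[OF assms(1) that nd[OF that(2)]] internal_sqrt_em_tensor[OF assms(1) that(2)] by blast
  have from_ym: "internal_sqrt M U T (self_dual_part M F) \<and> rainich M U (self_dual_part M F)"
    if "open U" "U \<subseteq> points M" "yang_mills_field M U F" "has_em_tensor M U F T" for U F
  proof -
    have sq: "internal_sqrt M U T (self_dual_part M F)"
      using that(3) by (intro yang_mills_internal_sqrt[OF assms(1) that(1,2) _ that(4)]) (simp add: yang_mills_field_def)
    then show ?thesis using yang_mills_rainich[OF assms(1) that(1-3) nd[OF sq]] by blast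
  qed
  \<comment> \<open>Each direction keeps the open set U, so the local statements correspond
    neighbourhood by neighbourhood.\<close>
  show ?thesis using bij to_ym from_ym by meson
qed

end
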